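(* Let $V$ be a vertex operator algebra over $\mathbb{F}$ and $n\ge0$. The assignment $M\mapsto M(n)$ induces a bijection between isomorphism classes of irreducible $V$-modules $M=\bigoplus_{m\ge0}M(m)$ with $M(0)\ne0$ and $M(n)\neq 0$, and isomorphism classes of simple $A_n(V)$-modules which do not factor through $A_{n-1}(V)$. The inverse sends such a simple $A_n(V)$-module $U$ to an irreducible $V$-module $L_n(U)$ with $L_n(U)(0)\neq 0$ and $L_n(U)(n)\cong U$.
   Context: Standing assumptions: $\mathbb{F}$ is an algebraically closed field with $\mathrm{char}\,\mathbb{F}\neq 2$. $V$ is a vertex operator algebra over $\mathbb{F}$ ($\mathbb{Z}$-graded vertex algebra $V=\bigoplus_kV_k$ with finite-dimensional graded pieces, $V_k=0$ for $k\ll0$, Virasoro vector $\omega\in V_2$ with modes $L(k)$, $u_kv\in V_{s+t-k-1}$ for $u\in V_s,v\in V_t$, Virasoro relations, $\frac{d}{dz}Y(v,z)=Y(L(-1)v,z)$, $L(0)|_{V_k}=k$). $\deg a=s$ for $a\in V_s$; $(1+z)^k=\sum_{i\ge0}\binom ki z^i$. For $n\ge0$: $O_n(V)$ is the span of all $L(-1)a+L(0)a$ and all $a\circ^s_{n,t}b=\mathrm{Res}_z\,Y(a,z)b\,\frac{(1+z)^{\deg a+n+s}}{z^{2n+2+t}}$ ($a$ homogeneous, $0\le s\le t$); $A_n(V)=V/O_n(V)$, associative with product induced by $a*_nb=\sum_{j=0}^n(-1)^j\binom{j+n}{n}\mathrm{Res}_z\,Y(a,z)b\frac{(1+z)^{\deg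 a+n}}{z^{n+j+1}}$; $A_{n-1}(V)$ is a quotient of $A_n(V)$ (as $O_n(V)\subseteq O_{n-1}(V)$), and a module factors through $A_{n-1}(V)$ if $O_{n-1}(V)$ acts as zero ($A_{-1}(V):=0$). A $V$-module is a weak $V$-module $M$ (vertex operators $Y_M(v,z)=\sum v_kz^{-k-1}$, $u_lw=0$ for $l\gg0$, $Y_M(\mathbf 1,z)=\mathrm{id}$, Jacobi identity) with grading $M=\bigoplus_{m\ge0}M(m)$, $v_kM(m)\subseteq M(m+\deg v-k-1)$. $M(n)$ is an $A_n(V)$-module with $[a]$ acting by $o(a)=a_{\deg a-1}$. *)

theory Defs
  imports "HOL-Computational_Algebra.Polynomial" "HOL-Library.Function_Algebras"
begin

text \<open>Integer binomial coefficient binom(k,i) for k an integer, i.e. the coefficient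
  of z^i in (1+z)^k (expanded in nonnegative powers of z).\<close>
definition ibinom :: "int \<Rightarrow> nat \<Rightarrow> int" where
  "ibinom k i = (if 0 \<le> k then int (nat k choose i)
                 else (-1)^i * int ((i + nat (- k) - 1) choose i))"

definition sgnpow :: "int \<Rightarrow> int" where
  "sgnpow r = (if even r then 1 else -1)"

text \<open>Sum of an eventually vanishing sequence (formal residues are such sums).\<close>
definition fsum :: "(nat \<Rightarrow> 'a::comm_monoid_add) \<Rightarrow> 'a" where
  "fsum f = sum f {..<(LEAST N. \<forall>i\<ge>N. f i = 0)}"

definition linon :: "'m set \<Rightarrow> ('k \<Rightarrow> 'm \<Rightarrow> 'm) \<Rightarrow> ('k \<Rightarrow> 'n \<Rightarrow> 'n)
    \<Rightarrow> ('m::ab_group_add \<Rightarrow> 'n::ab_group_add) \<Rightarrow> bool" where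
  "linon C s1 s2 f \<longleftrightarrow> (\<forall>x\<in>C. \<forall>y\<in>C. f (x + y) = f x + f y) \<and> (\<forall>c. \<forall>x\<in>C. f (s1 c x) = s2 c (f x))"

text \<open>V is the whole type 'v; vY V u k v is the mode u_k v; vgr V k is V_k.\<close>
record ('k, 'v) voa =
  vsc  :: "'k \<Rightarrow> 'v \<Rightarrow> 'v"
  vY   :: "'v \<Rightarrow> int \<Rightarrow> 'v \<Rightarrow> 'v"
  vvac :: 'v
  vom  :: 'v
  vgr  :: "int \<Rightarrow> 'v set"

text \<open>Component form of the Jacobi identity (Borcherds identity) for an action A of V
  on a carrier C with scalar multiplication s.\<close>
definition borcherds :: "('v \<Rightarrow> int \<Rightarrow> 'v \<Rightarrow> 'v) \<Rightarrow> 'm set \<Rightarrow> ('k::field \<Rightarrow> 'm \<Rightarrow> 'm)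
    \<Rightarrow> ('v \<Rightarrow> int \<Rightarrow> 'm \<Rightarrow> 'm::ab_group_add) \<Rightarrow> bool" where
  "borcherds Yv C s A \<longleftrightarrow> (\<forall>u v. \<forall>w\<in>C. \<forall>p q r::int.
     fsum (\<lambda>i. s (of_int (ibinom p i)) (A (Yv u (r + int i) v) (p + q - int i) w))
   = fsum (\<lambda>i. s (of_int ((-1)^i * ibinom r i))
                 (A u (p + r - int i) (A v (q + int i) w)
                  - s (of_int (sgnpow r)) (A v (q + r - int i) (A u (p + int i) w)))))"

definition vL :: "('k, 'v) voa \<Rightarrow> int \<Rightarrow> 'v \<Rightarrow> 'v" where
  "vL V m = vY V (vom V) (m + 1)"

definition is_voa :: "('k::field, 'v::ab_group_add) voa \<Rightarrow> bool" where
  "is_voa V \<longleftrightarrow>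
     vector_space (vsc V)
   \<comment> \<open>bilinearity of (u,v) \<mapsto> u_k v\<close>
   \<and> (\<forall>u k. linon UNIV (vsc V) (vsc V) (vY V u k))
   \<and> (\<forall>k v. linon UNIV (vsc V) (vsc V) (\<lambda>u. vY V u k v))
   \<comment> \<open>grading\<close>
   \<and> (\<forall>k. module.subspace (vsc V) (vgr V k))
   \<and> (\<forall>v. \<exists>!f::int \<Rightarrow> 'v. (\<forall>k. f k \<in> vgr V k) \<and> finite {k. f k \<noteq> 0} \<and> v = sum f {k. f k \<noteq> 0})
   \<and> (\<forall>k. \<exists>B. finite B \<and> B \<subseteq> vgr V k \<and> vgr V k \<subseteq> module.span (vsc V) B)
   \<and> (\<exists>N. \<forall>k<N. vgr V k = {0})
   \<and> (\<forall>s t u v k. u \<in> vgr V s \<longrightarrow> v \<in> vgr V t \<longrightarrow> vY V u k v \<in> vgr V (s + t - k - 1))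
   \<comment> \<open>truncation, vacuum, creation\<close>
   \<and> (\<forall>u v. \<exists>N. \<forall>l\<ge>N. vY V u l v = 0)
   \<and> vvac V \<in> vgr V 0
   \<and> (\<forall>k v. vY V (vvac V) k v = (if k = -1 then v else 0))
   \<and> (\<forall>u. vY V u (-1) (vvac V) = u \<and> (\<forall>k\<ge>0. vY V u k (vvac V) = 0))
   \<comment> \<open>Jacobi identity\<close>
   \<and> borcherds (vY V) UNIV (vsc V) (vY V)
   \<comment> \<open>conformal vector\<close>
   \<and> vom V \<in> vgr V 2
   \<and> (\<exists>c::'k. \<forall>m n v. vL V m (vL V n v) - vL V n (vL V m v)
          = vsc V (of_int (m - n)) (vL V (m + n) v)
            + (if m + n = 0 then vsc V (of_int ((m + 1) * m * (m - 1) div 6) * c / 2) v else 0))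
   \<and> (\<forall>v k w. vY V (vL V (-1) v) k w = vsc V (of_int (- k)) (vY V v (k - 1) w))
   \<and> (\<forall>k v. v \<in> vgr V k \<longrightarrow> vL V 0 v = vsc V (of_int k) v)"

definition vcomp :: "('k, 'v::ab_group_add) voa \<Rightarrow> 'v \<Rightarrow> int \<Rightarrow> 'v" where
  "vcomp V v = (THE f. (\<forall>k. f k \<in> vgr V k) \<and> finite {k. f k \<noteq> 0} \<and> v = sum f {k. f k \<noteq> 0})"

definition circ :: "('k::field, 'v::ab_group_add) voa \<Rightarrow> nat \<Rightarrow> nat \<Rightarrow> nat \<Rightarrow> int \<Rightarrow> 'v \<Rightarrow> 'v \<Rightarrow> 'v" where
  "circ V n s t d a b = fsum (\<lambda>i. vsc V (of_int (ibinom (d + int n + int s) i))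
                                     (vY V a (int i - 2 * int n - 2 - int t) b))"

definition Oset :: "('k::field, 'v::ab_group_add) voa \<Rightarrow> nat \<Rightarrow> 'v set" where
  "Oset V n = module.span (vsc V)
     ({vL V (-1) a + vL V 0 a | a. True}
      \<union> {circ V n s t d a b | s t d a b. a \<in> vgr V d \<and> s \<le> t})"

definition starh :: "('k::field, 'v::ab_group_add) voa \<Rightarrow> nat \<Rightarrow> int \<Rightarrow> 'v \<Rightarrow> 'v \<Rightarrow> 'v" where
  "starh V n d a b = (\<Sum>j\<le>n. vsc V (of_int ((-1)^j * int ((j + n) choose n)))
       (fsum (\<lambda>i. vsc V (of_int (ibinom (d + int n) i)) (vY V a (int i - int n - int j - 1) b))))"

definition star :: "('k::field, 'v::ab_group_add) voa \<Rightarrow> nat \<Rightarrow> 'v \<Rightarrow> 'v \<Rightarrow> 'v" where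
  "star V n a b = (\<Sum>d\<in>{d. vcomp V a d \<noteq> 0}. starh V n d (vcomp V a d) b)"

text \<open>A module over A_n(V) = V/O_n(V) is encoded as an action of V on a vector space
  (carrier ucar, a subspace of the type 'u) that is linear in both arguments,
  kills O_n(V), sends the vacuum to the identity and turns *_n into composition;
  [a] acts by uact U a.\<close>
record ('k, 'v, 'u) amod =
  ucar :: "'u set"
  usc  :: "'k \<Rightarrow> 'u \<Rightarrow> 'u"
  uact :: "'v \<Rightarrow> 'u \<Rightarrow> 'u"

definition is_amod :: "('k::field, 'v::ab_group_add) voa \<Rightarrow> nat \<Rightarrow> ('k, 'v, 'u::ab_group_add) amod \<Rightarrow> bool" where
  "is_amod V n U \<longleftrightarrow>
     vector_space (usc U) \<and> module.subspace (usc U) (ucar U)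
   \<and> (\<forall>a. \<forall>x\<in>ucar U. uact U a x \<in> ucar U)
   \<and> (\<forall>a. linon (ucar U) (usc U) (usc U) (uact U a))
   \<and> (\<forall>x\<in>ucar U. linon UNIV (vsc V) (usc U) (\<lambda>a. uact U a x))
   \<and> (\<forall>a\<in>Oset V n. \<forall>x\<in>ucar U. uact U a x = 0)
   \<and> (\<forall>x\<in>ucar U. uact U (vvac V) x = x)
   \<and> (\<forall>a b. \<forall>x\<in>ucar U. uact U (star V n a b) x = uact U a (uact U b x))"

definition simple_amod :: "('k::field, 'v::ab_group_add) voa \<Rightarrow> nat \<Rightarrow> ('k, 'v, 'u::ab_group_add) amod \<Rightarrow> bool" where
  "simple_amod V n U \<longleftrightarrow> is_amod V n U \<and> ucar U \<noteq> {0}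
   \<and> (\<forall>W. module.subspace (usc U) W \<and> W \<subseteq> ucar U \<and> (\<forall>a. \<forall>x\<in>W. uact U a x \<in> W)
          \<longrightarrow> W = {0} \<or> W = ucar U)"

text \<open>U factors through A_{n-1}(V): O_{n-1}(V) acts as zero (A_{-1}(V) = 0, i.e. all of V
  must act as zero when n = 0).\<close>
definition factors_prev :: "('k::field, 'v::ab_group_add) voa \<Rightarrow> nat \<Rightarrow> ('k, 'v, 'u::ab_group_add) amod \<Rightarrow> bool" where
  "factors_prev V n U \<longleftrightarrow>
     (\<forall>a. (if n = 0 then True else a \<in> Oset V (n - 1)) \<longrightarrow> (\<forall>x\<in>ucar U. uact U a x = 0))"

definition amod_iso :: "('k, 'v, 'u1::ab_group_add) amod \<Rightarrow> ('k, 'v, 'u2::ab_group_add) amod \<Rightarrow> bool" where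
  "amod_iso U1 U2 \<longleftrightarrow> (\<exists>\<phi>. bij_betw \<phi> (ucar U1) (ucar U2) \<and> linon (ucar U1) (usc U1) (usc U2) \<phi>
       \<and> (\<forall>a. \<forall>x\<in>ucar U1. \<phi> (uact U1 a x) = uact U2 a (\<phi> x)))"

record ('k, 'v, 'm) vmod =
  mcar :: "'m set"
  msc  :: "'k \<Rightarrow> 'm \<Rightarrow> 'm"
  mY   :: "'v \<Rightarrow> int \<Rightarrow> 'm \<Rightarrow> 'm"
  mgr  :: "nat \<Rightarrow> 'm set"

definition is_vmod :: "('k::field, 'v::ab_group_add) voa \<Rightarrow> ('k, 'v, 'm::ab_group_add) vmod \<Rightarrow> bool" where
  "is_vmod V M \<longleftrightarrow>
     vector_space (msc M) \<and> module.subspace (msc M) (mcar M)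
   \<and> (\<forall>v k. \<forall>w\<in>mcar M. mY M v k w \<in> mcar M)
   \<and> (\<forall>v k. linon (mcar M) (msc M) (msc M) (mY M v k))
   \<and> (\<forall>k. \<forall>w\<in>mcar M. linon UNIV (vsc V) (msc M) (\<lambda>v. mY M v k w))
   \<and> (\<forall>v. \<forall>w\<in>mcar M. \<exists>N. \<forall>l\<ge>N. mY M v l w = 0)
   \<and> (\<forall>k. \<forall>w\<in>mcar M. mY M (vvac V) k w = (if k = -1 then w else 0))
   \<and> borcherds (vY V) (mcar M) (msc M) (mY M)
   \<and> (\<forall>m. module.subspace (msc M) (mgr M m) \<and> mgr M m \<subseteq> mcar M)
   \<and> (\<forall>x\<in>mcar M. \<exists>!f::nat \<Rightarrow> 'm. (\<forall>m. f m \<in> mgr M m) \<and> finite {m. f m \<noteq> 0}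
                                    \<and> x = sum f {m. f m \<noteq> 0})
   \<and> (\<forall>v s k m w. v \<in> vgr V s \<longrightarrow> w \<in> mgr M m \<longrightarrow>
        (if 0 \<le> int m + s - k - 1 then mY M v k w \<in> mgr M (nat (int m + s - k - 1))
         else mY M v k w = 0))"

definition mcomp :: "('k, 'v, 'm::ab_group_add) vmod \<Rightarrow> 'm \<Rightarrow> nat \<Rightarrow> 'm" where
  "mcomp M x = (THE f. (\<forall>m. f m \<in> mgr M m) \<and> finite {m. f m \<noteq> 0} \<and> x = sum f {m. f m \<noteq> 0})"

definition irreducible_vmod :: "('k::field, 'v::ab_group_add) voa \<Rightarrow> ('k, 'v, 'm::ab_group_add) vmod \<Rightarrow> bool" where
  "irreducible_vmod V M \<longleftrightarrow> mcar M \<noteq> {0} \<and>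
     (\<forall>W. module.subspace (msc M) W \<and> W \<subseteq> mcar M
          \<and> (\<forall>v k. \<forall>w\<in>W. mY M v k w \<in> W) \<and> (\<forall>x\<in>W. \<forall>m. mcomp M x m \<in> W)
          \<longrightarrow> W = {0} \<or> W = mcar M)"

definition vmod_iso :: "('k, 'v, 'm1::ab_group_add) vmod \<Rightarrow> ('k, 'v, 'm2::ab_group_add) vmod \<Rightarrow> bool" where
  "vmod_iso M1 M2 \<longleftrightarrow> (\<exists>\<phi>. bij_betw \<phi> (mcar M1) (mcar M2) \<and> linon (mcar M1) (msc M1) (msc M2) \<phi>
       \<and> (\<forall>v k. \<forall>x\<in>mcar M1. \<phi> (mY M1 v k x) = mY M2 v k (\<phi> x))
       \<and> (\<forall>m. \<phi> ` mgr M1 m = mgr M2 m))"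

definition oact :: "('k, 'v::ab_group_add) voa \<Rightarrow> ('k, 'v, 'm::ab_group_add) vmod \<Rightarrow> 'v \<Rightarrow> 'm \<Rightarrow> 'm" where
  "oact V M a w = (\<Sum>d\<in>{d. vcomp V a d \<noteq> 0}. mY M (vcomp V a d) (d - 1) w)"

definition Mpiece :: "('k, 'v::ab_group_add) voa \<Rightarrow> ('k, 'v, 'm::ab_group_add) vmod \<Rightarrow> nat \<Rightarrow> ('k, 'v, 'm) amod" where
  "Mpiece V M n = \<lparr>ucar = mgr M n, usc = msc M, uact = oact V M\<rparr>"

definition good_vmod :: "('k::field, 'v::ab_group_add) voa \<Rightarrow> nat \<Rightarrow> ('k, 'v, 'm::ab_group_add) vmod \<Rightarrow> bool" where
  "good_vmod V n M \<longleftrightarrow> is_vmod V M \<and> irreducible_vmod V M \<and> mgr M 0 \<noteq> {0} \<and> mgr M n \<noteq> {0}"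

end

(*
  For a functional phi : V -> U such that, up to a power of x = 1 + z, the series
  phi(Y(a,z)b) is a Laurent polynomial in z whose degree is bounded independently of b,
  one may expand phi(Y(a,z)b) at x = 0 and at x = infinity.  The two expansions define
  commuting actions of V on the space of these functionals.  Residue calculus in z turns
  the Borcherds identity of V into the Borcherds identity of the action at x = 0.

  Let o be the action of V on an A_n(V)-module U.  That O_n(V) acts as zero says that
  phi_u(b) = o(b)u is such a functional with explicit pole bounds, and the product of A_n(V)
  says that o(a) is the zero mode of the action at infinity.  The functionals generated from
  the phi_u under the action at x = 0 form L_n(U).  In characteristic p the relations
  o(a_{-i-1} 1) = binom(-deg a, i) o(a) need not come from O_n(V); they follow from
  o(a *_n 1) = o(a) o(1) = o(a).  With skew symmetry they exchange the two expansions
  (x -> 1/x), which identifies the degree n part of L_n(U) with U.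

  On M(n) the element a o^1_{n-1,1} b of O_{n-1}(V) acts as the product of the mode of a of
  degree n and the mode of b of degree -n.  Hence O_{n-1}(V) cannot kill M(n) if M is
  irreducible with M(0) and M(n) nonzero.  Conversely, O_{n-1}(V) kills U if L_n(U)(0) = 0.
  An isomorphism M1(n) = M2(n) extends because its graph generates a graded submodule of
  the sum of M1 and M2 which is itself a graph.
*)
theory Submission
  imports Defs "HOL-Computational_Algebra.Formal_Laurent_Series" "HOL-Library.Product_Plus"
begin

text \<open>All series are expanded at z = 0 alone. The points x = 0 and infinity enter only through
  order conditions on test series, and a residue at one of them becomes a residue at z = 0 against a
  series that is a power of x near one point and negligible at the other. To cover positive
  characteristic, derivatives are divided powers, all coefficients are integers, and the elements
  a_{-i-1} 1 stand for the powers of L(-1) divided by factorials.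

  Realising L_n(U) by functionals with values in U, and not as a quotient of an induced module,
  leaves nothing to divide out. The value at b of a functional of degree m is recovered inside the
  module: one mode of b, of degree n - m, sends the functional to the element of degree n that
  belongs to this value. Hence a nonzero graded submodule meets degree n. The same formula separates
  the degrees by evaluation at the vacuum, whereas L(0)-eigenvalues would see degrees only modulo p
  in characteristic p.\<close>

unbundle fps_syntax

section \<open>Integer binomial coefficients\<close>

text \<open>Binomial identities are proved over the rationals, where generalised binomials are
  available, and pulled back by \<open>ibinom_eqI\<close>. As identities of integers they then hold
  in a field of any characteristic.\<close>

lemma ibinom_gbinomial: "(of_int (ibinom k i) :: rat) = of_int k gchoose i"
proof (cases "0 \<le> k")
  case True
  then obtain m where m: "k = int m" using nonneg_eq_int by blast
  have "(of_nat (m choose i) :: rat) = of_nat m gchoose i" by (rule binomial_gbinomial)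
  then show ?thesis by (simp add: ibinom_def m)
next
  case False
  have "of_int k gchoose i = (-1) ^ i * ((of_nat i - of_int k - 1 :: rat) gchoose i)"
    by (rule gbinomial_negated_upper)
  also have "(of_nat i - of_int k - 1 :: rat) = of_nat (i + nat (-k) - 1)"
    using False by (simp add: of_nat_diff)
  also have "\<dots> gchoose i = of_nat ((i + nat (-k) - 1) choose i)"
    by (rule binomial_gbinomial[symmetric])
  finally show ?thesis using False by (simp add: ibinom_def)
qed

lemma ibinom_eqI: "(of_int a :: rat) = of_int b \<Longrightarrow> a = b"
  by simp

lemma ibinom_0_right [simp]: "ibinom k 0 = 1"
  by (simp add: ibinom_def)

lemma ibinom_0_left: "ibinom 0 i = (if i = 0 then 1 else 0)"
  by (simp add: ibinom_def)

lemma ibinom_1_right [simp]: "ibinom k (Suc 0) = k"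
  by (rule ibinom_eqI) (simp add: ibinom_gbinomial)

lemma ibinom_of_nat: "ibinom (int k) i = int (k choose i)"
  by (simp add: ibinom_def)

lemma ibinom_Suc_Suc: "ibinom (k + 1) (Suc i) = ibinom k i + ibinom k (Suc i)"
  by (rule ibinom_eqI) (simp add: ibinom_gbinomial gbinomial_Suc_Suc)

lemma ibinom_Vandermonde: "(\<Sum>j\<le>i. ibinom k j * ibinom l (i - j)) = ibinom (k + l) i"
proof (rule ibinom_eqI)
  have "(\<Sum>j = 0..i. (of_int k gchoose j) * (of_int l gchoose (i - j))) = ((of_int k + of_int l :: rat) gchoose i)"
    by (rule gbinomial_Vandermonde)
  then show "(of_int (\<Sum>j\<le>i. ibinom k j * ibinom l (i - j)) :: rat) = of_int (ibinom (k + l) i)"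
    by (simp add: ibinom_gbinomial atLeast0AtMost)
qed

lemma ibinom_minus: "ibinom (- k) i = (-1) ^ i * ibinom (k + int i - 1) i"
  by (rule ibinom_eqI) (simp add: ibinom_gbinomial gbinomial_minus[of "of_int k"])

lemma ibinom_trinomial:
  "ibinom r i * ibinom (r - int i) j = ibinom r (i + j) * int ((i + j) choose i)"
proof (rule ibinom_eqI)
  have "(of_int r gchoose (i + j)) * (of_nat (i + j) gchoose i)
      = (of_int r gchoose i) * ((of_int r - of_nat i :: rat) gchoose (i + j - i))"
    by (rule gbinomial_trinomial_revision) simp
  then show "(of_int (ibinom r i * ibinom (r - int i) j) :: rat)
      = of_int (ibinom r (i + j) * int ((i + j) choose i))"
    using binomial_gbinomial[of "i + j" i, where ?'a = rat]
    by (simp add: ibinom_gbinomial mult.commute)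
qed

lemma ibinom_nonneg_eq_0: "0 \<le> k \<Longrightarrow> k < int i \<Longrightarrow> ibinom k i = 0"
  by (simp add: ibinom_def)

lemma ibinom_minus_one: "ibinom (- 1) i = (-1) ^ i"
  using ibinom_minus[of 1 i] ibinom_of_nat[of i i] by simp

lemma ibinom_symmetric: "ibinom (int (a + b)) a = ibinom (int (a + b)) b"
  unfolding ibinom_of_nat by (metis add_diff_cancel_left' binomial_symmetric le_add1)

section \<open>Laurent series in a variable z, powers of 1 + z, and Hasse derivatives\<close>

definition xp :: "int \<Rightarrow> 'k::field fls" where "xp k = (1 + fls_X) powi k"
definition zp :: "int \<Rightarrow> 'k::field fls" where "zp k = fls_X powi k"

lemma one_plus_X_nonzero [simp]: "(1 + fls_X :: 'k::field fls) \<noteq> 0"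
proof
  assume "(1 + fls_X :: 'k fls) = 0"
  then have "(1 + fls_X :: 'k fls) $$ 0 = 0" by simp
  then show False by simp
qed

lemma xp_0 [simp]: "xp 0 = 1" by (simp add: xp_def)
lemma xp_add: "xp (a + b) = xp a * xp b" by (simp add: xp_def power_int_add)
lemma xp_1: "xp 1 = 1 + fls_X" by (simp add: xp_def)
lemma zp_0 [simp]: "zp 0 = 1" by (simp add: zp_def)
lemma zp_add: "zp (a + b) = zp a * zp b"
  unfolding zp_def by (rule power_int_add) simp
lemma zp_1: "zp 1 = fls_X" by (simp add: zp_def)
lemma xp_eq: "xp 1 = 1 + zp 1" by (simp add: xp_1 zp_1)
lemma zp_shift: "zp k = fls_shift (- k) 1" by (simp add: zp_def)
lemma zp_nth: "zp k $$ j = (if j = k then 1 else 0)" by (auto simp: zp_shift)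
lemma zp_times: "zp k * f = fls_shift (- k) f" by (simp add: zp_shift fls_X_intpow_times_conv_shift)
lemma zp_times_nth: "(zp k * f) $$ j = f $$ (j - k)" by (simp add: zp_times)
lemma times_zp_nth: "(f * zp k) $$ j = f $$ (j - k)" by (metis zp_times_nth mult.commute)

lemma xp_Suc: "xp (k + 1) = xp k + zp 1 * xp k"
  by (simp add: xp_add xp_eq algebra_simps)

lemma fls_subdegree_xp: "fls_subdegree (xp k :: 'k::field fls) = 0"
proof -
  have nz: "(xp k :: 'k fls) \<noteq> 0" for k by (simp add: xp_def)
  have 1: "fls_subdegree (1 + fls_X :: 'k fls) = 0"
    by (rule fls_subdegree_eqI) auto
  have step: "fls_subdegree (xp (k + 1) :: 'k fls) = fls_subdegree (xp k :: 'k fls)" for k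
    unfolding xp_add xp_1 by (simp add: nz 1)
  show ?thesis
  proof (induction k rule: int_induct[where k = 0])
    case base show ?case by simp
  next
    case (step1 i) then show ?case using step[of i] by simp
  next
    case (step2 i) then show ?case using step[of "i - 1"] by simp
  qed
qed

lemma xp_nth_neg: "j < 0 \<Longrightarrow> (xp k :: 'k::field fls) $$ j = 0"
  by (rule fls_eq0_below_subdegree) (simp add: fls_subdegree_xp)

text \<open>Multiplication by 1 + z is Pascal's rule. The outer induction is on the coefficient; the
  inner one, on the exponent, runs both ways from 0, since the rule can be solved for either
  exponent once the preceding coefficient is known.\<close>

lemma xp_nth: "(xp k :: 'k::field fls) $$ int j = of_int (ibinom k j)"
proof (induction j arbitrary: k)
  case 0
  have step: "(xp (k + 1) :: 'k fls) $$ 0 = xp k $$ 0" for k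
    by (simp add: xp_Suc zp_times_nth xp_nth_neg)
  have "(xp k :: 'k fls) $$ 0 = 1"
  proof (induction k rule: int_induct[where k = 0])
    case base show ?case by simp
  next
    case (step1 i) then show ?case using step[of i] by simp
  next
    case (step2 i) then show ?case using step[of "i - 1"] by simp
  qed
  then show ?case by simp
next
  case (Suc j)
  have step: "(xp (k + 1) :: 'k fls) $$ int (Suc j) = xp k $$ int (Suc j) + of_int (ibinom k j)" for k
    by (simp add: xp_Suc zp_times_nth Suc)
  show ?case
  proof (induction k rule: int_induct[where k = 0])
    case base show ?case by (simp add: ibinom_0_left)
  next
    case (step1 i) then show ?case using step[of i] ibinom_Suc_Suc[of i j] by simp
  next
    case (step2 i) then show ?case using step[of "i - 1"] ibinom_Suc_Suc[of "i - 1" j] by simp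
  qed
qed

lemma fls_decompose:
  fixes g :: "'k::field fls"
  obtains F t where "finite F" "g = (\<Sum>p\<in>F. fls_const (g $$ p) * zp p) + t" "\<And>j. j < G \<Longrightarrow> t $$ j = 0"
proof -
  define F where "F = {fls_subdegree g..<G}"
  define t where "t = g - (\<Sum>p\<in>F. fls_const (g $$ p) * zp p)"
  have fin: "finite F" by (simp add: F_def)
  have "t $$ j = 0" if "j < G" for j
  proof -
    have "(\<Sum>p\<in>F. fls_const (g $$ p) * zp p) $$ j = (\<Sum>p\<in>F. if j = p then g $$ p else 0)"
      unfolding fls_nth_sum by (intro sum.cong refl) (simp add: zp_nth)
    also have "\<dots> = (if j \<in> F then g $$ j else 0)" using fin by simp
    also have "\<dots> = g $$ j"
      using that fls_eq0_below_subdegree[of j g] unfolding F_def by fastforce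
    finally show ?thesis by (simp add: t_def)
  qed
  moreover have "g = (\<Sum>p\<in>F. fls_const (g $$ p) * zp p) + t" by (simp add: t_def)
  ultimately show ?thesis using fin that by blast
qed

text \<open>A residue sees only finitely many coefficients. An additive statement therefore needs
  checking only on monomials and on series of order at least \<open>G\<close>, a threshold that may
  depend on the other data.\<close>

lemma fls_approx_induct [case_names add monom high]:
  fixes g :: "'k::field fls"
  assumes add: "\<And>f h. P f \<Longrightarrow> P h \<Longrightarrow> P (f + h)"
    and monom: "\<And>c p. P (fls_const c * zp p)"
    and high: "\<And>t. (\<And>j. j < G \<Longrightarrow> t $$ j = 0) \<Longrightarrow> P t"
  shows "P g"
proof -
  obtain F t where F: "finite F" "g = (\<Sum>p\<in>F. fls_const (g $$ p) * zp p) + t" "\<And>j. j < G \<Longrightarrow> t $$ j = 0"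
    by (rule fls_decompose[of g G]) (rule that)
  have "P (\<Sum>p\<in>F. fls_const (g $$ p) * zp p)" using F(1)
    by (induction F) (simp_all add: add monom high)
  from add[OF this high[OF F(3)]] show ?thesis by (subst F(2)) simp
qed

text \<open>The divided-power derivative \<open>(d/dz)^i / i!\<close>, which makes sense in every characteristic.\<close>

definition hasse :: "nat \<Rightarrow> 'k::field fls \<Rightarrow> 'k fls" where
  "hasse i g = Abs_fls (\<lambda>j. of_int (ibinom (j + int i) i) * g $$ (j + int i))"

lemma hasse_nth: "hasse i g $$ j = of_int (ibinom (j + int i) i) * g $$ (j + int i)"
proof -
  have "\<forall>\<^sub>\<infinity>n. of_int (ibinom (- int n + int i) i) * g $$ (- int n + int i) = 0"
    unfolding MOST_nat
  proof (intro exI allI impI)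
    fix m assume "nat (- fls_subdegree g) + i < m"
    then have "- int m + int i < fls_subdegree g" by linarith
    then show "of_int (ibinom (- int m + int i) i) * g $$ (- int m + int i) = 0" by simp
  qed
  then show ?thesis unfolding hasse_def by (subst nth_Abs_fls) auto
qed

lemma hasse_add: "hasse i (f + g) = hasse i f + hasse i g"
  by (rule fls_eqI) (simp add: hasse_nth algebra_simps)

lemma hasse_diff: "hasse i (f - g) = hasse i f - hasse i g"
  by (rule fls_eqI) (simp add: hasse_nth algebra_simps)

lemma hasse_const_mult: "hasse i (fls_const c * g) = fls_const c * hasse i g"
  by (rule fls_eqI) (simp add: hasse_nth)

lemma hasse_zp: "hasse i (zp p) = of_int (ibinom p i) * zp (p - int i)"
  by (rule fls_eqI) (auto simp: hasse_nth zp_nth fls_of_int)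

lemma hasse_xp: "hasse i (xp k :: 'k::field fls) = of_int (ibinom k i) * xp (k - int i)"
proof (rule fls_eqI)
  fix j
  show "hasse i (xp k :: 'k fls) $$ j = (of_int (ibinom k i) * xp (k - int i)) $$ j"
  proof (cases "0 \<le> j")
    case True
    then obtain m where m: "j = int m" using nonneg_eq_int by blast
    have "hasse i (xp k :: 'k fls) $$ j = of_int (ibinom (int m + int i) i * ibinom k (i + m))"
      unfolding hasse_nth using xp_nth[of k "i + m", where ?'k = 'k] by (simp add: m add.commute)
    also have "ibinom (int m + int i) i * ibinom k (i + m) = ibinom k i * ibinom (k - int i) m"
      using ibinom_trinomial[of k i m] ibinom_of_nat[of "i + m" i] by (simp add: algebra_simps)
    finally show ?thesis using xp_nth[of "k - int i" m, where ?'k = 'k] by (simp add: m fls_of_int)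
  next
    case False
    then have "hasse i (xp k :: 'k fls) $$ j = 0"
    proof (cases "j + int i < 0")
      case True then show ?thesis by (simp add: hasse_nth xp_nth_neg)
    next
      case F2: False
      then have "ibinom (j + int i) i = 0" using False by (intro ibinom_nonneg_eq_0) auto
      then show ?thesis by (simp add: hasse_nth)
    qed
    with False show ?thesis by (simp add: fls_of_int xp_nth_neg)
  qed
qed

lemma fls_times_nth_high:
  assumes "\<And>j. j < G \<Longrightarrow> t $$ j = 0" "k < G + fls_subdegree g"
  shows "(t * g) $$ k = (0::'k::field)"
  unfolding fls_times_nth(2)
proof (rule sum.neutral, rule ballI)
  fix i assume "i \<in> {fls_subdegree t..k - fls_subdegree g}"
  then have "i < G" using assms(2) by auto
  then show "t $$ i * g $$ (k - i) = 0" using assms(1) by simp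
qed

text \<open>Each coefficient is bilinear in finitely many coefficients of \<open>f\<close> and
  \<open>g\<close>, so monomials suffice; for them the Leibniz rule is Vandermonde's
  convolution.\<close>

lemma hasse_mult:
  fixes f g :: "'k::field fls"
  shows "hasse i (f * g) = (\<Sum>j\<le>i. hasse j f * hasse (i - j) g)"
proof (rule fls_eqI)
  fix n
  \<comment> \<open>The bound allows each factor to lose up to \<open>i\<close> in order under its
    divided derivative.\<close>
  have high: "hasse i (t * g) $$ n = (\<Sum>j\<le>i. hasse j t * hasse (i - j) g) $$ n"
    if t: "\<And>j. j < n + int i + 1 + int i - fls_subdegree g \<Longrightarrow> t $$ j = 0" for t g :: "'k fls"
  proof -
    have "hasse i (t * g) $$ n = 0"
      unfolding hasse_nth by (subst fls_times_nth_high[OF t]) auto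
    moreover have "(hasse j t * hasse (i - j) g) $$ n = 0" if "j \<le> i" for j
    proof (cases "hasse (i - j) g = 0")
      case False
      have "fls_subdegree g - int i \<le> fls_subdegree (hasse (i - j) g)"
        using that by (intro fls_subdegree_geI False) (auto simp: hasse_nth)
      then show ?thesis
        by (intro fls_times_nth_high[of "n + 1 + int i - fls_subdegree g"]) (use that in \<open>auto simp: hasse_nth t\<close>)
    qed simp
    ultimately show ?thesis by (simp add: fls_nth_sum)
  qed
  have mono: "hasse i (zp p * zp q :: 'k fls) = (\<Sum>j\<le>i. hasse j (zp p) * hasse (i - j) (zp q))" for p q
  proof -
    have "(\<Sum>j\<le>i. hasse j (zp p) * hasse (i - j) (zp q) :: 'k fls)
      = (\<Sum>j\<le>i. of_int (ibinom p j * ibinom q (i - j)) * zp (p + q - int i))"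
      by (intro sum.cong refl) (simp add: hasse_zp algebra_simps zp_add[symmetric] of_nat_diff)
    also have "\<dots> = of_int (ibinom (p + q) i) * zp (p + q - int i)"
      by (simp add: sum_distrib_right[symmetric] ibinom_Vandermonde[symmetric])
    finally show ?thesis by (simp add: zp_add[symmetric] hasse_zp)
  qed
  have g1: "hasse i (zp p * g) $$ n = (\<Sum>j\<le>i. hasse j (zp p) * hasse (i - j) g) $$ n" for p and g :: "'k fls"
  proof (induction g rule: fls_approx_induct[where G = "n + int i + 1 + int i - p"])
    case (add f h)
    then show ?case by (simp add: algebra_simps hasse_add sum.distrib)
  next
    case (monom c q)
    have "hasse i (zp p * (fls_const c * zp q)) = fls_const c * hasse i (zp p * zp q)"
      by (subst hasse_const_mult[symmetric]) (simp add: mult_ac)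
    also have "\<dots> = (\<Sum>j\<le>i. hasse j (zp p) * hasse (i - j) (fls_const c * zp q))"
      unfolding mono hasse_const_mult sum_distrib_left by (intro sum.cong refl) (simp add: mult_ac)
    finally show ?case by simp
  next
    case H: (high t)
    have sz: "fls_subdegree (zp p :: 'k fls) = p" by (rule fls_subdegree_eqI) (auto simp: zp_nth)
    have "hasse i (t * zp p) $$ n = (\<Sum>j\<le>i. hasse j t * hasse (i - j) (zp p)) $$ n"
      by (rule high) (simp add: sz H)
    also have "(\<Sum>j\<le>i. hasse j t * hasse (i - j) (zp p)) = (\<Sum>j\<le>i. hasse j (zp p) * hasse (i - j) t)"
      by (subst sum.nat_diff_reindex[symmetric, of _ "Suc i", unfolded lessThan_Suc_atMost])
         (auto intro!: sum.cong simp: mult.commute)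
    finally show ?case by (simp add: mult.commute)
  qed
  show "hasse i (f * g) $$ n = (\<Sum>j\<le>i. hasse j f * hasse (i - j) g) $$ n"
  proof (induction f rule: fls_approx_induct[where G = "n + int i + 1 + int i - fls_subdegree g"])
    case (add f h)
    then show ?case by (simp add: algebra_simps hasse_add sum.distrib)
  next
    case (monom c p)
    have "hasse i (fls_const c * zp p * g) = fls_const c * hasse i (zp p * g)"
      by (subst hasse_const_mult[symmetric]) (simp add: mult_ac)
    then show ?case using g1[of p g]
      by (simp add: hasse_const_mult mult.assoc sum_distrib_left[symmetric])
  next
    case H: (high t)
    then show ?case by (rule high)
  qed
qed

section \<open>Orders of vanishing at x = 0 and at infinity\<close>

text \<open>For rational functions with poles only at \<open>z = 0\<close>, \<open>x = 1 + z = 0\<close> and infinity, expanded at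
  \<open>z = 0\<close>: \<open>zord a g\<close> says that \<open>g\<close> vanishes to order \<open>a\<close> at \<open>x = 0\<close>, and \<open>ideg c g\<close> that \<open>g\<close> grows at
  most like \<open>z^c\<close> at infinity.\<close>

definition degle :: "int \<Rightarrow> 'k::field fls \<Rightarrow> bool" where
  "degle d g \<longleftrightarrow> (\<forall>j>d. g $$ j = 0)"

definition zord :: "int \<Rightarrow> 'k::field fls \<Rightarrow> bool" where
  "zord a g \<longleftrightarrow> (\<exists>d f. degle d f \<and> g = xp a * f)"

definition ideg :: "int \<Rightarrow> 'k::field fls \<Rightarrow> bool" where
  "ideg c g \<longleftrightarrow> (\<exists>a f. degle (c - a) f \<and> g = xp a * f)"

lemma degle_mono: "degle d g \<Longrightarrow> d \<le> d' \<Longrightarrow> degle d' g"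
  by (auto simp: degle_def)

lemma degle_zero [simp]: "degle d 0" by (simp add: degle_def)
lemma degle_one: "degle 0 1" by (simp add: degle_def)
lemma degle_add: "degle d f \<Longrightarrow> degle d g \<Longrightarrow> degle d (f + g)"
  by (simp add: degle_def)
lemma degle_const: "degle 0 (fls_const c)" by (simp add: degle_def)
lemma degle_zp: "degle j (zp j)" by (simp add: degle_def zp_nth)

lemma degle_mult:
  assumes "degle d f" "degle e g"
  shows "degle (d + e) (f * g)"
  unfolding degle_def
proof (intro allI impI)
  fix j assume j: "j > d + e"
  show "(f * g) $$ j = 0"
    unfolding fls_times_nth(2)
  proof (rule sum.neutral, rule ballI)
    fix i
    show "f $$ i * g $$ (j - i) = 0"
      using assms j unfolding degle_def by (cases "i > d") auto
  qed
qed

lemma degle_sum: "(\<And>i. i \<in> A \<Longrightarrow> degle d (f i)) \<Longrightarrow> degle d (\<Sum>i\<in>A. f i)"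
  by (induction A rule: infinite_finite_induct) (auto intro: degle_add)

lemma degle_xp_nat: "degle (int n) (xp (int n))"
proof (induction n)
  case 0 show ?case by (simp add: degle_one)
next
  case (Suc n)
  have 1: "degle 1 (xp 1 :: 'a fls)"
    unfolding xp_eq by (intro degle_add degle_mono[OF degle_one] degle_zp) simp
  have "xp (int (Suc n)) = xp 1 * (xp (int n) :: 'a fls)" by (simp add: xp_add[symmetric])
  with degle_mult[OF 1 Suc] show ?case by (simp add: add.commute)
qed

lemma degle_xp: "0 \<le> k \<Longrightarrow> degle k (xp k)"
  using degle_xp_nat[of "nat k"] by simp

lemma degle_hasse: "degle d g \<Longrightarrow> degle (d - int i) (hasse i g)"
  by (simp add: degle_def hasse_nth)

text \<open>Coefficients are compared downwards from the a priori bound \<open>d\<close>. Such a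
  bound is essential: 1/(1+z) expanded at z = 0 is not a Laurent polynomial, although its product
  with 1 + z is.\<close>

lemma degle_cancel_xp1:
  assumes f: "degle d f" and xf: "degle (e + 1) (xp 1 * f)"
  shows "degle e (f :: 'k::field fls)"
proof -
  have rec: "f $$ (j - 1) = - f $$ j" if "j > e + 1" for j
  proof -
    have "(xp 1 * f) $$ j = 0" using xf that by (simp add: degle_def)
    moreover have "(xp 1 * f) $$ j = f $$ j + f $$ (j - 1)"
      by (simp add: xp_eq distrib_right zp_times_nth)
    ultimately show ?thesis by (simp add: eq_neg_iff_add_eq_0 add.commute)
  qed
  have "\<forall>j>e. j > d - int m \<longrightarrow> f $$ j = 0" for m
  proof (induction m)
    case 0 then show ?case using f by (simp add: degle_def)
  next
    case (Suc m)
    show ?case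
    proof (intro allI impI)
      fix j assume j: "e < j" "d - int (Suc m) < j"
      then have "f $$ (j + 1) = 0" using Suc by auto
      then show "f $$ j = 0" using rec[of "j + 1"] j by simp
    qed
  qed
  from this[of "nat (d - e)"] show ?thesis by (auto simp: degle_def)
qed

lemma degle_cancel_xp:
  assumes "degle d f" "degle (e + int m) (xp (int m) * f)"
  shows "degle e (f :: 'k::field fls)"
  using assms(2)
proof (induction m arbitrary: e)
  case 0 then show ?case by simp
next
  case (Suc m)
  have "degle (int m + d) (xp (int m) * f)" by (rule degle_mult[OF degle_xp_nat assms(1)])
  moreover have "xp (int (Suc m)) * f = xp 1 * (xp (int m) * f)"
    by (simp add: mult.assoc[symmetric] xp_add[symmetric])
  moreover have "degle (e + int m + 1) (xp (int (Suc m)) * f)"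
    using Suc.prems by (simp add: algebra_simps)
  ultimately have "degle (e + int m) (xp (int m) * f)"
    by (metis degle_cancel_xp1)
  then show ?case by (rule Suc.IH)
qed

lemma xp_split: "xp a * f = xp b * (xp (a - b) * f)"
  by (simp add: mult.assoc[symmetric] xp_add[symmetric])

lemma zord_mono:
  assumes "zord a g" "b \<le> a"
  shows "zord b g"
proof -
  obtain d f where f: "degle d f" "g = xp a * f" using assms by (auto simp: zord_def)
  have "degle (a - b + d) (xp (a - b) * f)"
    by (rule degle_mult[OF degle_xp f(1)]) (use assms in simp)
  then show ?thesis unfolding zord_def using f(2) xp_split[of a f b] by auto
qed

text \<open>Lowering the exponent of x keeps the degree at infinity; this brings two summands to a
  common power of x.\<close>

lemma ideg_lower:
  assumes "degle (c - a) f" "b \<le> a"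
  shows "\<exists>f'. degle (c - b) f' \<and> xp a * f = xp b * f'"
proof -
  have "degle (a - b + (c - a)) (xp (a - b) * f)"
    by (rule degle_mult[OF degle_xp assms(1)]) (use assms in simp)
  then show ?thesis using xp_split[of a f b] by auto
qed

lemma ideg_mono: "ideg c g \<Longrightarrow> c \<le> c' \<Longrightarrow> ideg c' g"
proof -
  assume "ideg c g" and c: "c \<le> c'"
  then obtain a f where f: "degle (c - a) f" "g = xp a * f" by (auto simp: ideg_def)
  from f(1) have "degle (c' - a) f" by (rule degle_mono) (use c in simp)
  with f(2) show ?thesis unfolding ideg_def by blast
qed

lemma zord_add:
  assumes "zord a f" "zord a g"
  shows "zord a (f + g)"
proof -
  obtain d f' e g' where "degle d f'" "f = xp a * f'" "degle e g'" "g = xp a * g'"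
    using assms by (auto simp: zord_def)
  then show ?thesis unfolding zord_def
    by (intro exI[of _ "max d e"] exI[of _ "f' + g'"])
      (auto intro!: degle_add intro: degle_mono simp: distrib_left)
qed

lemma ideg_add:
  assumes "ideg c f" "ideg c g"
  shows "ideg c (f + g)"
proof -
  obtain a f' b g' where *: "degle (c - a) f'" "f = xp a * f'" "degle (c - b) g'" "g = xp b * g'"
    using assms by (auto simp: ideg_def)
  obtain f1 where f1: "degle (c - min a b) f1" "f = xp (min a b) * f1"
    using ideg_lower[OF *(1), of "min a b"] *(2) by auto
  obtain g1 where g1: "degle (c - min a b) g1" "g = xp (min a b) * g1"
    using ideg_lower[OF *(3), of "min a b"] *(4) by auto
  show ?thesis unfolding ideg_def
    using degle_add[OF f1(1) g1(1)] f1(2) g1(2) by (metis distrib_left)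
qed

lemma zord_mult:
  assumes "zord a f" "zord b g"
  shows "zord (a + b) (f * g)"
proof -
  obtain d f' e g' where *: "degle d f'" "f = xp a * f'" "degle e g'" "g = xp b * g'"
    using assms by (auto simp: zord_def)
  have "f * g = xp (a + b) * (f' * g')" using * by (simp add: xp_add mult_ac)
  then show ?thesis unfolding zord_def using degle_mult[OF *(1) *(3)] by blast
qed

lemma ideg_mult:
  assumes "ideg c f" "ideg c' g"
  shows "ideg (c + c') (f * g)"
proof -
  obtain a f' b g' where *: "degle (c - a) f'" "f = xp a * f'" "degle (c' - b) g'" "g = xp b * g'"
    using assms by (auto simp: ideg_def)
  have "f * g = xp (a + b) * (f' * g')" using * by (simp add: xp_add mult_ac)
  moreover have "degle (c + c' - (a + b)) (f' * g')"
    using degle_mult[OF *(1) *(3)] by (simp add: algebra_simps)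
  ultimately show ?thesis unfolding ideg_def by blast
qed

lemma zord_zero [simp]: "zord a 0" unfolding zord_def using degle_zero by (metis mult_zero_right)
lemma ideg_zero [simp]: "ideg a 0" unfolding ideg_def using degle_zero by (metis mult_zero_right)
lemma zord_const: "zord 0 (fls_const c)" unfolding zord_def using degle_const by (metis mult_1 xp_0)
lemma ideg_const: "ideg 0 (fls_const c)" unfolding ideg_def using degle_const by (metis mult_1 xp_0 diff_zero)
lemma zord_one: "zord 0 1" using zord_const[of 1] by simp
lemma ideg_one: "ideg 0 1" using ideg_const[of 1] by simp
lemma zord_zp: "zord 0 (zp j)" unfolding zord_def using degle_zp by (metis mult_1 xp_0)
lemma ideg_zp: "ideg j (zp j)" unfolding ideg_def using degle_zp by (metis mult_1 xp_0 diff_zero)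
lemma zord_xp: "zord k (xp k)" unfolding zord_def using degle_one by (metis mult_1_right)
lemma ideg_xp: "ideg k (xp k)" unfolding ideg_def using degle_one by (metis mult_1_right diff_self)

lemma zord_const_mult: "zord a f \<Longrightarrow> zord a (fls_const c * f)"
  using zord_mult[OF zord_const] by simp
lemma ideg_const_mult: "ideg a f \<Longrightarrow> ideg a (fls_const c * f)"
  using ideg_mult[OF ideg_const] by simp
lemma zord_uminus: "zord a f \<Longrightarrow> zord a (- f)"
  using zord_const_mult[of a f "- 1"] by simp
lemma ideg_uminus: "ideg a f \<Longrightarrow> ideg a (- f)"
  using ideg_const_mult[of a f "- 1"] by simp
lemma zord_diff: "zord a f \<Longrightarrow> zord a g \<Longrightarrow> zord a (f - g)"
  using zord_add[OF _ zord_uminus] by fastforce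
lemma ideg_diff: "ideg a f \<Longrightarrow> ideg a g \<Longrightarrow> ideg a (f - g)"
  using ideg_add[OF _ ideg_uminus] by fastforce
lemma zord_sum: "(\<And>i. i \<in> A \<Longrightarrow> zord a (f i)) \<Longrightarrow> zord a (\<Sum>i\<in>A. f i)"
  by (induction A rule: infinite_finite_induct) (auto intro: zord_add)
lemma ideg_sum: "(\<And>i. i \<in> A \<Longrightarrow> ideg a (f i)) \<Longrightarrow> ideg a (\<Sum>i\<in>A. f i)"
  by (induction A rule: infinite_finite_induct) (auto intro: ideg_add)
lemma zord_power: "zord a f \<Longrightarrow> zord (int n * a) (f ^ n)"
proof (induction n)
  case (Suc n)
  from zord_mult[OF Suc.prems Suc.IH[OF Suc.prems]] show ?case by (simp add: algebra_simps)
qed (simp add: zord_one)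
lemma ideg_power: "ideg a f \<Longrightarrow> ideg (int n * a) (f ^ n)"
proof (induction n)
  case (Suc n)
  from ideg_mult[OF Suc.prems Suc.IH[OF Suc.prems]] show ?case by (simp add: algebra_simps)
qed (simp add: ideg_one)
lemma zord_of_int_mult: "zord a f \<Longrightarrow> zord a (of_int c * f)"
  using zord_const_mult[of a f "of_int c"] by (simp add: fls_of_int)
lemma ideg_of_int_mult: "ideg a f \<Longrightarrow> ideg a (of_int c * f)"
  using ideg_const_mult[of a f "of_int c"] by (simp add: fls_of_int)

lemma hasse_xp_mult:
  assumes "degle d f"
  shows "\<exists>f'. degle d f' \<and> hasse i (xp a * f) = xp (a - int i) * f'"
proof -
  define f' where "f' = (\<Sum>j\<le>i. of_int (ibinom a j) * (xp (int (i - j)) * hasse (i - j) f))"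
  have "degle d f'" unfolding f'_def
  proof (rule degle_sum)
    fix j assume "j \<in> {..i}"
    have "degle (0 + (int (i - j) + (d - int (i - j)))) (fls_const (of_int (ibinom a j)) * (xp (int (i - j)) * hasse (i - j) f))"
      by (intro degle_mult degle_const degle_xp_nat degle_hasse assms)
    then show "degle d (of_int (ibinom a j) * (xp (int (i - j)) * hasse (i - j) f))"
      by (simp add: fls_of_int)
  qed
  moreover have "hasse i (xp a * f) = xp (a - int i) * f'"
    unfolding hasse_mult f'_def sum_distrib_left
  proof (rule sum.cong[OF refl])
    fix j assume "j \<in> {..i}"
    then have "xp (a - int j) = xp (a - int i) * (xp (int (i - j)) :: 'a fls)"
      by (simp add: xp_add[symmetric] of_nat_diff)
    then show "hasse j (xp a) * hasse (i - j) f
        = xp (a - int i) * (of_int (ibinom a j) * (xp (int (i - j)) * hasse (i - j) f))"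
      by (simp add: hasse_xp mult_ac)
  qed
  ultimately show ?thesis by blast
qed

lemma zord_hasse: "zord a g \<Longrightarrow> zord (a - int i) (hasse i g)"
  unfolding zord_def using hasse_xp_mult by metis

lemma ideg_hasse: "ideg c g \<Longrightarrow> ideg (c - int i) (hasse i g)"
proof -
  assume "ideg c g"
  then obtain a f where f: "degle (c - a) f" "g = xp a * f" by (auto simp: ideg_def)
  obtain f' where "degle (c - a) f'" "hasse i g = xp (a - int i) * f'"
    using hasse_xp_mult[OF f(1)] f(2) by blast
  moreover have "c - a = c - int i - (a - int i)" by simp
  ultimately show ?thesis unfolding ideg_def by metis
qed

text \<open>The two representations may involve different powers of x. If the one from infinity has
  the smaller exponent, the surplus power of x divides its Laurent polynomial and is cancelled by
  \<open>degle_cancel_xp\<close>. The outcome is the shape of the residue functions that define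
  O_n(V).\<close>

lemma zord_ideg_inter:
  assumes "zord a g" "ideg c g"
  shows "\<exists>f. degle (c - a) f \<and> g = xp a * f"
proof -
  obtain d f where f: "degle d f" "g = xp a * f" using assms by (auto simp: zord_def)
  obtain b h where h: "degle (c - b) h" "g = xp b * h" using assms by (auto simp: ideg_def)
  show ?thesis
  proof (cases "a \<le> b")
    case True
    with ideg_lower[OF h(1) True] h(2) show ?thesis by auto
  next
    case False
    then have m: "a - b = int (nat (a - b))" by simp
    have "xp b * h = xp b * (xp (a - b) * f)" using f(2) h(2) xp_split[of a f b] by simp
    then have "h = xp (a - b) * f" by (simp add: xp_def)
    then have "degle (c - a + int (nat (a - b))) (xp (int (nat (a - b))) * f)"
      using h(1) m by simp
    from degle_cancel_xp[OF f(1) this] f(2) show ?thesis by blast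
  qed
qed

text \<open>\<open>cutoff M\<close> vanishes to order \<open>M\<close> at infinity and is \<open>1\<close> to order \<open>M\<close> at \<open>x = 0\<close>,
  i.e. at \<open>z = -1\<close>.\<close>

definition cutoff :: "nat \<Rightarrow> 'k::field fls" where
  "cutoff M = 1 - (1 - (- zp (-1)) ^ M) ^ M"

lemma zp_power: "zp a ^ n = zp (int n * a)"
  by (induction n) (simp_all add: zp_add[symmetric] algebra_simps)

text \<open>With u = (-1/z)^M the cutoff is 1 - (1 - u)^M, which is divisible by u with a cofactor
  bounded at infinity.\<close>

lemma ideg_cutoff: "ideg (- int M) (cutoff M)"
proof -
  let ?u = "(- zp (-1)) ^ M :: 'a fls"
  have u: "ideg (- int M) ?u" using ideg_power[OF ideg_uminus[OF ideg_zp[of "-1"]], of M] by simp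
  have u1: "ideg 0 (1 - ?u)" by (intro ideg_diff ideg_one ideg_mono[OF u]) simp
  have "ideg (- int M + 0) (?u * (\<Sum>i<M. (1 - ?u) ^ i))"
    by (intro ideg_mult u ideg_sum) (use ideg_power[OF u1] in simp)
  moreover have "cutoff M = ?u * (\<Sum>i<M. (1 - ?u) ^ i)"
    using one_diff_power_eq[of "1 - ?u" M] by (simp add: cutoff_def)
  ultimately show ?thesis by simp
qed

lemma zord_one_diff_cutoff: "zord (int M) (1 - cutoff M)"
proof -
  let ?y = "- zp (-1) :: 'a fls"
  \<comment> \<open>1 + 1/z = x/z: the series y = -1/z takes the value 1 at x = 0, so 1 - y^M
    vanishes there and its M-th power vanishes to order M.\<close>
  have "xp 1 * zp (- 1) = (zp (-1) + 1 :: 'a fls)"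
    by (simp add: xp_eq distrib_right zp_add[symmetric])
  then have y: "1 - ?y = xp 1 * zp (-1)" by simp
  have "zord (1 + 0 + 0) (xp 1 * zp (-1) * (\<Sum>i<M. ?y ^ i))"
    by (intro zord_mult zord_xp zord_zp zord_sum) (use zord_power[OF zord_uminus[OF zord_zp[of "-1"]]] in simp)
  moreover have "1 - ?y ^ M = xp 1 * zp (-1) * (\<Sum>i<M. ?y ^ i)"
    by (simp only: one_diff_power_eq y)
  ultimately have "zord 1 (1 - ?y ^ M)" by simp
  from zord_power[OF this, of M] show ?thesis by (simp add: cutoff_def)
qed

lemma zord_cutoff: "zord 0 (cutoff M)"
  using zord_diff[OF zord_one zord_mono[OF zord_one_diff_cutoff[of M]]] by simp

lemma ideg_one_diff_cutoff: "ideg 0 (1 - cutoff M)"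
  by (rule ideg_diff[OF ideg_one ideg_mono[OF ideg_cutoff]]) simp

section \<open>Truncated expansions\<close>

lemma sgnpow_add_one: "sgnpow (m + 1) = - sgnpow m"
  by (simp add: sgnpow_def)

text \<open>The binomial series of z^m = (x - 1)^m in falling powers of x. Its remainders satisfy a
  Pascal recursion up to one boundary term of known order, so the bound spreads from m = 0 to all
  integers m on multiplying by z or 1/z.\<close>

lemma zp_expand_inf:
  "ideg (m - int J) (zp m - (\<Sum>j<J. of_int ((-1)^j * ibinom m j) * xp (m - int j)) :: 'k::field fls)"
proof -
  define R where "R m J = (zp m - (\<Sum>j<J. of_int ((-1)^j * ibinom m j) * xp (m - int j)) :: 'k fls)" for m J
  have R0: "R m 0 = zp m" for m by (simp add: R_def)
  have RS: "R m (Suc J) = R m J - of_int ((-1)^J * ibinom m J) * xp (m - int J)" for m J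
    by (simp add: R_def)
  have step: "zp 1 * R m (Suc J) = R (m + 1) (Suc J) + of_int ((-1)^J * ibinom m J) * xp (m - int J)" for m J
  proof (induction J)
    case 0
    show ?case by (simp add: RS R0 right_diff_distrib zp_add[symmetric] xp_add xp_eq algebra_simps)
  next
    case (Suc J)
    have e: "xp (m - int J) = xp (m - int (Suc J)) + zp 1 * (xp (m - int (Suc J)) :: 'k fls)"
      using xp_Suc[of "m - int (Suc J)"] by simp
    have "zp 1 * R m (Suc (Suc J)) = zp 1 * R m (Suc J) - of_int ((-1)^Suc J * ibinom m (Suc J)) * (zp 1 * xp (m - int (Suc J)))"
      unfolding RS[of m "Suc J"] by (simp add: algebra_simps)
    also have "\<dots> = R (m + 1) (Suc J) + of_int ((-1)^J * ibinom m J) * xp (m - int J)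
       - of_int ((-1)^Suc J * ibinom m (Suc J)) * (xp (m - int J) - xp (m - int (Suc J)))"
      unfolding Suc.IH e by simp
    also have "\<dots> = R (m + 1) (Suc (Suc J)) + of_int ((-1)^Suc J * ibinom m (Suc J)) * xp (m - int (Suc J))"
      unfolding RS[of "m + 1" "Suc J"] ibinom_Suc_Suc by (simp add: algebra_simps)
    finally show ?case .
  qed
  have "\<forall>J. ideg (m - int J) (R m J)"
  proof (induction m rule: int_induct[where k = 0])
    case base
    have "R 0 (Suc J) = 0" for J
      by (induction J) (simp_all add: RS R0 ibinom_0_left)
    then show ?case using ideg_zp[of 0] by (metis R0 ideg_zero not0_implies_Suc of_nat_0 diff_zero)
  next
    case (step1 m)
    show ?case
    proof
      fix J show "ideg (m + 1 - int J) (R (m + 1) J)"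
      proof (cases J)
        case 0 then show ?thesis using ideg_zp by (simp add: R0)
      next
        case (Suc J')
        have "ideg (1 + (m - int (Suc J'))) (zp 1 * R m (Suc J'))" using step1 by (intro ideg_mult ideg_zp) blast
        moreover have "ideg (m - int J') (of_int ((-1)^J' * ibinom m J') * xp (m - int J') :: 'k fls)"
          by (intro ideg_of_int_mult ideg_xp)
        ultimately have "ideg (m - int J') (zp 1 * R m (Suc J') - of_int ((-1)^J' * ibinom m J') * xp (m - int J'))"
          by (intro ideg_diff) simp_all
        then show ?thesis unfolding step by (simp add: Suc)
      qed
    qed
  next
    case (step2 m)
    show ?case
    proof
      fix J show "ideg (m - 1 - int J) (R (m - 1) J)"
      proof (cases J)
        case 0 then show ?thesis using ideg_zp by (simp add: R0)
      next
        case (Suc J')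
        have "ideg (m - int (Suc J')) (R m (Suc J'))" using step2 by blast
        moreover have "ideg (m - 1 - int J') (of_int ((-1)^J' * ibinom (m - 1) J') * xp (m - 1 - int J') :: 'k fls)"
          by (intro ideg_of_int_mult ideg_xp)
        ultimately have "ideg (m - 1 - int J') (zp 1 * R (m - 1) (Suc J'))"
          unfolding step by (intro ideg_add) (simp_all add: algebra_simps)
        from ideg_mult[OF ideg_zp[of "-1"] this] show ?thesis
          by (simp add: mult.assoc[symmetric] zp_add[symmetric] Suc algebra_simps)
      qed
    qed
  qed
  then show ?thesis by (simp add: R_def)
qed

text \<open>The same binomial series in rising powers of x. The sign is (-1)^(m-j) with an exponent
  that may be negative, hence \<open>sgnpow\<close>.\<close>

lemma zp_expand_zero:
  "zord (int J) (zp m - (\<Sum>j<J. of_int (sgnpow (m - int j) * ibinom m j) * xp (int j)) :: 'k::field fls)"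
proof -
  define R where "R m J = (zp m - (\<Sum>j<J. of_int (sgnpow (m - int j) * ibinom m j) * xp (int j)) :: 'k fls)" for m J
  have R0: "R m 0 = zp m" for m by (simp add: R_def)
  have RS: "R m (Suc J) = R m J - of_int (sgnpow (m - int J) * ibinom m J) * xp (int J)" for m J
    by (simp add: R_def)
  have z1: "zp 1 = xp 1 - (1 :: 'k fls)" by (simp add: xp_eq)
  have s: "sgnpow (1 + m) = - sgnpow m" for m by (simp add: sgnpow_def)
  have step: "zp 1 * R m (Suc J) = R (m + 1) (Suc J) - of_int (sgnpow (m - int J) * ibinom m J) * xp (int (Suc J))" for m J
  proof (induction J)
    case 0
    show ?case
      by (simp add: RS R0 right_diff_distrib zp_add[symmetric] s add.commute[of m 1]) (simp add: z1 algebra_simps)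
  next
    case (Suc J)
    have e: "zp 1 * xp (int (Suc J)) = xp (int (Suc (Suc J))) - (xp (int (Suc J)) :: 'k fls)"
      using xp_Suc[of "int (Suc J)", where ?'a = 'k] by (simp add: algebra_simps)
    have s1: "sgnpow (m - int J) = - sgnpow (m - int (Suc J))"
      using s[of "m - int (Suc J)"] by (simp add: algebra_simps)
    have s2: "sgnpow (m + 1 - int (Suc J)) = - sgnpow (m - int (Suc J))"
      using s[of "m - int (Suc J)"] by (simp add: algebra_simps)
    have "zp 1 * R m (Suc (Suc J)) = zp 1 * R m (Suc J) - of_int (sgnpow (m - int (Suc J)) * ibinom m (Suc J)) * (zp 1 * xp (int (Suc J)))"
      unfolding RS[of m "Suc J"] by (simp add: right_diff_distrib mult_ac)
    also have "\<dots> = R (m + 1) (Suc (Suc J)) - of_int (sgnpow (m - int (Suc J)) * ibinom m (Suc J)) * xp (int (Suc (Suc J)))"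
      unfolding Suc.IH e RS[of "m + 1" "Suc J"] ibinom_Suc_Suc s1 s2 by (simp add: algebra_simps)
    finally show ?case .
  qed
  have "\<forall>J. zord (int J) (R m J)"
  proof (induction m rule: int_induct[where k = 0])
    case base
    have "R 0 (Suc J) = 0" for J
      by (induction J) (simp_all add: RS R0 ibinom_0_left sgnpow_def)
    then show ?case using zord_zp[of 0] by (metis R0 zord_zero not0_implies_Suc of_nat_0)
  next
    case (step1 m)
    show ?case
    proof
      fix J show "zord (int J) (R (m + 1) J)"
      proof (cases J)
        case 0 then show ?thesis using zord_zp by (simp add: R0)
      next
        case (Suc J')
        have "zord (0 + int (Suc J')) (zp 1 * R m (Suc J'))" using step1 by (intro zord_mult zord_zp) blast
        moreover have "zord (int (Suc J')) (of_int (sgnpow (m - int J') * ibinom m J') * xp (int (Suc J')) :: 'k fls)"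
          by (intro zord_of_int_mult zord_xp)
        ultimately have "zord (int (Suc J')) (zp 1 * R m (Suc J') + of_int (sgnpow (m - int J') * ibinom m J') * xp (int (Suc J')))"
          by (intro zord_add) simp_all
        then show ?thesis unfolding step by (simp add: Suc)
      qed
    qed
  next
    case (step2 m)
    show ?case
    proof
      fix J show "zord (int J) (R (m - 1) J)"
      proof (cases J)
        case 0 then show ?thesis using zord_zp by (simp add: R0)
      next
        case (Suc J')
        have "zord (int (Suc J')) (R m (Suc J'))" using step2 by blast
        moreover have "zord (int (Suc J')) (of_int (sgnpow (m - 1 - int J') * ibinom (m - 1) J') * xp (int (Suc J')) :: 'k fls)"
          by (intro zord_of_int_mult zord_xp)
        ultimately have "zord (int (Suc J')) (zp 1 * R (m - 1) (Suc J'))"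
          unfolding step by (intro zord_diff) simp_all
        from zord_mult[OF zord_zp[of "-1"] this] show ?thesis
          by (simp add: mult.assoc[symmetric] zp_add[symmetric] Suc algebra_simps)
      qed
    qed
  qed
  then show ?thesis by (simp add: R_def)
qed

text \<open>Now x^m = (z + 1)^m in falling powers of z. For m = -n-1 the truncation yields the
  coefficients of the product in A_n(V).\<close>

lemma xp_expand_inf:
  "ideg (m - int J) (xp m - (\<Sum>j<J. of_int (ibinom m j) * zp (m - int j)) :: 'k::field fls)"
proof -
  define R where "R m J = (xp m - (\<Sum>j<J. of_int (ibinom m j) * zp (m - int j)) :: 'k fls)" for m J
  have R0: "R m 0 = xp m" for m by (simp add: R_def)
  have RS: "R m (Suc J) = R m J - of_int (ibinom m J) * zp (m - int J)" for m J
    by (simp add: R_def)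
  have step: "xp 1 * R m (Suc J) = R (m + 1) (Suc J) - of_int (ibinom m J) * zp (m - int J)" for m J
  proof (induction J)
    case 0
    show ?case by (simp add: RS R0 right_diff_distrib zp_add xp_add xp_eq algebra_simps)
  next
    case (Suc J)
    have e: "xp 1 * zp (m - int (Suc J)) = zp (m - int (Suc J)) + (zp (m - int J) :: 'k fls)"
      by (simp add: xp_eq distrib_right zp_add[symmetric])
    have "xp 1 * R m (Suc (Suc J)) = xp 1 * R m (Suc J) - of_int (ibinom m (Suc J)) * (xp 1 * zp (m - int (Suc J)))"
      unfolding RS[of m "Suc J"] by (simp add: right_diff_distrib mult_ac)
    also have "\<dots> = R (m + 1) (Suc (Suc J)) - of_int (ibinom m (Suc J)) * zp (m - int (Suc J))"
      unfolding Suc.IH e RS[of "m + 1" "Suc J"] ibinom_Suc_Suc by (simp add: algebra_simps)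
    finally show ?case .
  qed
  have "\<forall>J. ideg (m - int J) (R m J)"
  proof (induction m rule: int_induct[where k = 0])
    case base
    have "R 0 (Suc J) = 0" for J
      by (induction J) (simp_all add: RS R0 ibinom_0_left)
    then show ?case using ideg_xp[of 0] by (metis R0 ideg_zero not0_implies_Suc of_nat_0 diff_zero)
  next
    case (step1 m)
    show ?case
    proof
      fix J show "ideg (m + 1 - int J) (R (m + 1) J)"
      proof (cases J)
        case 0 then show ?thesis using ideg_xp by (simp add: R0)
      next
        case (Suc J')
        have "ideg (1 + (m - int (Suc J'))) (xp 1 * R m (Suc J'))" using step1 by (intro ideg_mult ideg_xp) blast
        moreover have "ideg (m - int J') (of_int (ibinom m J') * zp (m - int J') :: 'k fls)"
          by (intro ideg_of_int_mult ideg_zp)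
        ultimately have "ideg (m - int J') (xp 1 * R m (Suc J') + of_int (ibinom m J') * zp (m - int J'))"
          by (intro ideg_add) simp_all
        then show ?thesis unfolding step by (simp add: Suc)
      qed
    qed
  next
    case (step2 m)
    show ?case
    proof
      fix J show "ideg (m - 1 - int J) (R (m - 1) J)"
      proof (cases J)
        case 0 then show ?thesis using ideg_xp by (simp add: R0)
      next
        case (Suc J')
        have "ideg (m - int (Suc J')) (R m (Suc J'))" using step2 by blast
        moreover have "ideg (m - 1 - int J') (of_int (ibinom (m - 1) J') * zp (m - 1 - int J') :: 'k fls)"
          by (intro ideg_of_int_mult ideg_zp)
        ultimately have "ideg (m - 1 - int J') (xp 1 * R (m - 1) (Suc J'))"
          unfolding step by (intro ideg_diff) (simp_all add: algebra_simps)
        from ideg_mult[OF ideg_xp[of "-1"] this] show ?thesis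
          by (simp add: mult.assoc[symmetric] xp_add[symmetric] Suc algebra_simps)
      qed
    qed
  qed
  then show ?thesis by (simp add: R_def)
qed

lemma ibinom_neg_Suc: "ibinom (- int i - 1) m = (-1) ^ m * ibinom (int (i + m)) m"
proof -
  have "- (int i + 1) = - int i - 1" "int i + 1 + int m - 1 = int (i + m)" by simp_all
  then show ?thesis using ibinom_minus[of "int i + 1" m] by (simp only:)
qed

section \<open>Formal sums and gradings\<close>

lemma fsum_eq:
  assumes "\<And>i. N \<le> i \<Longrightarrow> f i = 0"
  shows "fsum f = sum f {..<N}"
proof -
  let ?L = "LEAST N. \<forall>i\<ge>N. f i = 0"
  have N: "\<forall>i\<ge>N. f i = 0" using assms by blast
  have L: "\<forall>i\<ge>?L. f i = 0" by (rule LeastI[of "\<lambda>N. \<forall>i\<ge>N. f i = 0", OF N])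
  have "?L \<le> N" by (rule Least_le[of "\<lambda>N. \<forall>i\<ge>N. f i = 0", OF N])
  then have "sum f {..<?L} = sum f {..<N}"
  proof (intro sum.mono_neutral_left ballI)
    fix i assume "i \<in> {..<N} - {..<?L}"
    then show "f i = 0" using L[rule_format, of i] by simp
  qed simp_all
  then show ?thesis unfolding fsum_def .
qed

text \<open>The common form of \<open>vcomp\<close> and \<open>mcomp\<close>, whose index types
  differ, so that facts about components are proved once.\<close>

definition gcomp :: "('i \<Rightarrow> 'm set) \<Rightarrow> 'm \<Rightarrow> 'i \<Rightarrow> 'm::ab_group_add" where
  "gcomp gr x = (THE f. (\<forall>k. f k \<in> gr k) \<and> finite {k. f k \<noteq> 0} \<and> x = sum f {k. f k \<noteq> 0})"

lemma vcomp_eq_gcomp: "vcomp V = gcomp (vgr V)"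
  by (rule ext, rule ext) (simp add: vcomp_def gcomp_def)

lemma mcomp_eq_gcomp: "mcomp M = gcomp (mgr M)"
  by (rule ext, rule ext) (simp add: mcomp_def gcomp_def)

locale graded_space = vector_space s
  for s :: "'k::field \<Rightarrow> 'm::ab_group_add \<Rightarrow> 'm" +
  fixes gr :: "'i \<Rightarrow> 'm set" and C :: "'m set"
  assumes gr_sub: "subspace (gr i)" and C_sub: "subspace C" and gr_C: "gr i \<subseteq> C"
    and decomp: "x \<in> C \<Longrightarrow> \<exists>!f. (\<forall>k. f k \<in> gr k) \<and> finite {k. f k \<noteq> 0} \<and> x = sum f {k. f k \<noteq> 0}"
begin

lemma gcomp:
  assumes "x \<in> C"
  shows gcomp_in: "gcomp gr x k \<in> gr k" and gcomp_finite: "finite {k. gcomp gr x k \<noteq> 0}"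
    and gcomp_sum: "x = sum (gcomp gr x) {k. gcomp gr x k \<noteq> 0}"
  using theI'[OF decomp[OF assms]] unfolding gcomp_def by blast+

lemma gcomp_unique:
  assumes "\<And>k. f k \<in> gr k" "finite S" "\<And>k. k \<notin> S \<Longrightarrow> f k = 0" "x = sum f S"
  shows "gcomp gr x = f"
proof -
  have fin: "finite {k. f k \<noteq> 0}" by (rule finite_subset[OF _ assms(2)]) (use assms(3) in auto)
  have xs: "x = sum f {k. f k \<noteq> 0}"
    unfolding assms(4) by (rule sum.mono_neutral_right) (use assms in auto)
  have "sum f S \<in> C" by (intro subspace_sum C_sub) (use gr_C assms(1) in blast)
  then have "x \<in> C" using assms(4) by simp
  then show ?thesis unfolding gcomp_def
    using assms(1) fin xs by (intro the1_equality decomp) auto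
qed

lemma gcomp_sum_superset:
  assumes "x \<in> C" "finite S" "{k. gcomp gr x k \<noteq> 0} \<subseteq> S"
  shows "x = sum (gcomp gr x) S"
  using gcomp_sum[OF assms(1)] sum.mono_neutral_left[OF assms(2,3)] by force

lemma gcomp_homog:
  assumes "x \<in> gr i"
  shows "gcomp gr x = (\<lambda>j. if j = i then x else 0)"
  by (rule gcomp_unique[where S = "{i}"]) (use assms gr_sub in \<open>auto intro: subspace_0\<close>)

lemma gcomp_add:
  assumes "x \<in> C" "y \<in> C"
  shows "gcomp gr (x + y) = (\<lambda>k. gcomp gr x k + gcomp gr y k)"
proof (rule gcomp_unique[where S = "{k. gcomp gr x k \<noteq> 0} \<union> {k. gcomp gr y k \<noteq> 0}"])
  show "gcomp gr x k + gcomp gr y k \<in> gr k" for k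
    by (intro subspace_add gr_sub gcomp_in assms)
  let ?S = "{k. gcomp gr x k \<noteq> 0} \<union> {k. gcomp gr y k \<noteq> 0}"
  show fin: "finite ?S" using assms gcomp_finite by auto
  show "gcomp gr x k + gcomp gr y k = 0" if "k \<notin> ?S" for k using that by auto
  have "x = sum (gcomp gr x) ?S" "y = sum (gcomp gr y) ?S"
    using gcomp_sum_superset[OF assms(1) fin] gcomp_sum_superset[OF assms(2) fin] by auto
  then show "x + y = (\<Sum>k\<in>?S. gcomp gr x k + gcomp gr y k)"
    by (simp add: sum.distrib)
qed

lemma gcomp_scale:
  assumes "x \<in> C"
  shows "gcomp gr (s c x) = (\<lambda>k. s c (gcomp gr x k))"
proof (rule gcomp_unique[where S = "{k. gcomp gr x k \<noteq> 0}"])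
  show "s c (gcomp gr x k) \<in> gr k" for k by (intro subspace_scale gr_sub gcomp_in assms)
  show "finite {k. gcomp gr x k \<noteq> 0}" by (rule gcomp_finite[OF assms])
  show "s c (gcomp gr x k) = 0" if "k \<notin> {k. gcomp gr x k \<noteq> 0}" for k using that by auto
  show "s c x = (\<Sum>k\<in>{k. gcomp gr x k \<noteq> 0}. s c (gcomp gr x k))"
    using gcomp_sum[OF assms] scale_sum_right by metis
qed

lemma gcomp_0: "gcomp gr 0 = (\<lambda>k. 0)"
  by (rule gcomp_unique[where S = "{}"]) (use gr_sub in \<open>auto intro: subspace_0\<close>)

lemma homog_induct [consumes 1, case_names homog add]:
  assumes "x \<in> C" and homog: "\<And>i y. y \<in> gr i \<Longrightarrow> P y"
    and add: "\<And>y z. y \<in> C \<Longrightarrow> z \<in> C \<Longrightarrow> P y \<Longrightarrow> P z \<Longrightarrow> P (y + z)"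
  shows "P x"
proof -
  have P0: "P 0" using homog[of 0] gr_sub subspace_0 by blast
  have "P (sum (gcomp gr x) S) \<and> sum (gcomp gr x) S \<in> C" if "finite S" for S
    using that
  proof (induction S)
    case empty show ?case using P0 C_sub by (simp add: subspace_0)
  next
    case (insert i S)
    have *: "gcomp gr x i \<in> gr i" by (rule gcomp_in[OF assms(1)])
    then have "gcomp gr x i \<in> C" using gr_C by blast
    then show ?case using insert add homog[OF *] C_sub by (simp add: subspace_add)
  qed
  from this[OF gcomp_finite[OF assms(1)]] gcomp_sum[OF assms(1)] show ?thesis by simp
qed

end

section \<open>Weak modules\<close>

locale voa =
  fixes V :: "('k::field, 'v::ab_group_add) voa"
  assumes voa: "is_voa V"
begin

abbreviation "sV \<equiv> vsc V"
abbreviation "Y \<equiv> vY V"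
abbreviation "vac \<equiv> vvac V"

sublocale sv: vector_space sV using voa by (simp add: is_voa_def)

lemma Y_add_right: "Y u k (x + y) = Y u k x + Y u k y"
  using voa by (simp add: is_voa_def linon_def)
lemma Y_scale_right: "Y u k (sV c x) = sV c (Y u k x)"
  using voa by (simp add: is_voa_def linon_def)
lemma Y_add_left: "Y (u + u') k x = Y u k x + Y u' k x"
  using voa by (simp add: is_voa_def linon_def)
lemma Y_scale_left: "Y (sV c u) k x = sV c (Y u k x)"
  using voa by (simp add: is_voa_def linon_def)
lemma Y_trunc: "\<exists>N. \<forall>l\<ge>N. Y u l v = 0"
  using voa by (simp add: is_voa_def)
lemma Y_vac: "Y vac k v = (if k = -1 then v else 0)"
  using voa by (simp add: is_voa_def)
lemma Y_creation: "Y u (-1) vac = u" "0 \<le> k \<Longrightarrow> Y u k vac = 0"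
  using voa by (simp_all add: is_voa_def)
lemma vac_gr: "vac \<in> vgr V 0" using voa by (simp add: is_voa_def)
lemma Y_gr: "u \<in> vgr V d \<Longrightarrow> v \<in> vgr V e \<Longrightarrow> Y u k v \<in> vgr V (d + e - k - 1)"
  using voa unfolding is_voa_def by blast
lemma Y_borcherds: "borcherds Y UNIV sV Y"
  using voa by (simp add: is_voa_def)
lemma Y_L: "Y (vL V (-1) v) k w = sV (of_int (- k)) (Y v (k - 1) w)"
  using voa unfolding is_voa_def by blast
lemma L0: "v \<in> vgr V k \<Longrightarrow> vL V 0 v = sV (of_int k) v"
  using voa by (simp add: is_voa_def)

lemma L_minus_one: "vL V (-1) v = Y v (-2) vac"
  using Y_L[of v "-1" vac] Y_creation(1)[of "vL V (-1) v"] by simp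

sublocale gv: graded_space sV "vgr V" UNIV
  using voa by unfold_locales (auto simp: is_voa_def sv.subspace_def)

lemma Y_0_left [simp]: "Y 0 k x = 0" using Y_scale_left[of 0 0 k x] by simp
lemma Y_0_right [simp]: "Y u k 0 = 0" using Y_scale_right[of u k 0 0] by simp
lemmas V_induct = gv.homog_induct[OF UNIV_I, case_names homog add]

end

locale wmod = voa V + vs: vector_space s
  for V :: "('k::field, 'v::ab_group_add) voa"
  and s :: "'k \<Rightarrow> 'm::ab_group_add \<Rightarrow> 'm" +
  fixes C :: "'m set" and A :: "'v \<Rightarrow> int \<Rightarrow> 'm \<Rightarrow> 'm"
  assumes C_sub: "vs.subspace C"
    and A_closed: "w \<in> C \<Longrightarrow> A v k w \<in> C"
    and A_add_right: "w \<in> C \<Longrightarrow> w' \<in> C \<Longrightarrow> A v k (w + w') = A v k w + A v k w'"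
    and A_scale_right: "w \<in> C \<Longrightarrow> A v k (s c w) = s c (A v k w)"
    and A_add_left: "w \<in> C \<Longrightarrow> A (v + v') k w = A v k w + A v' k w"
    and A_scale_left: "w \<in> C \<Longrightarrow> A (sV c v) k w = s c (A v k w)"
    and A_trunc: "w \<in> C \<Longrightarrow> \<exists>N. \<forall>l\<ge>N. A v l w = 0"
    and A_vac: "w \<in> C \<Longrightarrow> A vac k w = (if k = -1 then w else 0)"
    and A_borcherds: "borcherds Y C s A"
begin

lemma A_0_left [simp]: "w \<in> C \<Longrightarrow> A 0 k w = 0" using A_scale_left[of w 0 0 k] by simp
lemma A_0_right [simp]: "A v k 0 = 0"
  using A_scale_right[of 0 v k 0] C_sub by (simp add: vs.subspace_0)

lemma A_sum_right: "(\<And>i. i \<in> S \<Longrightarrow> f i \<in> C) \<Longrightarrow> A v k (sum f S) = (\<Sum>i\<in>S. A v k (f i))"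
proof (induction S rule: infinite_finite_induct)
  case (insert i S)
  then have "sum f S \<in> C" by (intro vs.subspace_sum C_sub) auto
  with insert show ?case by (simp add: A_add_right)
qed simp_all

lemma borcherds_sum:
  assumes w: "w \<in> C"
    and 1: "\<And>i. N1 \<le> i \<Longrightarrow> s (of_int (ibinom p i)) (A (Y u (r + int i) v) (p + q - int i) w) = 0"
    and 2: "\<And>i. N2 \<le> i \<Longrightarrow> s (of_int ((-1)^i * ibinom r i))
        (A u (p + r - int i) (A v (q + int i) w)
          - s (of_int (sgnpow r)) (A v (q + r - int i) (A u (p + int i) w))) = 0"
  shows "(\<Sum>i<N1. s (of_int (ibinom p i)) (A (Y u (r + int i) v) (p + q - int i) w))
    = (\<Sum>i<N2. s (of_int ((-1)^i * ibinom r i))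
        (A u (p + r - int i) (A v (q + int i) w)
          - s (of_int (sgnpow r)) (A v (q + r - int i) (A u (p + int i) w))))"
proof -
  have "fsum (\<lambda>i. s (of_int (ibinom p i)) (A (Y u (r + int i) v) (p + q - int i) w))
    = fsum (\<lambda>i. s (of_int ((-1)^i * ibinom r i))
        (A u (p + r - int i) (A v (q + int i) w)
          - s (of_int (sgnpow r)) (A v (q + r - int i) (A u (p + int i) w))))"
    using A_borcherds w unfolding borcherds_def by blast
  then show ?thesis by (simp only: fsum_eq[of N1, OF 1] fsum_eq[of N2, OF 2])
qed

text \<open>The element \<open>Y a (- int i - 1) vac\<close> is the i-th divided power of
  translation applied to \<open>a\<close>. The Borcherds identity with the vacuum as second element
  and p = 0 has one term on the left and at most one on the right, where the vacuum mode has index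
  -1.\<close>

lemma A_D:
  assumes w: "w \<in> C"
  shows "A (Y a (- int i - 1) vac) q w = s (of_int ((-1)^i * ibinom q i)) (A a (q - int i) w)"
proof -
  let ?r = "- int i - 1"
  define T where "T j = s (of_int ((-1)^j * ibinom ?r j))
        (A a (?r - int j) (A vac (q + int j) w)
          - s (of_int (sgnpow ?r)) (A vac (q + ?r - int j) (A a (int j) w)))" for j
  have "(\<Sum>j<1. s (of_int (ibinom 0 j)) (A (Y a (?r + int j) vac) (0 + q - int j) w))
     = (\<Sum>j<nat \<bar>q\<bar> + i + 1. s (of_int ((-1)^j * ibinom ?r j))
        (A a (0 + ?r - int j) (A vac (q + int j) w)
          - s (of_int (sgnpow ?r)) (A vac (q + ?r - int j) (A a (0 + int j) w))))"
    by (rule borcherds_sum[OF w]) (auto simp: ibinom_0_left A_vac A_closed w)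
  then have main: "A (Y a ?r vac) q w = (\<Sum>j<nat \<bar>q\<bar> + i + 1. T j)"
    by (simp add: T_def)
  show ?thesis
  \<comment> \<open>The vacuum mode has index -1 in the first product at j = -1 - q if q < 0, in the
    second at j = q - i if q \<ge> i, and nowhere for 0 \<le> q < i, where the binomial vanishes
    too.\<close>
  proof (cases "q < 0")
    case True
    define m where "m = nat (- 1 - q)"
    have qm: "q = - int m - 1" using True by (simp add: m_def)
    have "T j = 0" if "j \<noteq> m" for j
      using that unfolding T_def by (auto simp: A_vac w A_closed qm)
    then have "(\<Sum>j<nat \<bar>q\<bar> + i + 1. T j) = (\<Sum>j\<in>{m}. T j)"
      by (intro sum.mono_neutral_right) (auto simp: m_def)
    moreover have "T m = s (of_int ((-1)^m * ibinom ?r m)) (A a (?r - int m) w)"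
      unfolding T_def by (simp add: A_vac w A_closed qm)
    moreover have "?r - int m = q - int i" by (simp add: qm)
    moreover have "(-1)^m * ibinom ?r m = (-1)^i * ibinom q i"
    proof -
      have "(-1)^m * ibinom ?r m = ibinom (int (i + m)) m"
        by (simp add: ibinom_neg_Suc)
      also have "\<dots> = ibinom (int (i + m)) i" using ibinom_symmetric[of i m] by simp
      also have "\<dots> = (-1)^i * ibinom q i"
        using ibinom_neg_Suc[of m i] by (simp add: qm add.commute)
      finally show ?thesis .
    qed
    moreover have "sum T {m} = T m" by simp
    ultimately show ?thesis using main by (simp only:)
  next
    case False
    show ?thesis
    proof (cases "int i \<le> q")
      case True
      define m where "m = nat (q - int i)"
      have qm: "q = int i + int m" using True by (simp add: m_def)
      have "T j = 0" if "j \<noteq> m" for j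
        using that unfolding T_def by (auto simp: A_vac w A_closed qm)
      then have "(\<Sum>j<nat \<bar>q\<bar> + i + 1. T j) = (\<Sum>j\<in>{m}. T j)"
        by (intro sum.mono_neutral_right) (auto simp: m_def)
      moreover have "T m = s (of_int ((-1)^m * ibinom ?r m * (- sgnpow ?r))) (A a (q - int i) w)"
        unfolding T_def by (simp add: A_vac w A_closed qm)
      moreover have "(-1)^m * ibinom ?r m * (- sgnpow ?r) = (-1)^i * ibinom q i"
      proof -
        have "(-1)^m * ibinom ?r m = ibinom (int (i + m)) m"
          by (simp add: ibinom_neg_Suc)
        moreover have "- sgnpow ?r = (-1)^i" by (simp add: sgnpow_def)
        ultimately show ?thesis using ibinom_symmetric[of i m] by (simp add: qm algebra_simps)
      qed
      moreover have "sum T {m} = T m" by simp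
      ultimately show ?thesis using main by (simp only:)
    next
      case F: False
      have "T j = 0" for j
        unfolding T_def using False F by (auto simp: A_vac w A_closed)
      moreover have "ibinom q i = 0" using False F by (intro ibinom_nonneg_eq_0) auto
      ultimately show ?thesis using main by simp
    qed
  qed
qed

text \<open>Weak associativity expresses a product of two modes through modes of products.\<close>

lemma A_A_span:
  assumes w: "w \<in> C"
  shows "A u k (A v l w) \<in> vs.span {A (Y u j v) (k + l - j) w | j. True}"
proof -
  obtain N where N: "\<forall>i\<ge>N. A u i w = 0" using A_trunc[OF w] by blast
  obtain Q where Q: "\<forall>i\<ge>Q. A v i w = 0" using A_trunc[OF w] by blast
  let ?S = "\<lambda>t. vs.span {A (Y u j v) (t - j) w | j. True}"
  \<comment> \<open>With p = N the products in which \<open>u\<close> acts first vanish, and the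
    Borcherds identity can be solved for the product of \<open>u\<close> and the q-th mode of
    \<open>v\<close> modulo products with larger \<open>q\<close>. So the induction descends in
    \<open>q\<close> from the truncation bound \<open>Q\<close>, with \<open>r\<close> free.\<close>
  have "\<forall>r q. Q \<le> q + int m \<longrightarrow> A u (N + r) (A v q w) \<in> ?S (N + r + q)" for m
  proof (induction m)
    case 0
    then show ?case using Q by (simp add: vs.span_zero)
  next
    case (Suc m)
    show ?case
    proof (intro allI impI)
      fix r q assume q: "Q \<le> q + int (Suc m)"
      obtain K where K: "\<forall>l\<ge>K. Y u l v = 0" using Y_trunc by blast
      let ?N1 = "nat (K - r)" and ?N2 = "Suc m"
      define Z where "Z = (\<Sum>i<m. s (of_int ((-1)^Suc i * ibinom r (Suc i)))
          (A u (N + (r - int (Suc i))) (A v (q + int (Suc i)) w)))"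
      have LR: "(\<Sum>i<?N1. s (of_int (ibinom N i)) (A (Y u (r + int i) v) (N + q - int i) w))
        = (\<Sum>i<?N2. s (of_int ((-1)^i * ibinom r i))
          (A u (N + r - int i) (A v (q + int i) w)
            - s (of_int (sgnpow r)) (A v (q + r - int i) (A u (N + int i) w))))" (is "?L = ?R")
        using K N Q q by (intro borcherds_sum[OF w]) (auto simp: w)
      have LS: "?L \<in> ?S (N + r + q)"
      proof (intro vs.span_sum vs.span_scale vs.span_base)
        fix i
        have "N + q - int i = N + r + q - (r + int i)" by simp
        then have "A (Y u (r + int i) v) (N + q - int i) w = A (Y u (r + int i) v) (N + r + q - (r + int i)) w"
          by (simp only:)
        then show "A (Y u (r + int i) v) (N + q - int i) w \<in> {A (Y u j v) (N + r + q - j) w | j. True}"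
          by blast
      qed
      have RZ: "?R = A u (N + r) (A v q w) + Z"
        unfolding sum.lessThan_Suc_shift Z_def using N by (simp add: algebra_simps)
      have ZS: "Z \<in> ?S (N + r + q)" unfolding Z_def
      proof (intro vs.span_sum vs.span_scale)
        fix i
        have e: "N + (r - int (Suc i)) + (q + int (Suc i)) = N + r + q" by simp
        have "Q \<le> q + int (Suc i) + int m" using q by simp
        with Suc.IH have "A u (N + (r - int (Suc i))) (A v (q + int (Suc i)) w)
            \<in> ?S (N + (r - int (Suc i)) + (q + int (Suc i)))" by blast
        then show "A u (N + (r - int (Suc i))) (A v (q + int (Suc i)) w) \<in> ?S (N + r + q)"
          unfolding e .
      qed
      have "A u (N + r) (A v q w) = ?L - Z" unfolding LR RZ by simp
      then show "A u (N + r) (A v q w) \<in> ?S (N + r + q)"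
        using vs.span_diff[OF LS ZS] by (simp only:)
    qed
  qed
  moreover have "Q \<le> l + int (nat (Q - l))" by simp
  ultimately have "A u (N + (k - N)) (A v l w) \<in> ?S (N + (k - N) + l)" by blast
  then show ?thesis by simp
qed

text \<open>This is o(a), stated for weak modules so that it serves graded modules and spaces of
  functionals alike.\<close>

definition zmode :: "'v \<Rightarrow> 'm \<Rightarrow> 'm" where
  "zmode a w = (\<Sum>d\<in>{d. vcomp V a d \<noteq> 0}. A (vcomp V a d) (d - 1) w)"

lemma zmode_superset:
  assumes "w \<in> C" "finite S" "{d. vcomp V a d \<noteq> 0} \<subseteq> S"
  shows "zmode a w = (\<Sum>d\<in>S. A (vcomp V a d) (d - 1) w)"
  unfolding zmode_def using assms by (intro sum.mono_neutral_left) auto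

lemma zmode_homog: "w \<in> C \<Longrightarrow> a \<in> vgr V d \<Longrightarrow> zmode a w = A a (d - 1) w"
proof -
  assume w: "w \<in> C" and a: "a \<in> vgr V d"
  have c: "vcomp V a = (\<lambda>j. if j = d then a else 0)"
    unfolding vcomp_eq_gcomp by (rule gv.gcomp_homog[OF a])
  have "zmode a w = (\<Sum>d\<in>{d}. A (vcomp V a d) (d - 1) w)"
    by (rule zmode_superset[OF w]) (auto simp: c)
  then show ?thesis by (simp add: c)
qed

lemma zmode_closed: "w \<in> C \<Longrightarrow> zmode a w \<in> C"
  unfolding zmode_def by (intro vs.subspace_sum C_sub A_closed)

lemma zmode_add:
  assumes "w \<in> C"
  shows "zmode (a + b) w = zmode a w + zmode b w"
proof -
  let ?S = "{d. vcomp V a d \<noteq> 0} \<union> {d. vcomp V b d \<noteq> 0}"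
  have c: "vcomp V (a + b) = (\<lambda>d. vcomp V a d + vcomp V b d)"
    unfolding vcomp_eq_gcomp by (rule gv.gcomp_add) auto
  have fin: "finite ?S" using gv.gcomp_finite by (simp add: vcomp_eq_gcomp)
  have "zmode (a + b) w = (\<Sum>d\<in>?S. A (vcomp V (a + b) d) (d - 1) w)"
    by (rule zmode_superset[OF assms fin]) (auto simp: c)
  also have "\<dots> = (\<Sum>d\<in>?S. A (vcomp V a d) (d - 1) w) + (\<Sum>d\<in>?S. A (vcomp V b d) (d - 1) w)"
    by (simp add: c A_add_left assms sum.distrib)
  finally show ?thesis using zmode_superset[OF assms fin] by simp
qed

lemma zmode_scale:
  assumes "w \<in> C"
  shows "zmode (sV c a) w = s c (zmode a w)"
proof -
  have c: "vcomp V (sV c a) = (\<lambda>d. sV c (vcomp V a d))"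
    unfolding vcomp_eq_gcomp by (rule gv.gcomp_scale) auto
  have "zmode (sV c a) w = (\<Sum>d\<in>{d. vcomp V a d \<noteq> 0}. A (vcomp V (sV c a) d) (d - 1) w)"
  proof (intro zmode_superset assms)
    show "finite {d. vcomp V a d \<noteq> 0}" by (simp add: vcomp_eq_gcomp gv.gcomp_finite)
  qed (auto simp: c)
  then show ?thesis by (simp add: c A_scale_left assms zmode_def vs.scale_sum_right)
qed

lemma zmode_0: "w \<in> C \<Longrightarrow> zmode 0 w = 0" using zmode_scale[of w 0 0] by simp

lemma zmode_sum: "w \<in> C \<Longrightarrow> zmode (sum f S) w = (\<Sum>i\<in>S. zmode (f i) w)"
  by (induction S rule: infinite_finite_induct) (simp_all add: zmode_add zmode_0)

lemma zmode_add_right: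
  "w \<in> C \<Longrightarrow> w' \<in> C \<Longrightarrow> zmode a (w + w') = zmode a w + zmode a w'"
  unfolding zmode_def by (simp add: A_add_right sum.distrib)

lemma zmode_scale_right: "w \<in> C \<Longrightarrow> zmode a (s c w) = s c (zmode a w)"
  unfolding zmode_def by (simp add: A_scale_right vs.scale_sum_right)

lemma zmode_vac: "w \<in> C \<Longrightarrow> zmode vac w = w"
  using zmode_homog[OF _ vac_gr] by (simp add: A_vac)

text \<open>The space usually called Omega_n: vectors killed by every mode that lowers degrees by
  more than n. It replaces M(n) where no grading is at hand.\<close>

definition low :: "nat \<Rightarrow> 'm \<Rightarrow> bool" where
  "low n w \<longleftrightarrow> w \<in> C \<and> (\<forall>d. \<forall>a\<in>vgr V d. \<forall>k\<ge>d + int n. A a k w = 0)"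

end

context voa
begin

lemma Y_trunc_nat: "\<exists>N. \<forall>i\<ge>N. Y a (int i - m) b = 0"
proof -
  obtain K where K: "\<forall>l\<ge>K. Y a l b = 0" using Y_trunc by blast
  have "\<forall>i\<ge>nat (K + m). Y a (int i - m) b = 0" using K by auto
  then show ?thesis by blast
qed

end

text \<open>For k \<le> n this is the coefficient, in the action of the product of a and b in
  A_n(V), of the mode of b of degree -k followed by the mode of a of degree k. Factoring out
  binom(n+k,n) leaves the alternating row sum (1 - 1)^k, so only o(a) o(b) survives.\<close>

lemma star_coefficient:
  "(\<Sum>j\<le>k. ((-1)^j * int ((j + n) choose n)) * ((-1)^(k - j) * ibinom (- int n - int j - 1) (k - j)))
    = (if k = 0 then 1 else 0)"
proof -
  have "((-1)^j * int ((j + n) choose n)) * ((-1)^(k - j) * ibinom (- int n - int j - 1) (k - j))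
      = int ((n + k) choose n) * ((-1)^j * int (k choose j))" if "j \<le> k" for j
  proof -
    have 1: "- int n - int j - 1 = - int (n + j) - 1" by simp
    have "(-1)^(k - j) * ibinom (- int n - int j - 1) (k - j) = int ((n + k) choose (k - j))"
      unfolding 1 ibinom_neg_Suc using that ibinom_of_nat[of "n + k" "k - j"]
      by (simp add: power_mult_distrib[symmetric] mult.assoc[symmetric])
    also have "(n + k) choose (k - j) = (n + k) choose (n + j)"
      using binomial_symmetric[of "k - j" "n + k"] that by simp
    finally have 2: "(-1)^(k - j) * ibinom (- int n - int j - 1) (k - j) = int ((n + k) choose (n + j))" .
    have "((n + k) choose (n + j)) * ((n + j) choose n) = ((n + k) choose n) * (k choose j)"
      using choose_mult[of n "n + j" "n + k"] that by simp
    then have "int ((n + k) choose (n + j)) * int ((j + n) choose n) = int ((n + k) choose n) * int (k choose j)"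
      by (metis of_nat_mult add.commute)
    then show ?thesis unfolding 2 by (simp add: mult_ac)
  qed
  then have "(\<Sum>j\<le>k. ((-1)^j * int ((j + n) choose n)) * ((-1)^(k - j) * ibinom (- int n - int j - 1) (k - j)))
      = int ((n + k) choose n) * (\<Sum>j\<le>k. (-1)^j * int (k choose j))"
    unfolding sum_distrib_left by (intro sum.cong) auto
  also have "\<dots> = (if k = 0 then 1 else 0)"
    using choose_alternating_sum[of k, where ?'a = int] by auto
  finally show ?thesis .
qed

context voa
begin

lemma fsum_Y_eq:
  assumes "\<And>i. h i = int i - m"
  shows "\<exists>N0. \<forall>N\<ge>N0. fsum (\<lambda>i. sV (c i) (Y a (h i) b)) = (\<Sum>i<N. sV (c i) (Y a (h i) b))
     \<and> (\<forall>i\<ge>N. Y a (h i) b = 0)"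
proof -
  obtain N0 where N0: "\<forall>i\<ge>N0. Y a (int i - m) b = 0" using Y_trunc_nat by blast
  show ?thesis
  proof (intro exI[of _ N0] allI impI)
    fix N assume "N0 \<le> N"
    then have "\<And>i. N \<le> i \<Longrightarrow> Y a (h i) b = 0" using N0 assms by simp
    then show "fsum (\<lambda>i. sV (c i) (Y a (h i) b)) = (\<Sum>i<N. sV (c i) (Y a (h i) b))
       \<and> (\<forall>i\<ge>N. Y a (h i) b = 0)"
      by (intro conjI fsum_eq) auto
  qed
qed

lemma fsum_Y_add:
  assumes "\<And>i. h i = int i - m"
  shows "fsum (\<lambda>i. sV (c i) (Y a (h i) (b + b')))
    = fsum (\<lambda>i. sV (c i) (Y a (h i) b)) + fsum (\<lambda>i. sV (c i) (Y a (h i) b'))"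
proof -
  obtain N1 N2 N3 where *: "\<forall>N\<ge>N1. fsum (\<lambda>i. sV (c i) (Y a (h i) b)) = (\<Sum>i<N. sV (c i) (Y a (h i) b))"
    "\<forall>N\<ge>N2. fsum (\<lambda>i. sV (c i) (Y a (h i) b')) = (\<Sum>i<N. sV (c i) (Y a (h i) b'))"
    "\<forall>N\<ge>N3. fsum (\<lambda>i. sV (c i) (Y a (h i) (b + b'))) = (\<Sum>i<N. sV (c i) (Y a (h i) (b + b')))"
    using fsum_Y_eq[of h m c a, OF assms] by meson
  let ?N = "N1 + N2 + N3"
  show ?thesis
    using *(1)[rule_format, of ?N] *(2)[rule_format, of ?N] *(3)[rule_format, of ?N]
    by (simp add: Y_add_right sv.scale_right_distrib sum.distrib)
qed

lemma circ_add_right: "circ V n s t d a (b + b') = circ V n s t d a b + circ V n s t d a b'"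
  unfolding circ_def by (rule fsum_Y_add[where m = "2 * int n + 2 + int t"]) simp

lemma starh_add_right: "starh V n d a (b + b') = starh V n d a b + starh V n d a b'"
proof -
  have "fsum (\<lambda>i. sV (of_int (ibinom (d + int n) i)) (Y a (int i - int n - int j - 1) (b + b')))
    = fsum (\<lambda>i. sV (of_int (ibinom (d + int n) i)) (Y a (int i - int n - int j - 1) b))
    + fsum (\<lambda>i. sV (of_int (ibinom (d + int n) i)) (Y a (int i - int n - int j - 1) b'))" for j
    by (rule fsum_Y_add[where m = "int n + int j + 1"]) simp
  then show ?thesis unfolding starh_def by (simp add: sv.scale_right_distrib sum.distrib)
qed

end

section \<open>Zero modes of the elements of O_n(V) and of products in A_n(V)\<close>

context wmod
begin


text \<open>The Borcherds identity with \<open>q\<close> fixed by counting degrees, so that each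
  term on the left is the zero mode of its element. Products in which \<open>a\<close> acts first
  drop out because the modes of \<open>a\<close> from index \<open>p\<close> on kill
  \<open>w\<close>.\<close>

lemma zmode_residue:
  assumes w: "w \<in> C" and a: "a \<in> vgr V d" and b: "b \<in> vgr V e"
    and q: "q = d + e - r - 2 - p"
    and 2: "\<And>i. N \<le> i \<Longrightarrow> A b (q + int i) w = 0" "\<And>i. A a (p + int i) w = 0"
    and h: "\<And>i. h i = r + int i"
  shows "zmode (fsum (\<lambda>i. sV (of_int (ibinom p i)) (Y a (h i) b))) w
    = (\<Sum>i<N. s (of_int ((-1)^i * ibinom r i)) (A a (p + r - int i) (A b (q + int i) w)))"
proof -
  have "\<And>i. h i = int i - (- r)" using h by simp
  then obtain N1 where N1: "fsum (\<lambda>i. sV (of_int (ibinom p i)) (Y a (h i) b)) = (\<Sum>i<N1. sV (of_int (ibinom p i)) (Y a (h i) b))"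
     "\<forall>i\<ge>N1. Y a (h i) b = 0"
    using fsum_Y_eq[of h "- r" "\<lambda>i. of_int (ibinom p i)" a b] by blast
  have z: "zmode (Y a (h i) b) w = A (Y a (r + int i) b) (p + q - int i) w" for i
  proof -
    have "Y a (r + int i) b \<in> vgr V (d + e - (r + int i) - 1)" by (rule Y_gr[OF a b])
    moreover have "d + e - (r + int i) - 1 - 1 = p + q - int i" by (simp add: q)
    ultimately show ?thesis using zmode_homog[OF w] h by metis
  qed
  have "zmode (fsum (\<lambda>i. sV (of_int (ibinom p i)) (Y a (h i) b))) w
     = (\<Sum>i<N1. s (of_int (ibinom p i)) (A (Y a (r + int i) b) (p + q - int i) w))"
    unfolding N1(1) by (simp add: zmode_sum zmode_scale w z)
  also have "\<dots> = (\<Sum>i<N. s (of_int ((-1)^i * ibinom r i))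
        (A a (p + r - int i) (A b (q + int i) w)
          - s (of_int (sgnpow r)) (A b (q + r - int i) (A a (p + int i) w))))"
    by (rule borcherds_sum[OF w]) (use N1 2 h w in simp_all)
  also have "\<dots> = (\<Sum>i<N. s (of_int ((-1)^i * ibinom r i)) (A a (p + r - int i) (A b (q + int i) w)))"
    using 2 by simp
  finally show ?thesis .
qed

lemma low_C: "low n w \<Longrightarrow> w \<in> C" by (simp add: low_def)
lemma low_A: "low n w \<Longrightarrow> a \<in> vgr V d \<Longrightarrow> d + int n \<le> k \<Longrightarrow> A a k w = 0" by (simp add: low_def)

lemma zmode_circ:
  assumes "low n w" "a \<in> vgr V d" "t' \<le> t"
  shows "zmode (circ V n t' t d a b) w = 0"
proof (induction b rule: V_induct)
  case (homog e b)
  \<comment> \<open>Here p = d + n + t', so all modes of \<open>a\<close> from p on kill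
    \<open>w\<close>, and q = e + n + t - t'. Because t' \<le> t, this is already in the range where
    \<open>b\<close> kills \<open>w\<close>, and the sum is empty.\<close>
  have "zmode (circ V n t' t d a b) w = (\<Sum>i<0. s (of_int ((-1)^i * ibinom (- 2 * int n - 2 - int t) i))
     (A a (d + int n + int t' + (- 2 * int n - 2 - int t) - int i) (A b (e + int n + int t - int t' + int i) w)))"
    unfolding circ_def
    by (rule zmode_residue[OF low_C[OF assms(1)] assms(2) homog])
      (use assms homog in \<open>auto intro!: low_A[OF assms(1)]\<close>)
  then show ?case by simp
next
  case (add b b')
  then show ?case by (simp add: circ_add_right zmode_add low_C[OF assms(1)])
qed

lemma zmode_L:
  assumes w: "w \<in> C"
  shows "zmode (vL V (-1) a + vL V 0 a) w = 0"
proof (induction a rule: V_induct)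
  case (homog d a)
  have 1: "vL V (-1) a = Y a (-2) vac" by (rule L_minus_one)
  have "Y a (-2) vac \<in> vgr V (d + 1)" using Y_gr[OF homog vac_gr, of "-2"] by (simp add: add.commute)
  then have "zmode (vL V (-1) a) w = A (Y a (- int 1 - 1) vac) d w"
    unfolding 1 using zmode_homog[OF w] by fastforce
  also have "\<dots> = s (of_int (- d)) (A a (d - 1) w)"
    unfolding A_D[OF w] by simp
  finally show ?case
    using zmode_homog[OF w homog] by (simp add: zmode_add zmode_scale w L0[OF homog] vs.scale_left_distrib[symmetric])
next
  case (add a b)
  have "vL V k (a + b) = vL V k a + vL V k b" for k by (simp add: vL_def Y_add_right)
  then have "vL V (-1) (a + b) + vL V 0 (a + b) = (vL V (-1) a + vL V 0 a) + (vL V (-1) b + vL V 0 b)"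
    by simp
  with add show ?case by (simp only: zmode_add[OF w] add_0)
qed

lemma zmode_Oset:
  assumes "low n w" "x \<in> Oset V n"
  shows "zmode x w = 0"
  using assms(2) unfolding Oset_def
proof (induction rule: sv.span_induct_alt)
  case base show ?case by (rule zmode_0[OF low_C[OF assms(1)]])
next
  case (step c x y)
  then have "zmode x w = 0"
    using zmode_L[OF low_C[OF assms(1)]] zmode_circ[OF assms(1)] by auto
  with step show ?case by (simp add: zmode_add zmode_scale low_C[OF assms(1)])
qed

text \<open>The superscript 1 raises the exponent to d + n, from which on all modes of
  \<open>a\<close> kill \<open>w\<close>. The pole order then gives q = e + n - 1, one below the
  range where \<open>b\<close> kills \<open>w\<close>, so exactly one product remains.\<close>

lemma zmode_circ_top:
  assumes low: "low n w" and n: "0 < n" and a: "a \<in> vgr V d" and b: "b \<in> vgr V e"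
  shows "zmode (circ V (n - 1) 1 1 d a b) w = A a (d - int n - 1) (A b (e + int n - 1) w)"
proof -
  have "zmode (circ V (n - 1) 1 1 d a b) w = (\<Sum>i<1. s (of_int ((-1)^i * ibinom (- 2 * int n - 1) i))
     (A a (d + int (n - 1) + int 1 + (- 2 * int n - 1) - int i) (A b (e + int n - 1 + int i) w)))"
    unfolding circ_def
    by (rule zmode_residue[OF low_C[OF low] a b])
      (use n a b in \<open>auto intro!: low_A[OF low] simp: of_nat_diff\<close>)
  moreover have "d + int (n - 1) + int 1 + (- 2 * int n - 1) - int 0 = d - int n - 1"
    using n by (simp add: of_nat_diff)
  ultimately show ?thesis by (simp add: algebra_simps)
qed

lemma zmode_starh:
  assumes low: "low n w" and a: "a \<in> vgr V d"
  shows "zmode (starh V n d a b) w = A a (d - 1) (zmode b w)"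
proof (induction b rule: V_induct)
  case (homog e b)
  have w: "w \<in> C" by (rule low_C[OF low])
  define G where "G k = A a (d - 1 - int k) (A b (e - 1 + int k) w)" for k
  \<comment> \<open>The mode e - 1 + j + i of \<open>b\<close> kills \<open>w\<close> when j + i >
    n. So the j-th summand stops at i = n - j, and the index pairs form a triangle that is regrouped
    by k = j + i.\<close>
  have j: "zmode (fsum (\<lambda>i. sV (of_int (ibinom (d + int n) i)) (Y a (int i - int n - int j - 1) b))) w
     = (\<Sum>i\<le>n - j. s (of_int ((-1)^i * ibinom (- int n - int j - 1) i)) (G (j + i)))" if "j \<le> n" for j
  proof -
    have "zmode (fsum (\<lambda>i. sV (of_int (ibinom (d + int n) i)) (Y a (int i - int n - int j - 1) b))) w
     = (\<Sum>i<Suc (n - j). s (of_int ((-1)^i * ibinom (- int n - int j - 1) i))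
         (A a (d + int n + (- int n - int j - 1) - int i) (A b (e - 1 + int j + int i) w)))"
      by (rule zmode_residue[OF w a homog])
        (use that in \<open>auto intro!: low_A[OF low a] low_A[OF low homog] simp: of_nat_diff\<close>)
    then show ?thesis unfolding lessThan_Suc_atMost G_def by (simp add: algebra_simps)
  qed
  define c where "c j i = ((-1)^j * int ((j + n) choose n)) * ((-1)^i * ibinom (- int n - int j - 1) i)" for j i
  have "zmode (starh V n d a b) w = (\<Sum>j\<le>n. \<Sum>i\<le>n - j. s (of_int (c j i)) (G (j + i)))"
    unfolding starh_def by (simp add: zmode_sum zmode_scale w j vs.scale_sum_right c_def)
  also have "\<dots> = (\<Sum>(j, i)\<in>{(j, i). j + i \<le> n}. s (of_int (c j i)) (G (j + i)))"
    by (subst sum.Sigma) (auto intro!: sum.cong)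
  also have "\<dots> = (\<Sum>k\<le>n. \<Sum>j\<le>k. s (of_int (c j (k - j))) (G (j + (k - j))))"
    by (rule sum.triangle_reindex_eq)
  also have "\<dots> = (\<Sum>k\<le>n. s (of_int (\<Sum>j\<le>k. c j (k - j))) (G k))"
    by (intro sum.cong refl) (simp add: vs.scale_sum_left)
  also have "\<dots> = (\<Sum>k\<le>n. if k = 0 then G k else 0)"
    unfolding c_def star_coefficient by (intro sum.cong) auto
  also have "\<dots> = G 0" by simp
  finally show ?case using zmode_homog[OF w homog] by (simp add: G_def)
next
  case (add b b')
  then show ?case
    using low_C[OF low] by (simp add: starh_add_right zmode_add A_add_right zmode_closed)
qed

lemma zmode_star:
  assumes "low n w"
  shows "zmode (star V n a b) w = zmode a (zmode b w)"
proof -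
  have "vcomp V a d \<in> vgr V d" for d by (simp add: vcomp_eq_gcomp gv.gcomp_in)
  then show ?thesis
    unfolding star_def zmode_def[of a] zmode_sum[OF low_C[OF assms]] by (simp add: zmode_starh[OF assms])
qed

end

section \<open>Modes of V smeared with Laurent series\<close>

context voa
begin

text \<open>The residue of \<open>g(z) Y(a,z) b\<close> at \<open>z = 0\<close>; the sum is finite for every Laurent series \<open>g\<close>.\<close>

definition smode :: "'v \<Rightarrow> 'k fls \<Rightarrow> 'v \<Rightarrow> 'v" where
  "smode a g b = (\<Sum>j\<in>{j. g $$ j \<noteq> 0 \<and> Y a j b \<noteq> 0}. sV (g $$ j) (Y a j b))"

lemma smode_interval:
  assumes "\<And>j. j < l \<Longrightarrow> g $$ j = 0" "\<And>j. h \<le> j \<Longrightarrow> Y a j b = 0"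
  shows "smode a g b = (\<Sum>j\<in>{l..<h}. sV (g $$ j) (Y a j b))"
  unfolding smode_def
proof (rule sum.mono_neutral_left)
  show "{j. g $$ j \<noteq> 0 \<and> Y a j b \<noteq> 0} \<subseteq> {l..<h}"
  proof
    fix j assume "j \<in> {j. g $$ j \<noteq> 0 \<and> Y a j b \<noteq> 0}"
    then show "j \<in> {l..<h}" using assms(1)[of j] assms(2)[of j] by (cases "j < l"; cases "h \<le> j") auto
  qed
qed auto

lemma fls_low: "\<exists>l. \<forall>j<l. (g::'k fls) $$ j = 0"
  using fls_eq0_below_subdegree by blast

lemma smode_add: "smode a (f + g) b = smode a f b + smode a g b"
proof -
  obtain l1 where l1: "\<forall>j<l1. f $$ j = 0" using fls_low by blast
  obtain l2 where l2: "\<forall>j<l2. g $$ j = 0" using fls_low by blast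
  obtain h where h: "\<forall>j\<ge>h. Y a j b = 0" using Y_trunc by blast
  let ?l = "min l1 l2"
  have "smode a f b = (\<Sum>j\<in>{?l..<h}. sV (f $$ j) (Y a j b))"
    "smode a g b = (\<Sum>j\<in>{?l..<h}. sV (g $$ j) (Y a j b))"
    "smode a (f + g) b = (\<Sum>j\<in>{?l..<h}. sV ((f + g) $$ j) (Y a j b))"
    by (rule smode_interval; use l1 l2 h in simp)+
  then show ?thesis by (simp add: sv.scale_left_distrib sum.distrib)
qed

lemma smode_const_mult: "smode a (fls_const c * g) b = sV c (smode a g b)"
proof -
  obtain l where l: "\<forall>j<l. g $$ j = 0" using fls_low by blast
  obtain h where h: "\<forall>j\<ge>h. Y a j b = 0" using Y_trunc by blast
  have "smode a g b = (\<Sum>j\<in>{l..<h}. sV (g $$ j) (Y a j b))"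
    "smode a (fls_const c * g) b = (\<Sum>j\<in>{l..<h}. sV ((fls_const c * g) $$ j) (Y a j b))"
    by (rule smode_interval; use l h in simp)+
  then show ?thesis by (simp add: sv.scale_sum_right)
qed

lemma smode_zero [simp]: "smode a 0 b = 0" by (simp add: smode_def)
lemma smode_0_left [simp]: "smode 0 g b = 0" by (simp add: smode_def)
lemma smode_0_right [simp]: "smode a g 0 = 0" by (simp add: smode_def)
lemma smode_uminus: "smode a (- g) b = - smode a g b"
  using smode_add[of a g "- g" b] by (simp add: eq_neg_iff_add_eq_0 add.commute)

lemma smode_diff: "smode a (f - g) b = smode a f b - smode a g b"
  using smode_add[of a f "- g" b] by (simp add: smode_uminus)

lemma smode_sum: "smode a (sum f S) b = (\<Sum>i\<in>S. smode a (f i) b)"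
  by (induction S rule: infinite_finite_induct) (simp_all add: smode_add)

lemma smode_of_int_mult: "smode a (of_int c * g) b = sV (of_int c) (smode a g b)"
  using smode_const_mult[of a "of_int c" g b] by (simp add: fls_of_int)

lemma smode_add_left: "smode (a + a') g b = smode a g b + smode a' g b"
proof -
  obtain l where l: "\<forall>j<l. g $$ j = 0" using fls_low by blast
  obtain h where h: "\<forall>j\<ge>h. Y a j b = 0" using Y_trunc by blast
  obtain h' where h': "\<forall>j\<ge>h'. Y a' j b = 0" using Y_trunc by blast
  let ?h = "max h h'"
  have "smode a g b = (\<Sum>j\<in>{l..<?h}. sV (g $$ j) (Y a j b))"
    "smode a' g b = (\<Sum>j\<in>{l..<?h}. sV (g $$ j) (Y a' j b))"
    "smode (a + a') g b = (\<Sum>j\<in>{l..<?h}. sV (g $$ j) (Y (a + a') j b))"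
    by (rule smode_interval; use l h h' in \<open>simp add: Y_add_left\<close>)+
  then show ?thesis by (simp add: Y_add_left sv.scale_right_distrib sum.distrib)
qed

lemma smode_scale_left: "smode (sV c a) g b = sV c (smode a g b)"
proof -
  obtain l where l: "\<forall>j<l. g $$ j = 0" using fls_low by blast
  obtain h where h: "\<forall>j\<ge>h. Y a j b = 0" using Y_trunc by blast
  have "smode a g b = (\<Sum>j\<in>{l..<h}. sV (g $$ j) (Y a j b))"
    "smode (sV c a) g b = (\<Sum>j\<in>{l..<h}. sV (g $$ j) (Y (sV c a) j b))"
    by (rule smode_interval; use l h in \<open>simp add: Y_scale_left\<close>)+
  then show ?thesis by (simp add: Y_scale_left sv.scale_sum_right mult.commute)
qed

lemma smode_add_right: "smode a g (b + b') = smode a g b + smode a g b'"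
proof -
  obtain l where l: "\<forall>j<l. g $$ j = 0" using fls_low by blast
  obtain h where h: "\<forall>j\<ge>h. Y a j b = 0" using Y_trunc by blast
  obtain h' where h': "\<forall>j\<ge>h'. Y a j b' = 0" using Y_trunc by blast
  let ?h = "max h h'"
  have "smode a g b = (\<Sum>j\<in>{l..<?h}. sV (g $$ j) (Y a j b))"
    "smode a g b' = (\<Sum>j\<in>{l..<?h}. sV (g $$ j) (Y a j b'))"
    "smode a g (b + b') = (\<Sum>j\<in>{l..<?h}. sV (g $$ j) (Y a j (b + b')))"
    by (rule smode_interval; use l h h' in \<open>simp add: Y_add_right\<close>)+
  then show ?thesis by (simp add: Y_add_right sv.scale_right_distrib sum.distrib)
qed

lemma smode_scale_right: "smode a g (sV c b) = sV c (smode a g b)"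
proof -
  obtain l where l: "\<forall>j<l. g $$ j = 0" using fls_low by blast
  obtain h where h: "\<forall>j\<ge>h. Y a j b = 0" using Y_trunc by blast
  have "smode a g b = (\<Sum>j\<in>{l..<h}. sV (g $$ j) (Y a j b))"
    "smode a g (sV c b) = (\<Sum>j\<in>{l..<h}. sV (g $$ j) (Y a j (sV c b)))"
    by (rule smode_interval; use l h in \<open>simp add: Y_scale_right\<close>)+
  then show ?thesis by (simp add: Y_scale_right sv.scale_sum_right mult.commute)
qed

lemma smode_zp: "smode a (zp p) b = Y a p b"
proof -
  obtain h where h: "\<forall>j\<ge>h. Y a j b = 0" using Y_trunc by blast
  have "smode a (zp p) b = (\<Sum>j\<in>{p..<max h (p + 1)}. sV (zp p $$ j) (Y a j b))"
    by (rule smode_interval) (use h in \<open>auto simp: zp_nth\<close>)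
  also have "\<dots> = (\<Sum>j\<in>{p}. sV (zp p $$ j) (Y a j b))"
    by (rule sum.mono_neutral_right) (auto simp: zp_nth)
  finally show ?thesis by (simp add: zp_nth)
qed

lemma smode_high:
  assumes "\<And>j. j < G \<Longrightarrow> g $$ j = 0" "\<And>j. G \<le> j \<Longrightarrow> Y a j b = 0"
  shows "smode a g b = 0"
  using smode_interval[of G g G a b] assms by simp

lemma Y_trunc_finite: "\<exists>K. \<forall>i<I::nat. \<forall>j\<ge>K. Y (u i) j (v i) = 0"
proof (induction I)
  case (Suc I)
  then obtain K where K: "\<forall>i<I. \<forall>j\<ge>K. Y (u i) j (v i) = 0" by blast
  obtain K' where K': "\<forall>j\<ge>K'. Y (u I) j (v I) = 0" using Y_trunc by blast
  have "\<forall>i<Suc I. \<forall>j\<ge>max K K'. Y (u i) j (v i) = 0"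
    using K K' by (simp add: less_Suc_eq)
  then show ?case by blast
qed simp

lemma smode_zp_mult_high: "\<exists>I. \<forall>i\<ge>I. smode a (zp (int i) * g) b = 0"
proof -
  obtain l where l: "\<forall>j<l. g $$ j = 0" using fls_low by blast
  obtain h where h: "\<forall>j\<ge>h. Y a j b = 0" using Y_trunc by blast
  have "smode a (zp (int i) * g) b = 0" if "nat (h - l) \<le> i" for i
    by (rule smode_high[of h]) (use l h that in \<open>auto simp: zp_times_nth\<close>)
  then show ?thesis by blast
qed

section \<open>The Borcherds identity with arbitrary Laurent series as test functions\<close>

sublocale self: wmod V sV UNIV Y
  by unfold_locales
    (auto simp: Y_add_right Y_scale_right Y_add_left Y_scale_left Y_trunc Y_vac Y_borcherds)

text \<open>The two sides of the Borcherds identity integrated against \<open>g(z1) h(z2) (z1 - z2)^r\<close>.\<close>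

definition JL :: "'v \<Rightarrow> 'v \<Rightarrow> 'v \<Rightarrow> int \<Rightarrow> 'k fls \<Rightarrow> 'k fls \<Rightarrow> nat \<Rightarrow> 'v" where
  "JL a c b r g h i = smode (Y a (r + int i) c) (hasse i g * h) b"

definition JR :: "'v \<Rightarrow> 'v \<Rightarrow> 'v \<Rightarrow> int \<Rightarrow> 'k fls \<Rightarrow> 'k fls \<Rightarrow> nat \<Rightarrow> 'v" where
  "JR a c b r g h i = sV (of_int ((-1)^i * ibinom r i))
     (smode a (zp (r - int i) * g) (smode c (zp (int i) * h) b)
      - sV (of_int (sgnpow r)) (smode c (zp (r - int i) * h) (smode a (zp (int i) * g) b)))"

text \<open>The terms on both sides vanish from some index on, so agreement of all late partial sums
  is equality of the two infinite sums. In this form the identity is additive without bookkeeping of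
  bounds.\<close>

definition JJ :: "'v \<Rightarrow> 'v \<Rightarrow> 'v \<Rightarrow> int \<Rightarrow> 'k fls \<Rightarrow> 'k fls \<Rightarrow> bool" where
  "JJ a c b r g h \<longleftrightarrow> (\<forall>\<^sub>F I in sequentially. sum (JL a c b r g h) {..<I} = sum (JR a c b r g h) {..<I})"

lemma JJ_add_left: "JJ a c b r g h \<Longrightarrow> JJ a c b r g' h \<Longrightarrow> JJ a c b r (g + g') h"
proof -
  have L: "JL a c b r (g + g') h i = JL a c b r g h i + JL a c b r g' h i" for i
    by (simp add: JL_def hasse_add distrib_right smode_add)
  have R: "JR a c b r (g + g') h i = JR a c b r g h i + JR a c b r g' h i" for i
    by (simp add: JR_def distrib_left smode_add smode_add_right sv.scale_right_distrib sv.scale_right_diff_distrib)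
  assume "JJ a c b r g h" "JJ a c b r g' h"
  then show ?thesis unfolding JJ_def
    by eventually_elim (simp add: L R sum.distrib)
qed

lemma JJ_add_right: "JJ a c b r g h \<Longrightarrow> JJ a c b r g h' \<Longrightarrow> JJ a c b r g (h + h')"
proof -
  have L: "JL a c b r g (h + h') i = JL a c b r g h i + JL a c b r g h' i" for i
    by (simp add: JL_def distrib_left smode_add)
  have R: "JR a c b r g (h + h') i = JR a c b r g h i + JR a c b r g h' i" for i
    by (simp add: JR_def distrib_left smode_add smode_add_right sv.scale_right_distrib sv.scale_right_diff_distrib)
  assume "JJ a c b r g h" "JJ a c b r g h'"
  then show ?thesis unfolding JJ_def
    by eventually_elim (simp add: L R sum.distrib)
qed

lemma JJ_scale_left: "JJ a c b r g h \<Longrightarrow> JJ a c b r (fls_const k * g) h"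
proof -
  have L: "JL a c b r (fls_const k * g) h i = sV k (JL a c b r g h i)" for i
    by (simp add: JL_def hasse_const_mult mult.assoc smode_const_mult)
  have z: "zp m * (fls_const k * f) = fls_const k * (zp m * f)" for m and f :: "'k fls"
    by (simp add: mult_ac)
  have R: "JR a c b r (fls_const k * g) h i = sV k (JR a c b r g h i)" for i
    by (simp add: JR_def z smode_const_mult smode_scale_right sv.scale_right_diff_distrib
        sv.scale_left_commute[of _ k] del: sv.scale_scale)
  assume "JJ a c b r g h"
  then show ?thesis unfolding JJ_def
    by eventually_elim (simp add: L R sv.scale_sum_right[symmetric])
qed

lemma JJ_scale_right: "JJ a c b r g h \<Longrightarrow> JJ a c b r g (fls_const k * h)"
proof -
  have z: "zp m * (fls_const k * f) = fls_const k * (zp m * f)" for m and f :: "'k fls"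
    by (simp add: mult_ac)
  have z': "hasse i g * (fls_const k * h) = fls_const k * (hasse i g * h)" for i
    by (simp add: mult_ac)
  have L: "JL a c b r g (fls_const k * h) i = sV k (JL a c b r g h i)" for i
    unfolding JL_def z' by (rule smode_const_mult)
  have R: "JR a c b r g (fls_const k * h) i = sV k (JR a c b r g h i)" for i
    by (simp add: JR_def z smode_const_mult smode_scale_right sv.scale_right_diff_distrib
        sv.scale_left_commute[of _ k] del: sv.scale_scale)
  assume "JJ a c b r g h"
  then show ?thesis unfolding JJ_def
    by eventually_elim (simp add: L R sv.scale_sum_right[symmetric])
qed

lemma JJ_monom: "JJ a c b r (zp p) (zp q)"
  unfolding JJ_def
proof -
  obtain K1 where K1: "\<forall>l\<ge>K1. Y a l c = 0" using Y_trunc by blast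
  obtain K2 where K2: "\<forall>l\<ge>K2. Y c l b = 0" using Y_trunc by blast
  obtain K3 where K3: "\<forall>l\<ge>K3. Y a l b = 0" using Y_trunc by blast
  show "\<forall>\<^sub>F I in sequentially. sum (JL a c b r (zp p) (zp q)) {..<I} = sum (JR a c b r (zp p) (zp q)) {..<I}"
  proof (rule eventually_sequentiallyI)
    fix I assume I: "nat (K1 - r) + nat (K2 - q) + nat (K3 - p) \<le> I"
    have L: "JL a c b r (zp p) (zp q) i = sV (of_int (ibinom p i)) (Y (Y a (r + int i) c) (p + q - int i) b)" for i
    proof -
      have "hasse i (zp p) * zp q = of_int (ibinom p i) * (zp (p + q - int i) :: 'k fls)"
        by (simp add: hasse_zp mult.assoc zp_add[symmetric] algebra_simps)
      then show ?thesis by (simp add: JL_def smode_of_int_mult smode_zp)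
    qed
    have R: "JR a c b r (zp p) (zp q) i = sV (of_int ((-1)^i * ibinom r i))
        (Y a (p + r - int i) (Y c (q + int i) b)
          - sV (of_int (sgnpow r)) (Y c (q + r - int i) (Y a (p + int i) b)))" for i
      by (simp add: JR_def zp_add[symmetric] smode_zp algebra_simps)
    show "sum (JL a c b r (zp p) (zp q)) {..<I} = sum (JR a c b r (zp p) (zp q)) {..<I}"
      unfolding L R by (rule self.borcherds_sum) (use I K1 K2 K3 in auto)
  qed
qed

text \<open>Only finitely many vectors, those with i < \<open>I1\<close> on the left and i <
  \<open>I2\<close> on the right, meet a mode weighted by \<open>g\<close>. Hence a single threshold
  \<open>G\<close> makes all terms vanish for every \<open>g\<close> of order at least
  \<open>G\<close>.\<close>

lemma JJ_high_left: "\<exists>G. \<forall>g. (\<forall>j<G. g $$ j = 0) \<longrightarrow> JJ a c b r g h"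
proof -
  obtain l where l: "\<forall>j<l. h $$ j = 0" using fls_low by blast
  obtain K0 where K0: "\<forall>j\<ge>K0. Y a j c = 0" using Y_trunc by blast
  obtain I2 where I2: "\<forall>i\<ge>I2. smode c (zp (int i) * h) b = 0" using smode_zp_mult_high by blast
  define I1 where "I1 = nat (K0 - r)"
  obtain K1 where K1: "\<forall>i<I1. \<forall>j\<ge>K1. Y (Y a (r + int i) c) j b = 0"
    using Y_trunc_finite[of I1 "\<lambda>i. Y a (r + int i) c" "\<lambda>i. b"] by blast
  obtain K2 where K2: "\<forall>i<I2. \<forall>j\<ge>K2. Y a j (smode c (zp (int i) * h) b) = 0"
    using Y_trunc_finite[of I2 "\<lambda>i. a" "\<lambda>i. smode c (zp (int i) * h) b"] by blast
  obtain K3 where K3: "\<forall>j\<ge>K3. Y a j b = 0" using Y_trunc by blast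
  define G where "G = max (K1 + int I1 - min l (fls_subdegree h)) (max (K2 - r + int I2) K3)"
  show ?thesis
  proof (intro exI[of _ G] allI impI)
    fix g :: "'k fls" assume g: "\<forall>j<G. g $$ j = 0"
    have L: "JL a c b r g h i = 0" for i
    proof (cases "i < I1")
      case True
      show ?thesis unfolding JL_def
      proof (rule smode_high[of K1])
        fix j assume j: "j < K1"
        show "(hasse i g * h) $$ j = 0"
        proof (rule fls_times_nth_high[of "G - int i"])
          show "hasse i g $$ k = 0" if "k < G - int i" for k
            using g that by (simp add: hasse_nth)
          show "j < G - int i + fls_subdegree h" using j True by (simp add: G_def)
        qed
      qed (use K1 True in simp)
    next
      case False
      then show ?thesis using K0 by (simp add: JL_def I1_def)
    qed
    have R: "JR a c b r g h i = 0" for i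
    proof -
      have "smode a (zp (int i) * g) b = 0"
        by (rule smode_high[of K3]) (use K3 g in \<open>auto simp: zp_times_nth G_def\<close>)
      moreover have "smode a (zp (r - int i) * g) (smode c (zp (int i) * h) b) = 0"
      proof (cases "i < I2")
        case True
        show ?thesis
          by (rule smode_high[of K2]) (use K2 True g in \<open>auto simp: zp_times_nth G_def\<close>)
      next
        case False then show ?thesis using I2 by simp
      qed
      ultimately show ?thesis by (simp add: JR_def)
    qed
    show "JJ a c b r g h" by (simp add: JJ_def L R)
  qed
qed

lemma JJ_high_right: "\<exists>G. \<forall>h. (\<forall>j<G. h $$ j = 0) \<longrightarrow> JJ a c b r g h"
proof -
  obtain K0 where K0: "\<forall>j\<ge>K0. Y a j c = 0" using Y_trunc by blast
  obtain I2 where I2: "\<forall>i\<ge>I2. smode a (zp (int i) * g) b = 0" using smode_zp_mult_high by blast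
  define I1 where "I1 = nat (K0 - r)"
  obtain K1 where K1: "\<forall>i<I1. \<forall>j\<ge>K1. Y (Y a (r + int i) c) j b = 0"
    using Y_trunc_finite[of I1 "\<lambda>i. Y a (r + int i) c" "\<lambda>i. b"] by blast
  obtain K2 where K2: "\<forall>i<I2. \<forall>j\<ge>K2. Y c j (smode a (zp (int i) * g) b) = 0"
    using Y_trunc_finite[of I2 "\<lambda>i. c" "\<lambda>i. smode a (zp (int i) * g) b"] by blast
  obtain K3 where K3: "\<forall>j\<ge>K3. Y c j b = 0" using Y_trunc by blast
  define G where "G = max (K1 + int I1 - fls_subdegree g) (max (K2 - r + int I2) K3)"
  show ?thesis
  proof (intro exI[of _ G] allI impI)
    fix h :: "'k fls" assume h: "\<forall>j<G. h $$ j = 0"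
    have L: "JL a c b r g h i = 0" for i
    proof (cases "i < I1")
      case True
      show ?thesis
      proof (cases "hasse i g = 0")
        case False
        have sub: "fls_subdegree g - int i \<le> fls_subdegree (hasse i g)"
          by (intro fls_subdegree_geI False) (auto simp: hasse_nth)
        show ?thesis unfolding JL_def
        proof (rule smode_high[of K1])
          fix j assume j: "j < K1"
          have "(h * hasse i g) $$ j = 0"
          proof (rule fls_times_nth_high[of G])
            show "h $$ k = 0" if "k < G" for k using h that by simp
            show "j < G + fls_subdegree (hasse i g)" using j True sub by (simp add: G_def)
          qed
          then show "(hasse i g * h) $$ j = 0" by (simp add: mult.commute)
        qed (use K1 True in simp)
      qed (simp add: JL_def)
    next
      case False
      then show ?thesis using K0 by (simp add: JL_def I1_def)
    qed
    have R: "JR a c b r g h i = 0" for i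
    proof -
      have "smode c (zp (int i) * h) b = 0"
        by (rule smode_high[of K3]) (use K3 h in \<open>auto simp: zp_times_nth G_def\<close>)
      moreover have "smode c (zp (r - int i) * h) (smode a (zp (int i) * g) b) = 0"
      proof (cases "i < I2")
        case True
        show ?thesis
          by (rule smode_high[of K2]) (use K2 True h in \<open>auto simp: zp_times_nth G_def\<close>)
      next
        case False then show ?thesis using I2 by simp
      qed
      ultimately show ?thesis by (simp add: JR_def)
    qed
    show "JJ a c b r g h" by (simp add: JJ_def L R)
  qed
qed

text \<open>Bilinearity reduces this to monomials, where it is the component form. The series
  \<open>h\<close> stays a monomial while \<open>g\<close> is approximated, because each threshold
  depends on the other series.\<close>

lemma JJ: "JJ a c b r g h"
proof -
  have 1: "JJ a c b r g (zp q)" for q g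
  proof -
    obtain G where G: "\<And>g. (\<And>j. j < G \<Longrightarrow> g $$ j = 0) \<Longrightarrow> JJ a c b r g (zp q)"
      using JJ_high_left by metis
    show ?thesis
      by (induction g rule: fls_approx_induct[where G = G])
        (auto intro: JJ_add_left JJ_scale_left JJ_monom G)
  qed
  obtain G where G: "\<And>h. (\<And>j. j < G \<Longrightarrow> h $$ j = 0) \<Longrightarrow> JJ a c b r g h"
    using JJ_high_right by metis
  show ?thesis
    by (induction h rule: fls_approx_induct[where G = G])
      (auto intro: JJ_add_right JJ_scale_right 1 G)
qed

lemma sum_lessThan_tail:
  fixes f :: "nat \<Rightarrow> 'c::comm_monoid_add"
  assumes "\<And>i. N \<le> i \<Longrightarrow> f i = 0" "N \<le> M"
  shows "sum f {..<M} = sum f {..<N}"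
  by (rule sum.mono_neutral_right) (use assms in auto)

lemma smode_borcherds:
  assumes "\<And>i. I1 \<le> i \<Longrightarrow> Y a (r + int i) c = 0"
    and "\<And>i. I2 \<le> i \<Longrightarrow> smode c (zp (int i) * h) b = 0"
    and "\<And>i. I2 \<le> i \<Longrightarrow> smode a (zp (int i) * g) b = 0"
  shows "(\<Sum>i<I1. smode (Y a (r + int i) c) (hasse i g * h) b)
    = (\<Sum>i<I2. sV (of_int ((-1)^i * ibinom r i)) (smode a (zp (r - int i) * g) (smode c (zp (int i) * h) b)
      - sV (of_int (sgnpow r)) (smode c (zp (r - int i) * h) (smode a (zp (int i) * g) b))))"
proof -
  obtain N where N: "\<And>I. I \<ge> N \<Longrightarrow> sum (JL a c b r g h) {..<I} = sum (JR a c b r g h) {..<I}"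
    using JJ[of a c b r g h] unfolding JJ_def eventually_sequentially by blast
  have "sum (JL a c b r g h) {..<N + I1 + I2} = sum (JL a c b r g h) {..<I1}"
    by (rule sum_lessThan_tail) (use assms in \<open>auto simp: JL_def\<close>)
  moreover have "sum (JR a c b r g h) {..<N + I1 + I2} = sum (JR a c b r g h) {..<I2}"
    by (rule sum_lessThan_tail) (use assms in \<open>auto simp: JR_def\<close>)
  ultimately show ?thesis using N[of "N + I1 + I2"] by (simp add: JL_def JR_def)
qed

lemma smode_commutator:
  assumes "\<forall>i\<ge>I. Y a (int i) c = 0"
  shows "(\<Sum>i<I. smode (Y a (int i) c) (hasse i g * h) b) = smode a g (smode c h b) - smode c h (smode a g b)"
proof -
  obtain N where N: "\<And>M. M \<ge> N \<Longrightarrow> sum (JL a c b 0 g h) {..<M} = sum (JR a c b 0 g h) {..<M}"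
    using JJ[of a c b 0 g h] unfolding JJ_def eventually_sequentially by blast
  have "sum (JL a c b 0 g h) {..<N + I + 1} = sum (JL a c b 0 g h) {..<I}"
    by (rule sum_lessThan_tail) (use assms in \<open>auto simp: JL_def\<close>)
  moreover have "sum (JR a c b 0 g h) {..<N + I + 1} = sum (JR a c b 0 g h) {..<1}"
    by (rule sum_lessThan_tail) (auto simp: JR_def ibinom_0_left)
  ultimately show ?thesis using N[of "N + I + 1"] by (simp add: JL_def JR_def sgnpow_def)
qed

end

section \<open>The Borcherds ladder\<close>

text \<open>With \<open>bR\<close>, the two sides of the Borcherds identity for arbitrary double
  sequences in place of (u_j v)_k w, u_k v_l w and v_k u_l w, so that recursions in p, q, r can be
  studied apart from any module.\<close>

definition bL :: "('k::field \<Rightarrow> 'm::ab_group_add \<Rightarrow> 'm) \<Rightarrow> (int \<Rightarrow> int \<Rightarrow> 'm) \<Rightarrow> int \<Rightarrow> int \<Rightarrow> int \<Rightarrow> 'm" where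
  "bL s X p q r = fsum (\<lambda>i. s (of_int (ibinom p i)) (X (r + int i) (p + q - int i)))"

definition bR :: "('k::field \<Rightarrow> 'm::ab_group_add \<Rightarrow> 'm) \<Rightarrow> (int \<Rightarrow> int \<Rightarrow> 'm) \<Rightarrow> (int \<Rightarrow> int \<Rightarrow> 'm) \<Rightarrow> int \<Rightarrow> int \<Rightarrow> int \<Rightarrow> 'm" where
  "bR s Z1 Z2 p q r = fsum (\<lambda>i. s (of_int ((-1)^i * ibinom r i))
     (Z1 (p + r - int i) (q + int i) - s (of_int (sgnpow r)) (Z2 (q + r - int i) (p + int i))))"

context vector_space
begin

lemma bL_eq:
  fixes X :: "int \<Rightarrow> int \<Rightarrow> 'b"
  assumes "\<And>j k. K \<le> j \<Longrightarrow> X j k = 0" "nat (K - r) \<le> N"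
  shows "bL scale X p q r = (\<Sum>i<N. scale (of_int (ibinom p i)) (X (r + int i) (p + q - int i)))"
  unfolding bL_def by (rule fsum_eq) (use assms in auto)

lemma bR_eq:
  fixes Z1 Z2 :: "int \<Rightarrow> int \<Rightarrow> 'b"
  assumes "\<And>k l. K \<le> l \<Longrightarrow> Z1 k l = 0" "\<And>k l. K \<le> l \<Longrightarrow> Z2 k l = 0"
    and "nat (K - q) \<le> N" "nat (K - p) \<le> N"
  shows "bR scale Z1 Z2 p q r = (\<Sum>i<N. scale (of_int ((-1)^i * ibinom r i))
     (Z1 (p + r - int i) (q + int i) - scale (of_int (sgnpow r)) (Z2 (q + r - int i) (p + int i))))"
  unfolding bR_def by (rule fsum_eq) (use assms in auto)

lemma pascal_sum:
  fixes F :: "nat \<Rightarrow> 'b"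
  shows
  "(\<Sum>i<Suc N. scale (of_int (ibinom (r + 1) i)) (F i))
    = (\<Sum>i<Suc N. scale (of_int (ibinom r i)) (F i)) + (\<Sum>i<N. scale (of_int (ibinom r i)) (F (Suc i)))"
proof -
  have "(\<Sum>i<Suc N. scale (of_int (ibinom (r + 1) i)) (F i))
     = F 0 + (\<Sum>i<N. scale (of_int (ibinom (r + 1) (Suc i))) (F (Suc i)))"
    unfolding sum.lessThan_Suc_shift by simp
  also have "\<dots> = (F 0 + (\<Sum>i<N. scale (of_int (ibinom r (Suc i))) (F (Suc i)))) + (\<Sum>i<N. scale (of_int (ibinom r i)) (F (Suc i)))"
    by (simp add: ibinom_Suc_Suc scale_left_distrib sum.distrib)
  also have "F 0 + (\<Sum>i<N. scale (of_int (ibinom r (Suc i))) (F (Suc i))) = (\<Sum>i<Suc N. scale (of_int (ibinom r i)) (F i))"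
    unfolding sum.lessThan_Suc_shift by simp
  finally show ?thesis .
qed

lemma bL_step:
  fixes X :: "int \<Rightarrow> int \<Rightarrow> 'b"
  assumes X: "\<And>j k. K \<le> j \<Longrightarrow> X j k = 0"
  shows "bL scale X (p + 1) q r = bL scale X p (q + 1) r + bL scale X p q (r + 1)"
proof -
  let ?N = "nat (K - r)"
  have "bL scale X (p + 1) q r = (\<Sum>i<Suc ?N. scale (of_int (ibinom (p + 1) i)) (X (r + int i) (p + 1 + q - int i)))"
    by (rule bL_eq[OF X]) auto
  moreover have "bL scale X p (q + 1) r = (\<Sum>i<Suc ?N. scale (of_int (ibinom p i)) (X (r + int i) (p + (q + 1) - int i)))"
    by (rule bL_eq[OF X]) auto
  moreover have "bL scale X p q (r + 1) = (\<Sum>i<?N. scale (of_int (ibinom p i)) (X (r + 1 + int i) (p + q - int i)))"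
    by (rule bL_eq[OF X]) auto
  ultimately show ?thesis unfolding pascal_sum by (simp add: algebra_simps)
qed

lemma bR_step:
  fixes Z1 Z2 :: "int \<Rightarrow> int \<Rightarrow> 'b"
  assumes Z: "\<And>k l. K \<le> l \<Longrightarrow> Z1 k l = 0" "\<And>k l. K \<le> l \<Longrightarrow> Z2 k l = 0"
  shows "bR scale Z1 Z2 (p + 1) q r = bR scale Z1 Z2 p (q + 1) r + bR scale Z1 Z2 p q (r + 1)"
proof -
  define N where "N = nat (K - q) + nat (K - p)"
  have sg: "sgnpow (r + 1) = - sgnpow r" by (rule sgnpow_add_one)
  \<comment> \<open>The sign (-1)^i is absorbed into \<open>W\<close> so that Pascal's rule in
    \<open>r\<close> applies. Weighted by binom(r,i), consecutive \<open>W\<close> then add up to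
    the difference of the i-th terms for (p+1, q, r) and (p, q+1, r).\<close>
  define W where "W i = scale (of_int ((-1)^i)) (Z1 (p + (r + 1) - int i) (q + int i)
      - scale (of_int (sgnpow (r + 1))) (Z2 (q + (r + 1) - int i) (p + int i)))" for i
  have sc: "scale (of_int ((-1)^i * c)) x = scale (of_int c) (scale (of_int ((-1)^i)) x)" for i and c :: int and x :: 'b
    by (simp add: mult.commute)
  have "bR scale Z1 Z2 p q (r + 1) = (\<Sum>i<Suc N. scale (of_int ((-1)^i * ibinom (r + 1) i))
     (Z1 (p + (r + 1) - int i) (q + int i) - scale (of_int (sgnpow (r + 1))) (Z2 (q + (r + 1) - int i) (p + int i))))"
    by (rule bR_eq[OF Z]) (auto simp: N_def)
  also have "\<dots> = (\<Sum>i<Suc N. scale (of_int (ibinom (r + 1) i)) (W i))"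
    unfolding W_def sc[symmetric] ..
  also have "\<dots> = (\<Sum>i<Suc N. scale (of_int (ibinom r i)) (W i)) + (\<Sum>i<N. scale (of_int (ibinom r i)) (W (Suc i)))"
    by (rule pascal_sum)
  finally have 0: "bR scale Z1 Z2 p q (r + 1) = \<dots>" .
  have 1: "bR scale Z1 Z2 (p + 1) q r = (\<Sum>i<Suc N. scale (of_int ((-1)^i * ibinom r i))
     (Z1 (p + 1 + r - int i) (q + int i) - scale (of_int (sgnpow r)) (Z2 (q + r - int i) (p + 1 + int i))))"
    by (rule bR_eq[OF Z]) (auto simp: N_def)
  have 2: "bR scale Z1 Z2 p (q + 1) r = (\<Sum>i<Suc N. scale (of_int ((-1)^i * ibinom r i))
     (Z1 (p + r - int i) (q + 1 + int i) - scale (of_int (sgnpow r)) (Z2 (q + 1 + r - int i) (p + int i))))"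
    by (rule bR_eq[OF Z]) (auto simp: N_def)
  have tail: "(\<Sum>i<N. scale (of_int (ibinom r i)) (W (Suc i))) = (\<Sum>i<Suc N. scale (of_int (ibinom r i)) (W (Suc i)))"
  proof -
    have "W (Suc N) = 0" unfolding W_def N_def using Z by simp
    then show ?thesis by simp
  qed
  have "scale (of_int ((-1)^i * ibinom r i))
     (Z1 (p + 1 + r - int i) (q + int i) - scale (of_int (sgnpow r)) (Z2 (q + r - int i) (p + 1 + int i)))
    = scale (of_int ((-1)^i * ibinom r i))
     (Z1 (p + r - int i) (q + 1 + int i) - scale (of_int (sgnpow r)) (Z2 (q + 1 + r - int i) (p + int i)))
    + (scale (of_int (ibinom r i)) (W i) + scale (of_int (ibinom r i)) (W (Suc i)))" for i
  proof -
    have a: "p + (r + 1) - int i = p + 1 + r - int i" "q + (r + 1) - int i = q + 1 + r - int i"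
      "p + (r + 1) - int (Suc i) = p + r - int i" "q + (r + 1) - int (Suc i) = q + r - int i"
      "q + int (Suc i) = q + 1 + int i" "p + int (Suc i) = p + 1 + int i" by simp_all
    show ?thesis unfolding W_def a sg sc
      by (simp add: scale_right_diff_distrib scale_right_distrib)
  qed
  then show ?thesis unfolding 0 1 2 tail by (simp add: sum.distrib)
qed

text \<open>Both sides satisfy \<open>B(p+1,q,r) = B(p,q+1,r) + B(p,q,r+1)\<close>, so the commutator formula (\<open>r = 0\<close>) and weak
  associativity (large \<open>p\<close>) imply the identity for all \<open>p\<close>, \<open>q\<close>, \<open>r\<close>.\<close>

lemma borcherds_ladder:
  fixes X Z1 Z2 :: "int \<Rightarrow> int \<Rightarrow> 'b"
  assumes X: "\<And>j k. K \<le> j \<Longrightarrow> X j k = 0"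
    and Z: "\<And>k l. K' \<le> l \<Longrightarrow> Z1 k l = 0" "\<And>k l. K' \<le> l \<Longrightarrow> Z2 k l = 0"
    and comm: "\<And>p q. bL scale X p q 0 = bR scale Z1 Z2 p q 0"
    and assoc: "\<And>p q r. p0 \<le> p \<Longrightarrow> bL scale X p q r = bR scale Z1 Z2 p q r"
  shows "bL scale X p q r = bR scale Z1 Z2 p q r"
proof -
  have "\<forall>p q. bL scale X p q r = bR scale Z1 Z2 p q r"
  proof (induction r rule: int_induct[where k = 0])
    case base then show ?case using comm by blast
  next
    case (step1 r)
    show ?case
    proof (intro allI)
      fix p q
      show "bL scale X p q (r + 1) = bR scale Z1 Z2 p q (r + 1)"
        using bL_step[of K X p q r, OF X] bR_step[of K' Z1 Z2 p q r, OF Z] step1 by simp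
    qed
  next
    case (step2 r)
    \<comment> \<open>For negative r the recursion is read as B(p,q,r-1) = B(p+1,q-1,r-1) -
      B(p,q-1,r); it descends in \<open>p\<close> from the region p \<ge> \<open>p0\<close> covered
      by weak associativity.\<close>
    have "\<forall>q. bL scale X (p0 - int m) q (r - 1) = bR scale Z1 Z2 (p0 - int m) q (r - 1)" for m
    proof (induction m)
      case 0 then show ?case using assoc by simp
    next
      case (Suc m)
      show ?case
      proof
        fix q :: int
        let ?p = "p0 - int (Suc m)"
        have e: "?p + 1 = p0 - int m" "q - 1 + 1 = q" "r - 1 + 1 = r" by simp_all
        have "bL scale X ?p q (r - 1) = bL scale X (p0 - int m) (q - 1) (r - 1) - bL scale X ?p (q - 1) r"
          using bL_step[of K X ?p "q - 1" "r - 1", OF X] unfolding e by (simp del: of_nat_Suc)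
        moreover have "bR scale Z1 Z2 ?p q (r - 1) = bR scale Z1 Z2 (p0 - int m) (q - 1) (r - 1) - bR scale Z1 Z2 ?p (q - 1) r"
          using bR_step[of K' Z1 Z2 ?p "q - 1" "r - 1", OF Z] unfolding e by (simp del: of_nat_Suc)
        ultimately show "bL scale X ?p q (r - 1) = bR scale Z1 Z2 ?p q (r - 1)" using Suc step2 by (simp del: of_nat_Suc)
      qed
    qed
    show ?case
    proof (intro allI)
      fix p q show "bL scale X p q (r - 1) = bR scale Z1 Z2 p q (r - 1)"
      proof (cases "p0 \<le> p")
        case True then show ?thesis by (rule assoc)
      next
        case False
        then have "p = p0 - int (nat (p0 - p))" by simp
        with \<open>\<And>m. \<forall>q. bL scale X (p0 - int m) q (r - 1) = bR scale Z1 Z2 (p0 - int m) q (r - 1)\<close>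
        show ?thesis by metis
      qed
    qed
  qed
  then show ?thesis by blast
qed

end

section \<open>Functionals on V with two regular expansions\<close>

locale coind = voa V + us: vector_space su
  for V :: "('k::field, 'v::ab_group_add) voa" and su :: "'k \<Rightarrow> 'u::ab_group_add \<Rightarrow> 'u" +
  fixes Uc :: "'u set"
  assumes Uc_sub: "us.subspace Uc"
begin

definition lin :: "('v \<Rightarrow> 'u) \<Rightarrow> bool" where
  "lin \<phi> \<longleftrightarrow> (\<forall>x y. \<phi> (x + y) = \<phi> x + \<phi> y) \<and> (\<forall>c x. \<phi> (sV c x) = su c (\<phi> x)) \<and> (\<forall>x. \<phi> x \<in> Uc)"

lemma lin_add: "lin \<phi> \<Longrightarrow> \<phi> (x + y) = \<phi> x + \<phi> y" by (simp add: lin_def)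
lemma lin_scale: "lin \<phi> \<Longrightarrow> \<phi> (sV c x) = su c (\<phi> x)" by (simp add: lin_def)
lemma lin_Uc: "lin \<phi> \<Longrightarrow> \<phi> x \<in> Uc" by (simp add: lin_def)
lemma lin_0: "lin \<phi> \<Longrightarrow> \<phi> 0 = 0" using lin_scale[of \<phi> 0 0] by simp
lemma lin_uminus: "lin \<phi> \<Longrightarrow> \<phi> (- x) = - \<phi> x"
  using lin_add[of \<phi> x "- x"] lin_0[of \<phi>] by (simp add: eq_neg_iff_add_eq_0 add.commute)
lemma lin_diff: "lin \<phi> \<Longrightarrow> \<phi> (x - y) = \<phi> x - \<phi> y"
  using lin_add[of \<phi> x "- y"] by (simp add: lin_uminus)
lemma lin_sum: "lin \<phi> \<Longrightarrow> \<phi> (sum f S) = (\<Sum>i\<in>S. \<phi> (f i))"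
  by (induction S rule: infinite_finite_induct) (simp_all add: lin_add lin_0)

text \<open>By the residue theorem, \<open>kill\<close> holds if \<open>\<phi> (Y(a,z) b)\<close> has no pole outside \<open>z = 0\<close>, \<open>x = 0\<close> and infinity,
  a pole of order at most \<open>l\<close> at \<open>x = 0\<close>, and growth at most \<open>z^(- c - 2)\<close> at infinity, uniformly in \<open>b\<close>.\<close>

definition kill :: "('v \<Rightarrow> 'u) \<Rightarrow> 'v \<Rightarrow> int \<Rightarrow> int \<Rightarrow> bool" where
  "kill \<phi> a l c \<longleftrightarrow> (\<forall>g b. zord l g \<longrightarrow> ideg c g \<longrightarrow> \<phi> (smode a g b) = 0)"

definition good :: "('v \<Rightarrow> 'u) \<Rightarrow> bool" where
  "good \<phi> \<longleftrightarrow> lin \<phi> \<and> (\<forall>a. \<exists>l c. kill \<phi> a l c)"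

lemma good_lin: "good \<phi> \<Longrightarrow> lin \<phi>" by (simp add: good_def)

lemma killD: "kill \<phi> a l c \<Longrightarrow> zord l g \<Longrightarrow> ideg c g \<Longrightarrow> \<phi> (smode a g b) = 0"
  by (simp add: kill_def)

lemma kill_mono: "kill \<phi> a l c \<Longrightarrow> l \<le> l' \<Longrightarrow> c' \<le> c \<Longrightarrow> kill \<phi> a l' c'"
  unfolding kill_def using zord_mono ideg_mono by blast

lemma goodE:
  assumes "good \<phi>" obtains l c where "kill \<phi> a l c"
  using assms that unfolding good_def by blast

lemma good_kill_finite:
  assumes "good \<phi>"
  shows "\<exists>l c. \<forall>i<I::nat. kill \<phi> (u i) l c"
proof (induction I)
  case (Suc I)
  then obtain l c where lc: "\<forall>i<I. kill \<phi> (u i) l c" by blast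
  obtain l' c' where lc': "kill \<phi> (u I) l' c'" by (rule goodE[OF assms])
  have "\<forall>i<Suc I. kill \<phi> (u i) (max l l') (min c c')"
  proof (intro allI impI)
    fix i assume "i < Suc I"
    then consider "i < I" | "i = I" by linarith
    then show "kill \<phi> (u i) (max l l') (min c c')"
      by cases (use lc lc' in \<open>auto intro: kill_mono[of \<phi> _ l c] kill_mono[of \<phi> _ l' c']\<close>)
  qed
  then show ?case by blast
qed simp

text \<open>The least cutoff order that fits some admissible pair of bounds. The choice makes
  \<open>rmode\<close> and \<open>lmode\<close> depend on \<phi> alone; by
  \<open>cutoff_diff_killed\<close> every larger order gives the same values.\<close>

definition level :: "('v \<Rightarrow> 'u) \<Rightarrow> 'v \<Rightarrow> int \<Rightarrow> nat" where
  "level \<phi> a k = (LEAST M. \<exists>l c. kill \<phi> a l c \<and> l \<le> k + int M \<and> k - int M \<le> c)"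

text \<open>The coefficients of the expansions of \<open>\<phi> (Y(a,z) b)\<close> at \<open>x = 0\<close> (\<open>rmode\<close>) and at infinity (\<open>lmode\<close>);
  the sum of all residues being zero, the cutoff turns them into residues at \<open>z = 0\<close>.\<close>

definition rmode :: "'v \<Rightarrow> int \<Rightarrow> ('v \<Rightarrow> 'u) \<Rightarrow> 'v \<Rightarrow> 'u" where
  "rmode a k \<phi> = (\<lambda>b. - \<phi> (smode a (xp k * cutoff (level \<phi> a k)) b))"

definition lmode :: "'v \<Rightarrow> int \<Rightarrow> ('v \<Rightarrow> 'u) \<Rightarrow> 'v \<Rightarrow> 'u" where
  "lmode a k \<phi> = (\<lambda>b. \<phi> (smode a (xp k * (1 - cutoff (level \<phi> a k))) b))"

lemma level_kill:
  assumes "kill \<phi> a l c"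
  shows "\<exists>l' c'. kill \<phi> a l' c' \<and> l' \<le> k + int (level \<phi> a k) \<and> k - int (level \<phi> a k) \<le> c'"
  unfolding level_def
proof (rule LeastI[of "\<lambda>M. \<exists>l c. kill \<phi> a l c \<and> l \<le> k + int M \<and> k - int M \<le> c" "nat (\<bar>l - k\<bar> + \<bar>k - c\<bar>)"])
  show "\<exists>l' c'. kill \<phi> a l' c' \<and> l' \<le> k + int (nat (\<bar>l - k\<bar> + \<bar>k - c\<bar>))
      \<and> k - int (nat (\<bar>l - k\<bar> + \<bar>k - c\<bar>)) \<le> c'"
    by (intro exI[of _ l] exI[of _ c]) (use assms in auto)
qed

text \<open>Two cutoffs differ by a series that vanishes to the smaller of the two orders both at x
  = 0 and at infinity. Times x^k, such a series is annihilated by \<open>kill\<close>.\<close>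

lemma cutoff_diff_killed:
  assumes "lin \<phi>" "kill \<phi> a l c" "level \<phi> a k \<le> M"
  shows "\<phi> (smode a (xp k * cutoff M) b) = \<phi> (smode a (xp k * cutoff (level \<phi> a k)) b)"
proof -
  let ?B = "level \<phi> a k"
  obtain l' c' where lc: "kill \<phi> a l' c'" "l' \<le> k + int ?B" "k - int ?B \<le> c'"
    using level_kill[OF assms(2)] by blast
  have "zord (int ?B) ((1 - cutoff ?B) - (1 - cutoff M))"
    by (intro zord_diff zord_one_diff_cutoff zord_mono[OF zord_one_diff_cutoff[of M]]) (use assms in simp)
  then have "zord (k + int ?B) (xp k * (cutoff M - cutoff ?B))"
    by (intro zord_mult zord_xp) simp
  moreover have "ideg (k + - int ?B) (xp k * (cutoff M - cutoff ?B))"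
    by (intro ideg_mult ideg_xp ideg_diff ideg_cutoff ideg_mono[OF ideg_cutoff[of M]]) (use assms in simp)
  ultimately have "\<phi> (smode a (xp k * (cutoff M - cutoff ?B)) b) = 0"
    by (intro killD[OF lc(1)] zord_mono[OF _ lc(2)] ideg_mono[where c' = c']) (use lc in auto)
  then show ?thesis by (simp add: right_diff_distrib smode_diff lin_diff[OF assms(1)])
qed

text \<open>The eventual form allows one \<open>M\<close> to serve several elements, several
  exponents and iterated modes at once.\<close>

lemma rmode_ev:
  assumes "lin \<phi>" "kill \<phi> a l c"
  shows "\<forall>\<^sub>F M in sequentially. \<forall>b. rmode a k \<phi> b = - \<phi> (smode a (xp k * cutoff M) b)"
proof (rule eventually_sequentiallyI)
  fix M assume "level \<phi> a k \<le> M"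
  from cutoff_diff_killed[OF assms this] show "\<forall>b. rmode a k \<phi> b = - \<phi> (smode a (xp k * cutoff M) b)"
    unfolding rmode_def by metis
qed

lemma lmode_ev:
  assumes "lin \<phi>" "kill \<phi> a l c"
  shows "\<forall>\<^sub>F M in sequentially. \<forall>b. lmode a k \<phi> b = \<phi> (smode a (xp k * (1 - cutoff M)) b)"
proof (rule eventually_sequentiallyI)
  fix M assume "level \<phi> a k \<le> M"
  note * = cutoff_diff_killed[OF assms this]
  have split: "\<phi> (smode a (xp k * (1 - cutoff N)) b) = \<phi> (smode a (xp k) b) - \<phi> (smode a (xp k * cutoff N) b)" for N b
    by (simp add: right_diff_distrib smode_diff lin_diff[OF assms(1)])
  show "\<forall>b. lmode a k \<phi> b = \<phi> (smode a (xp k * (1 - cutoff M)) b)"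
    unfolding lmode_def split * by blast
qed

lemma good_rmode_ev: "good \<phi> \<Longrightarrow> \<forall>\<^sub>F M in sequentially. \<forall>b. rmode a k \<phi> b = - \<phi> (smode a (xp k * cutoff M) b)"
  unfolding good_def using rmode_ev by blast

lemma good_lmode_ev: "good \<phi> \<Longrightarrow> \<forall>\<^sub>F M in sequentially. \<forall>b. lmode a k \<phi> b = \<phi> (smode a (xp k * (1 - cutoff M)) b)"
  unfolding good_def using lmode_ev by blast

lemma ev_le1: "\<forall>\<^sub>F M in sequentially. l \<le> k + int M"
  by (rule eventually_sequentiallyI[of "nat (l - k)"]) auto
lemma ev_le2: "\<forall>\<^sub>F M in sequentially. k - int M \<le> c"
  by (rule eventually_sequentiallyI[of "nat (k - c)"]) auto

lemma ev_ex: "\<forall>\<^sub>F M in sequentially. P M \<Longrightarrow> \<exists>M::nat. P M"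
  unfolding eventually_sequentially by blast

lemma phi_smode_sum:
  assumes "lin \<phi>"
  shows "\<phi> (smode a (\<Sum>k\<in>F. fls_const (c k) * f k) b) = (\<Sum>k\<in>F. su (c k) (\<phi> (smode a (f k) b)))"
  by (simp add: smode_sum smode_const_mult lin_sum[OF assms] lin_scale[OF assms])

text \<open>The residue theorem for a test series \<open>h\<close> without contribution from
  infinity: at x = 0 only its expansion up to order \<open>l\<close> counts. Replacing each power of
  x in this expansion by its product with a cutoff changes \<open>h\<close> by a series that \<phi>
  kills.\<close>

lemma rmode_gen:
  assumes \<phi>: "lin \<phi>" and kill: "kill \<phi> a l c" and F: "finite F"
    and h: "ideg c h" "zord l (h - (\<Sum>k\<in>F. fls_const (\<gamma> k) * xp k))"
  shows "\<phi> (smode a h b) = - (\<Sum>k\<in>F. su (\<gamma> k) (rmode a k \<phi> b))"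
proof -
  have "\<forall>\<^sub>F M in sequentially. \<forall>k\<in>F. rmode a k \<phi> b = - \<phi> (smode a (xp k * cutoff M) b) \<and> l \<le> k + int M \<and> k - int M \<le> c"
    by (intro eventually_ball_finite F ballI eventually_conj ev_le1 ev_le2
        eventually_mono[OF rmode_ev[OF \<phi> kill]]) auto
  from ev_ex[OF this] obtain M where M: "\<forall>k\<in>F. rmode a k \<phi> b = - \<phi> (smode a (xp k * cutoff M) b) \<and> l \<le> k + int M \<and> k - int M \<le> c"
    by blast
  let ?h = "\<Sum>k\<in>F. fls_const (\<gamma> k) * (xp k * cutoff M)"
  have i: "ideg c ?h"
  proof (intro ideg_sum ideg_const_mult)
    fix k assume "k \<in> F"
    then show "ideg c (xp k * cutoff M)"
      using M ideg_mono[OF ideg_mult[OF ideg_xp[of k] ideg_cutoff[of M]]] by auto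
  qed
  have e: "h - ?h = (h - (\<Sum>k\<in>F. fls_const (\<gamma> k) * xp k)) + (\<Sum>k\<in>F. fls_const (\<gamma> k) * (xp k * (1 - cutoff M)))"
    by (simp add: right_diff_distrib sum_subtractf)
  have "zord l (\<Sum>k\<in>F. fls_const (\<gamma> k) * (xp k * (1 - cutoff M)))"
  proof (intro zord_sum zord_const_mult)
    fix k assume "k \<in> F"
    then show "zord l (xp k * (1 - cutoff M))"
      using M zord_mono[OF zord_mult[OF zord_xp[of k] zord_one_diff_cutoff[of M]]] by auto
  qed
  then have "zord l (h - ?h)" unfolding e by (intro zord_add h)
  then have "\<phi> (smode a (h - ?h) b) = 0"
    by (rule killD[OF kill]) (intro ideg_diff h i)
  then have "\<phi> (smode a h b) = \<phi> (smode a ?h b)" by (simp add: smode_diff lin_diff[OF \<phi>])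
  also have "\<dots> = - (\<Sum>k\<in>F. su (\<gamma> k) (rmode a k \<phi> b))"
    unfolding phi_smode_sum[OF \<phi>] using M by (simp add: sum_negf[symmetric])
  finally show ?thesis .
qed

text \<open>Here x = 0 contributes nothing. The sign differs from \<open>rmode_gen\<close> because
  the residue at infinity is minus the coefficient of x^(-1).\<close>

lemma lmode_gen:
  assumes \<phi>: "lin \<phi>" and kill: "kill \<phi> a l c" and F: "finite F"
    and h: "zord l h" "ideg c (h - (\<Sum>k\<in>F. fls_const (\<gamma> k) * xp k))"
  shows "\<phi> (smode a h b) = (\<Sum>k\<in>F. su (\<gamma> k) (lmode a k \<phi> b))"
proof -
  have "\<forall>\<^sub>F M in sequentially. \<forall>k\<in>F. lmode a k \<phi> b = \<phi> (smode a (xp k * (1 - cutoff M)) b) \<and> l \<le> k + int M \<and> k - int M \<le> c"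
    by (intro eventually_ball_finite F ballI eventually_conj ev_le1 ev_le2
        eventually_mono[OF lmode_ev[OF \<phi> kill]]) auto
  from ev_ex[OF this] obtain M where M: "\<forall>k\<in>F. lmode a k \<phi> b = \<phi> (smode a (xp k * (1 - cutoff M)) b) \<and> l \<le> k + int M \<and> k - int M \<le> c"
    by blast
  let ?h = "\<Sum>k\<in>F. fls_const (\<gamma> k) * (xp k * (1 - cutoff M))"
  have i: "zord l ?h"
  proof (intro zord_sum zord_const_mult)
    fix k assume "k \<in> F"
    then show "zord l (xp k * (1 - cutoff M))"
      using M zord_mono[OF zord_mult[OF zord_xp[of k] zord_one_diff_cutoff[of M]]] by auto
  qed
  have e: "h - ?h = (h - (\<Sum>k\<in>F. fls_const (\<gamma> k) * xp k)) + (\<Sum>k\<in>F. fls_const (\<gamma> k) * (xp k * cutoff M))"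
    by (simp add: right_diff_distrib sum_subtractf)
  have "ideg c (\<Sum>k\<in>F. fls_const (\<gamma> k) * (xp k * cutoff M))"
  proof (intro ideg_sum ideg_const_mult)
    fix k assume "k \<in> F"
    then show "ideg c (xp k * cutoff M)"
      using M ideg_mono[OF ideg_mult[OF ideg_xp[of k] ideg_cutoff[of M]]] by auto
  qed
  then have "ideg c (h - ?h)" unfolding e by (intro ideg_add h)
  then have "\<phi> (smode a (h - ?h) b) = 0"
    by (intro killD[OF kill] zord_diff h i)
  then have "\<phi> (smode a h b) = \<phi> (smode a ?h b)" by (simp add: smode_diff lin_diff[OF \<phi>])
  also have "\<dots> = (\<Sum>k\<in>F. su (\<gamma> k) (lmode a k \<phi> b))"
    unfolding phi_smode_sum[OF \<phi>] using M by simp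
  finally show ?thesis .
qed

lemma rmode_eq_0:
  assumes "lin \<phi>" "kill \<phi> a l c" "l \<le> k"
  shows "rmode a k \<phi> = (\<lambda>b. 0)"
proof
  fix b
  have "\<phi> (smode a 0 b) = - (\<Sum>k\<in>{k}. su 1 (rmode a k \<phi> b))"
    by (rule rmode_gen[OF assms(1,2)]) (use zord_uminus[OF zord_mono[OF zord_xp[of k] assms(3)]] in simp_all)
  then show "rmode a k \<phi> b = 0" by (simp add: lin_0[OF assms(1)])
qed

lemma lmode_eq_0:
  assumes "lin \<phi>" "kill \<phi> a l c" "k \<le> c"
  shows "lmode a k \<phi> = (\<lambda>b. 0)"
proof
  fix b
  have "\<phi> (smode a 0 b) = (\<Sum>k\<in>{k}. su 1 (lmode a k \<phi> b))"
    by (rule lmode_gen[OF assms(1,2)]) (use ideg_uminus[OF ideg_mono[OF ideg_xp[of k] assms(3)]] in simp_all)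
  then show "lmode a k \<phi> b = 0" by (simp add: lin_0[OF assms(1)])
qed

lemma lmode_minus_rmode: "lin \<phi> \<Longrightarrow> lmode a k \<phi> b - rmode a k \<phi> b = \<phi> (smode a (xp k) b)"
  by (simp add: lmode_def rmode_def right_diff_distrib smode_diff lin_diff)

lemma rmode_zero [simp]: "rmode a k (\<lambda>b. 0) = (\<lambda>b. 0)" by (simp add: rmode_def)
text \<open>Commuting a mode past \<open>smode c h\<close> shows that the space of good functionals is stable.\<close>

lemma good_compose:
  assumes \<phi>: "good \<phi>" and h: "zord k h" "ideg k' h"
  shows "good (\<lambda>b. \<phi> (smode c h b))"
  unfolding good_def
proof (intro conjI allI)
  have l: "lin \<phi>" by (rule good_lin[OF \<phi>])
  show "lin (\<lambda>b. \<phi> (smode c h b))"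
    using l by (auto simp: lin_def smode_add_right smode_scale_right)
  fix a
  obtain l0 c0 where lc0: "kill \<phi> a l0 c0" by (rule goodE[OF \<phi>])
  obtain K where K: "\<forall>j\<ge>K. Y a j c = 0" using Y_trunc by blast
  define I where "I = nat K"
  have I: "\<forall>i\<ge>I. Y a (int i) c = 0" using K by (simp add: I_def)
  obtain l1 c1 where lc1: "\<forall>i<I. kill \<phi> (Y a (int i) c) l1 c1"
    using good_kill_finite[OF \<phi>, of I "\<lambda>i. Y a (int i) c"] by blast
  have "kill (\<lambda>b. \<phi> (smode c h b)) a (max l0 (l1 + int I - k)) (min c0 (c1 - k'))"
    unfolding kill_def
  proof (intro allI impI)
    fix g :: "'k fls" and b assume g: "zord (max l0 (l1 + int I - k)) g" "ideg (min c0 (c1 - k')) g"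
    have "\<phi> (smode a g (smode c h b)) = 0"
      by (rule killD[OF lc0 zord_mono[OF g(1)] ideg_mono[OF g(2)]]) auto
    moreover have "\<phi> (smode (Y a (int i) c) (hasse i g * h) b) = 0" if "i < I" for i
    proof (rule killD)
      show "kill \<phi> (Y a (int i) c) l1 c1" using lc1 that by blast
      show "zord l1 (hasse i g * h)"
        by (rule zord_mono[OF zord_mult[OF zord_hasse[OF g(1)] h(1)]]) (use that in auto)
      show "ideg c1 (hasse i g * h)"
        by (rule ideg_mono[OF ideg_mult[OF ideg_hasse[OF g(2)] h(2)]]) auto
    qed
    then have "\<phi> (\<Sum>i<I. smode (Y a (int i) c) (hasse i g * h) b) = 0"
      by (simp add: lin_sum[OF l])
    then have "\<phi> (smode a g (smode c h b)) - \<phi> (smode c h (smode a g b)) = 0"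
      unfolding smode_commutator[of I a c g h b, OF I] lin_diff[OF l] .
    ultimately show "\<phi> (smode c h (smode a g b)) = 0" by simp
  qed
  then show "\<exists>l c'. kill (\<lambda>b. \<phi> (smode c h b)) a l c'" by blast
qed

lemma good_uminus: "good \<phi> \<Longrightarrow> good (\<lambda>b. - \<phi> b)"
  unfolding good_def lin_def kill_def
  using us.subspace_neg[OF Uc_sub] by (auto simp: us.scale_minus_right)

lemma good_rmode: "good \<phi> \<Longrightarrow> good (rmode a k \<phi>)"
  unfolding rmode_def
  by (intro good_uminus good_compose[where k = "k + 0" and k' = "k + 0"])
    (auto intro!: zord_mult zord_xp zord_cutoff ideg_mult ideg_xp ideg_mono[OF ideg_cutoff] simp del: add_0_right)

lemma good_lmode: "good \<phi> \<Longrightarrow> good (lmode a k \<phi>)"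
  unfolding lmode_def
  by (intro good_compose[where k = "k + 0" and k' = "k + 0"])
    (auto intro!: zord_mult zord_xp zord_diff zord_one zord_cutoff ideg_mult ideg_xp ideg_one_diff_cutoff simp del: add_0_right)

end

context voa
begin

lemma xp_truncate:
  "j < int N \<Longrightarrow> ((xp m :: 'k fls) - (\<Sum>i<N. of_int (ibinom m i) * zp (int i))) $$ j = 0"
proof -
  assume j: "j < int N"
  have "(\<Sum>i<N. of_int (ibinom m i) * (zp (int i) :: 'k fls)) $$ j = (\<Sum>i<N. if j = int i then of_int (ibinom m i) else 0)"
    unfolding fls_nth_sum by (intro sum.cong refl) (simp add: fls_of_int zp_nth)
  also have "\<dots> = (xp m :: 'k fls) $$ j"
  proof (cases "0 \<le> j")
    case True
    then obtain t where t: "j = int t" using nonneg_eq_int by blast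
    have "(\<Sum>i<N. if j = int i then of_int (ibinom m i) else 0) = (\<Sum>i<N. if t = i then of_int (ibinom m i) else 0 :: 'k)"
      by (intro sum.cong) (auto simp: t)
    then show ?thesis using j by (simp add: t xp_nth)
  next
    case False
    then have "(\<Sum>i<N. if j = int i then of_int (ibinom m i) else 0) = (0::'k)"
      by (intro sum.neutral) auto
    then show ?thesis using False by (simp add: xp_nth_neg)
  qed
  finally show ?thesis by simp
qed

lemma smode_xp_expand:
  assumes "\<And>i. int N \<le> i \<Longrightarrow> Y a i b = 0"
  shows "smode a (xp m * xp p) b = (\<Sum>i<N. sV (of_int (ibinom m i)) (smode a (zp (int i) * xp p) b))"
proof -
  let ?t = "xp m - (\<Sum>i<N. of_int (ibinom m i) * zp (int i)) :: 'k fls"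
  have "smode a (?t * xp p) b = 0"
  proof (rule smode_high[of "int N"])
    fix j assume "j < int N"
    then show "(?t * xp p) $$ j = 0"
      by (intro fls_times_nth_high[of "int N"] xp_truncate) (simp_all add: fls_subdegree_xp)
  qed (use assms in auto)
  then have "smode a (xp m * xp p) b = smode a ((\<Sum>i<N. of_int (ibinom m i) * zp (int i)) * xp p) b"
    by (simp add: left_diff_distrib smode_diff)
  then show ?thesis
    by (simp add: sum_distrib_right smode_sum mult.assoc smode_of_int_mult)
qed

lemma xp_nat_expand: "xp (int s) = (\<Sum>i\<le>s. of_int (int (s choose i)) * (zp (int i) :: 'k fls))"
proof -
  have "xp (int s) = (zp 1 + 1 :: 'k fls) ^ s"
    by (induction s) (simp_all add: xp_add xp_eq algebra_simps)
  also have "\<dots> = (\<Sum>i\<le>s. of_nat (s choose i) * zp 1 ^ i * 1 ^ (s - i))" by (rule binomial_ring)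
  finally show ?thesis by (simp add: zp_power)
qed

end

section \<open>Relations between the actions at x = 0 and at infinity\<close>

context coind
begin

text \<open>The commutator is a sum of residues whose test series are products: one factor, with its
  divided derivatives, is negligible at x = 0 and the other at infinity. For a high cutoff \<phi>
  kills all of them.\<close>

lemma lmode_rmode_commute:
  assumes \<phi>: "good \<phi>"
  shows "lmode a k (rmode c l \<phi>) = rmode c l (lmode a k \<phi>)"
proof
  fix b
  have lin: "lin \<phi>" by (rule good_lin[OF \<phi>])
  obtain K where K: "\<forall>j\<ge>K. Y a j c = 0" using Y_trunc by blast
  define I where "I = nat K"
  have I: "\<forall>i\<ge>I. Y a (int i) c = 0" using K by (simp add: I_def)
  obtain l1 c1 where lc1: "\<forall>i<I. kill \<phi> (Y a (int i) c) l1 c1"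
    using good_kill_finite[OF \<phi>, of I "\<lambda>i. Y a (int i) c"] by blast
  have "\<forall>\<^sub>F M in sequentially. (\<forall>b. lmode a k \<phi> b = \<phi> (smode a (xp k * (1 - cutoff M)) b))
      \<and> (\<forall>b. rmode c l \<phi> b = - \<phi> (smode c (xp l * cutoff M) b))
      \<and> (\<forall>b. lmode a k (rmode c l \<phi>) b = rmode c l \<phi> (smode a (xp k * (1 - cutoff M)) b))
      \<and> (\<forall>b. rmode c l (lmode a k \<phi>) b = - lmode a k \<phi> (smode c (xp l * cutoff M) b))
      \<and> l1 \<le> (k + l - int I) + int M \<and> (k + l) - int M \<le> c1"
    by (intro eventually_conj ev_le1 ev_le2 good_lmode_ev good_rmode_ev good_rmode good_lmode \<phi>)
  from ev_ex[OF this] obtain M where M: "\<And>b. lmode a k \<phi> b = \<phi> (smode a (xp k * (1 - cutoff M)) b)"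
    "\<And>b. rmode c l \<phi> b = - \<phi> (smode c (xp l * cutoff M) b)"
    "\<And>b. lmode a k (rmode c l \<phi>) b = rmode c l \<phi> (smode a (xp k * (1 - cutoff M)) b)"
    "\<And>b. rmode c l (lmode a k \<phi>) b = - lmode a k \<phi> (smode c (xp l * cutoff M) b)"
    "l1 \<le> (k + l - int I) + int M" "(k + l) - int M \<le> c1" by blast
  let ?g = "xp k * (1 - cutoff M)" and ?h = "xp l * cutoff M"
  have "\<phi> (smode (Y a (int i) c) (hasse i ?g * ?h) b) = 0" if i: "i < I" for i
  proof (rule killD)
    show "kill \<phi> (Y a (int i) c) l1 c1" using lc1 i by blast
    have "zord (k + int M - int i + (l + 0)) (hasse i ?g * ?h)"
      by (intro zord_mult zord_hasse zord_xp zord_one_diff_cutoff zord_cutoff)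
    then show "zord l1 (hasse i ?g * ?h)" by (rule zord_mono) (use M(5) i in simp)
    have "ideg (k + 0 - int i + (l + - int M)) (hasse i ?g * ?h)"
      by (intro ideg_mult ideg_hasse ideg_xp ideg_one_diff_cutoff ideg_cutoff)
    then show "ideg c1 (hasse i ?g * ?h)" by (rule ideg_mono) (use M(6) in simp)
  qed
  then have "\<phi> (\<Sum>i<I. smode (Y a (int i) c) (hasse i ?g * ?h) b) = 0"
    by (simp add: lin_sum[OF lin])
  then have "\<phi> (smode a ?g (smode c ?h b)) - \<phi> (smode c ?h (smode a ?g b)) = 0"
    unfolding smode_commutator[of I a c ?g ?h b, OF I] lin_diff[OF lin] .
  then show "lmode a k (rmode c l \<phi>) b = rmode c l (lmode a k \<phi>) b"
    unfolding M(3,4) unfolding M(1,2) by simp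
qed

text \<open>Now both test series decay at infinity and agree with x^p and x^q to high order at x =
  0. The i-th product is therefore binom(p,i) x^(p+q-i) near x = 0, which \<open>rmode_gen\<close>
  turns into a single mode.\<close>

lemma rmode_commutator:
  assumes \<phi>: "good \<phi>" and I: "\<forall>i\<ge>I. Y a (int i) c = 0"
  shows "rmode a p (rmode c q \<phi>) b - rmode c q (rmode a p \<phi>) b
    = (\<Sum>i<I. su (of_int (ibinom p i)) (rmode (Y a (int i) c) (p + q - int i) \<phi> b))"
proof -
  have lin: "lin \<phi>" by (rule good_lin[OF \<phi>])
  obtain l1 c1 where lc1: "\<forall>i<I. kill \<phi> (Y a (int i) c) l1 c1"
    using good_kill_finite[OF \<phi>, of I "\<lambda>i. Y a (int i) c"] by blast
  have "\<forall>\<^sub>F M in sequentially. (\<forall>b. rmode a p \<phi> b = - \<phi> (smode a (xp p * cutoff M) b))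
      \<and> (\<forall>b. rmode c q \<phi> b = - \<phi> (smode c (xp q * cutoff M) b))
      \<and> (\<forall>b. rmode a p (rmode c q \<phi>) b = - rmode c q \<phi> (smode a (xp p * cutoff M) b))
      \<and> (\<forall>b. rmode c q (rmode a p \<phi>) b = - rmode a p \<phi> (smode c (xp q * cutoff M) b))
      \<and> l1 \<le> (p + q - int I) + int M \<and> (p + q) - int M \<le> c1"
    by (intro eventually_conj ev_le1 ev_le2 good_rmode_ev good_rmode \<phi>)
  from ev_ex[OF this] obtain M where M: "\<And>b. rmode a p \<phi> b = - \<phi> (smode a (xp p * cutoff M) b)"
    "\<And>b. rmode c q \<phi> b = - \<phi> (smode c (xp q * cutoff M) b)"
    "\<And>b. rmode a p (rmode c q \<phi>) b = - rmode c q \<phi> (smode a (xp p * cutoff M) b)"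
    "\<And>b. rmode c q (rmode a p \<phi>) b = - rmode a p \<phi> (smode c (xp q * cutoff M) b)"
    "l1 \<le> (p + q - int I) + int M" "(p + q) - int M \<le> c1" by blast
  let ?g = "xp p * cutoff M :: 'k fls" and ?h = "xp q * cutoff M :: 'k fls"
  have *: "\<phi> (smode (Y a (int i) c) (hasse i ?g * ?h) b) = - su (of_int (ibinom p i)) (rmode (Y a (int i) c) (p + q - int i) \<phi> b)"
    if i: "i < I" for i
  proof -
    have "\<phi> (smode (Y a (int i) c) (hasse i ?g * ?h) b) = - (\<Sum>k\<in>{p + q - int i}. su (of_int (ibinom p i)) (rmode (Y a (int i) c) k \<phi> b))"
    proof (rule rmode_gen[OF lin])
      show "kill \<phi> (Y a (int i) c) l1 c1" using lc1 i by blast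
      have "ideg (p + - int M - int i + (q + - int M)) (hasse i ?g * ?h)"
        by (intro ideg_mult ideg_hasse ideg_xp ideg_cutoff)
      then show "ideg c1 (hasse i ?g * ?h)" by (rule ideg_mono) (use M(6) in simp)
      have hg: "hasse i ?g = of_int (ibinom p i) * xp (p - int i) - hasse i (xp p * (1 - cutoff M))"
        by (simp add: right_diff_distrib hasse_diff hasse_xp)
      have x: "xp (p + q - int i) = xp (p - int i) * (xp q :: 'k fls)"
        using xp_add[of "p - int i" q, where ?'a = 'k] by (simp add: algebra_simps)
      have e: "hasse i ?g * ?h - (\<Sum>k\<in>{p + q - int i}. fls_const (of_int (ibinom p i)) * xp k)
         = - (of_int (ibinom p i) * (xp (p + q - int i) * (1 - cutoff M)) + hasse i (xp p * (1 - cutoff M)) * ?h)"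
        unfolding hg by (simp add: fls_of_int[symmetric] x algebra_simps)
      have "zord l1 (of_int (ibinom p i) * (xp (p + q - int i) * (1 - cutoff M)))"
        by (intro zord_of_int_mult zord_mono[OF zord_mult[OF zord_xp[of "p + q - int i"] zord_one_diff_cutoff[of M]]])
          (use M(5) i in simp)
      moreover have "zord l1 (hasse i (xp p * (1 - cutoff M)) * ?h)"
        by (rule zord_mono[OF zord_mult[OF zord_hasse[OF zord_mult[OF zord_xp[of p] zord_one_diff_cutoff[of M]]] zord_mult[OF zord_xp[of q] zord_cutoff[of M]]]])
          (use M(5) i in simp)
      ultimately show "zord l1 (hasse i ?g * ?h - (\<Sum>k\<in>{p + q - int i}. fls_const (of_int (ibinom p i)) * xp k))"
        unfolding e by (intro zord_uminus zord_add)
    qed simp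
    then show ?thesis by simp
  qed
  have "\<phi> (\<Sum>i<I. smode (Y a (int i) c) (hasse i ?g * ?h) b)
     = - (\<Sum>i<I. su (of_int (ibinom p i)) (rmode (Y a (int i) c) (p + q - int i) \<phi> b))"
    unfolding lin_sum[OF lin] by (simp add: * sum_negf)
  then have "\<phi> (smode a ?g (smode c ?h b)) - \<phi> (smode c ?h (smode a ?g b))
     = - (\<Sum>i<I. su (of_int (ibinom p i)) (rmode (Y a (int i) c) (p + q - int i) \<phi> b))"
    unfolding smode_commutator[of I a c ?g ?h b, OF I] lin_diff[OF lin] .
  then show ?thesis
    unfolding M(3,4) unfolding M(1,2) by (simp add: algebra_simps)
qed

text \<open>The identity on V with \<open>g = x^p\<close> and \<open>h\<close> a cutoff of \<open>x^q\<close>. Expanding \<open>z^m\<close> at infinity in the first term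
  gives modes at infinity, expanding it at \<open>x = 0\<close> in the second term gives both kinds of modes, and the
  modes at infinity cancel because the two actions commute.\<close>

lemma rmode_weak_assoc:
  assumes \<phi>: "good \<phi>" and killa: "kill \<phi> a l c0" and lp: "l \<le> p"
    and N1: "\<forall>i\<ge>N1. Y a (r + int i) c = 0"
    and N2: "\<forall>i\<ge>N2. rmode c (q + int i) \<phi> = (\<lambda>b. 0)"
  shows "(\<Sum>i<N1. su (of_int (ibinom p i)) (rmode (Y a (r + int i) c) (p + q - int i) \<phi> b))
    = (\<Sum>i<N2. su (of_int ((-1)^i * ibinom r i)) (rmode a (p + r - int i) (rmode c (q + int i) \<phi>) b))"
proof -
  have lin: "lin \<phi>" by (rule good_lin[OF \<phi>])
  obtain lc cc where killc: "kill \<phi> c lc cc" by (rule goodE[OF \<phi>])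
  \<comment> \<open>\<open>S\<close> terms of the expansions suffice: p + r - S is at most
    \<open>c0\<close>, which makes the remainder at infinity negligible for \<open>a\<close>, and q
    + S is at least \<open>lc\<close>, which does the same for \<open>c\<close> at x = 0.\<close>
  define S where "S = N2 + nat (p + r - c0) + nat (lc - q)"
  define Lf where "Lf s = lmode a (p + r - int s) \<phi>" for s
  define Rt where "Rt j = rmode c (q + int j) \<phi>" for j
  have Lf: "good (Lf s)" "lin (Lf s)" for s unfolding Lf_def using good_lmode[OF \<phi>] good_lin by blast+
  have Rt: "good (Rt s)" "lin (Rt s)" for s unfolding Rt_def using good_rmode[OF \<phi>] good_lin by blast+
  have "\<forall>\<^sub>F M in sequentially.
      (\<forall>i\<in>{..<N1}. \<forall>b. rmode (Y a (r + int i) c) (p + q - int i) \<phi> b = - \<phi> (smode (Y a (r + int i) c) (xp (p + q - int i) * cutoff M) b))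
      \<and> (\<forall>s\<in>{..<S}. \<forall>b. rmode c (q + int s) (Lf s) b = - Lf s (smode c (xp (q + int s) * cutoff M) b))
      \<and> lc \<le> q + int M \<and> (r + q) - int M \<le> cc"
    by (intro eventually_conj ev_le1 ev_le2 eventually_ball_finite ballI good_rmode_ev \<phi> Lf) auto
  from ev_ex[OF this] obtain M where
    M1: "\<And>i b. i < N1 \<Longrightarrow> rmode (Y a (r + int i) c) (p + q - int i) \<phi> b = - \<phi> (smode (Y a (r + int i) c) (xp (p + q - int i) * cutoff M) b)"
    and M2: "\<And>s b. s < S \<Longrightarrow> rmode c (q + int s) (Lf s) b = - Lf s (smode c (xp (q + int s) * cutoff M) b)"
    and M3: "lc \<le> q + int M" and M4: "(r + q) - int M \<le> cc"
    by blast
  define h where "h = (xp q * cutoff M :: 'k fls)"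
  obtain I2 where I2: "\<forall>i\<ge>I2. smode c (zp (int i) * h) b = 0" using smode_zp_mult_high by blast
  obtain I3 where I3: "\<forall>i\<ge>I3. smode a (zp (int i) * xp p) b = 0" using smode_zp_mult_high by blast
  obtain K where K: "\<forall>j\<ge>K. Y a j b = 0" using Y_trunc by blast
  define I where "I = I2 + I3 + nat K + S"
  define v where "v i = smode c (zp (int i) * h) b" for i
  define w where "w i = smode a (zp (int i) * xp p) b" for i
  have J: "(\<Sum>i<N1. smode (Y a (r + int i) c) (hasse i (xp p) * h) b)
    = (\<Sum>i<I. sV (of_int ((-1)^i * ibinom r i)) (smode a (zp (r - int i) * xp p) (v i)
      - sV (of_int (sgnpow r)) (smode c (zp (r - int i) * h) (w i))))"
    unfolding v_def w_def by (rule smode_borcherds) (use N1 I2 I3 in \<open>auto simp: I_def\<close>)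

  have left: "\<phi> (\<Sum>i<N1. smode (Y a (r + int i) c) (hasse i (xp p) * h) b)
     = - (\<Sum>i<N1. su (of_int (ibinom p i)) (rmode (Y a (r + int i) c) (p + q - int i) \<phi> b))"
  proof -
    have "\<phi> (smode (Y a (r + int i) c) (hasse i (xp p) * h) b)
      = - su (of_int (ibinom p i)) (rmode (Y a (r + int i) c) (p + q - int i) \<phi> b)" if "i < N1" for i
    proof -
      have "xp (p + q - int i) = xp (p - int i) * (xp q :: 'k fls)"
        using xp_add[of "p - int i" q, where ?'a = 'k] by (simp add: algebra_simps)
      then have "hasse i (xp p) * h = of_int (ibinom p i) * (xp (p + q - int i) * cutoff M)"
        by (simp add: hasse_xp h_def mult.assoc)
      then show ?thesis by (simp add: smode_of_int_mult lin_scale[OF lin] M1[OF that])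
    qed
    then show ?thesis by (simp add: lin_sum[OF lin] sum_negf)
  qed

  have first: "(\<Sum>i<I. su (of_int ((-1)^i * ibinom r i)) (\<phi> (smode a (zp (r - int i) * xp p) (v i))))
     = - (\<Sum>s<S. su (of_int ((-1)^s * ibinom r s)) (rmode c (q + int s) (Lf s) b))"
  proof -
    have T1: "\<phi> (smode a (zp (r - int i) * xp p) x) = (\<Sum>j<S - i. su (of_int ((-1)^j * ibinom (r - int i) j)) (Lf (i + j) x))" for i x
    proof -
      let ?k = "\<lambda>j. p + r - int (i + j)"
      have inj: "inj_on ?k {..<S - i}" by (auto simp: inj_on_def)
      have e: "zp (r - int i) * xp p - (\<Sum>k\<in>?k ` {..<S - i}. fls_const (of_int ((-1)^nat (p + r - int i - k) * ibinom (r - int i) (nat (p + r - int i - k)))) * xp k)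
        = (zp (r - int i) - (\<Sum>j<S - i. of_int ((-1)^j * ibinom (r - int i) j) * xp (r - int i - int j))) * (xp p :: 'k fls)"
      proof -
        have x: "xp (p + r - int (i + j)) = xp (r - int i - int j) * (xp p :: 'k fls)" for j
          using xp_add[of "r - int i - int j" p, where ?'a = 'k] by (simp add: algebra_simps)
        show ?thesis
          unfolding left_diff_distrib sum_distrib_right sum.reindex[OF inj] o_def x
          by (simp add: fls_of_int[symmetric] mult.assoc del: of_int_mult of_int_power)
      qed
      have "\<phi> (smode a (zp (r - int i) * xp p) x) = (\<Sum>k\<in>?k ` {..<S - i}. su (of_int ((-1)^nat (p + r - int i - k) * ibinom (r - int i) (nat (p + r - int i - k)))) (lmode a k \<phi> x))"
      proof (rule lmode_gen[OF lin killa])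
        show "zord l (zp (r - int i) * xp p :: 'k fls)" by (rule zord_mono[OF zord_mult[OF zord_zp zord_xp]]) (use lp in simp)
        show "ideg c0 (zp (r - int i) * xp p - (\<Sum>k\<in>?k ` {..<S - i}. fls_const (of_int ((-1)^nat (p + r - int i - k) * ibinom (r - int i) (nat (p + r - int i - k)))) * xp k) :: 'k fls)"
          unfolding e
          by (rule ideg_mono[OF ideg_mult[OF zp_expand_inf ideg_xp]]) (auto simp: S_def)
      qed simp
      then show ?thesis
        unfolding sum.reindex[OF inj] o_def Lf_def by (simp del: of_int_mult of_int_power)
    qed
    have "(\<Sum>i<I. su (of_int ((-1)^i * ibinom r i)) (\<phi> (smode a (zp (r - int i) * xp p) (v i))))
      = (\<Sum>i<I. \<Sum>j<S - i. su (of_int ((-1)^(i + j) * ibinom r (i + j) * int ((i + j) choose i))) (Lf (i + j) (v i)))"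
    proof (intro sum.cong refl)
      fix i
      have "su (of_int ((-1)^i * ibinom r i)) (su (of_int ((-1)^j * ibinom (r - int i) j)) x)
         = su (of_int ((-1)^(i + j) * ibinom r (i + j) * int ((i + j) choose i))) x" for j x
      proof -
        have "((-1)^i * ibinom r i) * ((-1)^j * ibinom (r - int i) j) = (-1)^(i + j) * (ibinom r i * ibinom (r - int i) j)"
          by (simp add: power_add)
        then show ?thesis unfolding us.scale_scale of_int_mult[symmetric] ibinom_trinomial
          by (simp only: mult.assoc)
      qed
      then show "su (of_int ((-1)^i * ibinom r i)) (\<phi> (smode a (zp (r - int i) * xp p) (v i)))
         = (\<Sum>j<S - i. su (of_int ((-1)^(i + j) * ibinom r (i + j) * int ((i + j) choose i))) (Lf (i + j) (v i)))"
        unfolding T1 us.scale_sum_right by (simp only:)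
    qed
    also have "\<dots> = (\<Sum>i<S. \<Sum>j<S - i. su (of_int ((-1)^(i + j) * ibinom r (i + j) * int ((i + j) choose i))) (Lf (i + j) (v i)))"
      by (rule sum_lessThan_tail) (auto simp: I_def)
    also have "\<dots> = (\<Sum>(i, j)\<in>{(i, j). i + j < S}. su (of_int ((-1)^(i + j) * ibinom r (i + j) * int ((i + j) choose i))) (Lf (i + j) (v i)))"
      by (subst sum.Sigma) (auto intro!: sum.cong)
    also have "\<dots> = (\<Sum>s<S. \<Sum>i\<le>s. su (of_int ((-1)^(i + (s - i)) * ibinom r (i + (s - i)) * int ((i + (s - i)) choose i))) (Lf (i + (s - i)) (v i)))"
      by (rule sum.triangle_reindex)
    also have "\<dots> = (\<Sum>s<S. su (of_int ((-1)^s * ibinom r s)) (Lf s (smode c (xp (q + int s) * cutoff M) b)))"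
    proof (intro sum.cong refl)
      fix s
      \<comment> \<open>For fixed s = i + j the trinomial revision has left the weights binom(s,i)
        on z^i. They sum to (1 + z)^s = x^s, which produces the test series of the mode q + s of
        \<open>c\<close>.\<close>
      have x: "xp (q + int s) * cutoff M = (\<Sum>i\<le>s. of_int (int (s choose i)) * (zp (int i) * h))"
        using xp_nat_expand[of s] by (simp add: xp_add h_def sum_distrib_left sum_distrib_right mult_ac)
      have "Lf s (smode c (xp (q + int s) * cutoff M) b) = (\<Sum>i\<le>s. su (of_int (int (s choose i))) (Lf s (v i)))"
        unfolding x smode_sum smode_of_int_mult lin_sum[OF Lf(2)] lin_scale[OF Lf(2)] v_def ..
      then show "(\<Sum>i\<le>s. su (of_int ((-1)^(i + (s - i)) * ibinom r (i + (s - i)) * int ((i + (s - i)) choose i))) (Lf (i + (s - i)) (v i)))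
         = su (of_int ((-1)^s * ibinom r s)) (Lf s (smode c (xp (q + int s) * cutoff M) b))"
        by (simp add: us.scale_sum_right mult.assoc)
    qed
    also have "\<dots> = - (\<Sum>s<S. su (of_int ((-1)^s * ibinom r s)) (rmode c (q + int s) (Lf s) b))"
      by (simp add: M2 sum_negf us.scale_minus_right)
    finally show ?thesis .
  qed

  have second: "(\<Sum>i<I. su (of_int ((-1)^i * ibinom r i)) (su (of_int (sgnpow r)) (\<phi> (smode c (zp (r - int i) * h) (w i)))))
     = - (\<Sum>j<S. su (of_int ((-1)^j * ibinom r j)) (Rt j (smode a (xp (p + r - int j)) b)))"
  proof -
    have T2: "\<phi> (smode c (zp (r - int i) * h) x) = - (\<Sum>j<S. su (of_int (sgnpow (r - int i - int j) * ibinom (r - int i) j)) (Rt j x))" for i x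
    proof -
      let ?k = "\<lambda>j. q + int j"
      have inj: "inj_on ?k {..<S}" by (auto simp: inj_on_def)
      let ?z = "zp (r - int i) - (\<Sum>j<S. of_int (sgnpow (r - int i - int j) * ibinom (r - int i) j) * xp (int j)) :: 'k fls"
      have e: "zp (r - int i) * h - (\<Sum>k\<in>?k ` {..<S}. fls_const (of_int (sgnpow (r - int i - int (nat (k - q))) * ibinom (r - int i) (nat (k - q)))) * xp k)
        = ?z * xp q - zp (r - int i) * (xp q * (1 - cutoff M))"
      proof -
        have x: "xp (q + int j) = xp (int j) * (xp q :: 'k fls)" for j
          using xp_add[of "int j" q, where ?'a = 'k] by (simp add: algebra_simps)
        show ?thesis
          unfolding left_diff_distrib sum_distrib_right sum.reindex[OF inj] o_def x h_def
          by (simp add: fls_of_int[symmetric] mult.assoc right_diff_distrib del: of_int_mult of_int_power)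
      qed
      have "\<phi> (smode c (zp (r - int i) * h) x) = - (\<Sum>k\<in>?k ` {..<S}. su (of_int (sgnpow (r - int i - int (nat (k - q))) * ibinom (r - int i) (nat (k - q)))) (rmode c k \<phi> x))"
      proof (rule rmode_gen[OF lin killc])
        show "ideg cc (zp (r - int i) * h)" unfolding h_def
          by (rule ideg_mono[OF ideg_mult[OF ideg_zp ideg_mult[OF ideg_xp ideg_cutoff]]]) (use M4 in simp)
        have "zord lc (?z * xp q)"
          by (rule zord_mono[OF zord_mult[OF zp_expand_zero zord_xp]]) (auto simp: S_def)
        moreover have "zord lc (zp (r - int i) * (xp q * (1 - cutoff M)))"
          by (rule zord_mono[OF zord_mult[OF zord_zp zord_mult[OF zord_xp zord_one_diff_cutoff]]]) (use M3 in simp)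
        ultimately show "zord lc (zp (r - int i) * h - (\<Sum>k\<in>?k ` {..<S}. fls_const (of_int (sgnpow (r - int i - int (nat (k - q))) * ibinom (r - int i) (nat (k - q)))) * xp k))"
          unfolding e by (rule zord_diff)
      qed simp
      then show ?thesis
        unfolding sum.reindex[OF inj] o_def Rt_def by (simp del: of_int_mult of_int_power)
    qed
    have co: "su (of_int ((-1)^i * ibinom r i)) (su (of_int (sgnpow r)) (su (of_int (sgnpow (r - int i - int j) * ibinom (r - int i) j)) x))
       = su (of_int ((-1)^j * ibinom r j)) (su (of_int (ibinom (r - int j) i)) x)" for i j x
    proof -
      have sg: "(-1)^i * sgnpow r * sgnpow (r - int i - int j) = (-1)^j"
        by (auto simp: sgnpow_def minus_one_power_iff)
      have tr: "ibinom r i * ibinom (r - int i) j = ibinom r j * ibinom (r - int j) i"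
        unfolding ibinom_trinomial using binomial_symmetric[of i "i + j"] by (simp add: add.commute)
      have "((-1)^i * ibinom r i) * (sgnpow r * (sgnpow (r - int i - int j) * ibinom (r - int i) j))
         = ((-1)^i * sgnpow r * sgnpow (r - int i - int j)) * (ibinom r i * ibinom (r - int i) j)"
        by (simp add: mult_ac)
      also have "\<dots> = ((-1)^j * ibinom r j) * ibinom (r - int j) i" unfolding sg tr by simp
      finally show ?thesis unfolding us.scale_scale of_int_mult[symmetric] by (simp only: mult.assoc)
    qed
    have "(\<Sum>i<I. su (of_int ((-1)^i * ibinom r i)) (su (of_int (sgnpow r)) (\<phi> (smode c (zp (r - int i) * h) (w i)))))
      = - (\<Sum>i<I. \<Sum>j<S. su (of_int ((-1)^j * ibinom r j)) (su (of_int (ibinom (r - int j) i)) (Rt j (w i))))"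
      unfolding T2 us.scale_minus_right us.scale_sum_right co sum_negf ..
    also have "(\<Sum>i<I. \<Sum>j<S. su (of_int ((-1)^j * ibinom r j)) (su (of_int (ibinom (r - int j) i)) (Rt j (w i))))
      = (\<Sum>j<S. su (of_int ((-1)^j * ibinom r j)) (\<Sum>i<I. su (of_int (ibinom (r - int j) i)) (Rt j (w i))))"
      unfolding us.scale_sum_right by (rule sum.swap)
    also have "\<dots> = (\<Sum>j<S. su (of_int ((-1)^j * ibinom r j)) (Rt j (smode a (xp (p + r - int j)) b)))"
    proof (intro sum.cong refl arg_cong[where f = "su _"])
      fix j
      have x: "xp (p + r - int j) = xp (r - int j) * (xp p :: 'k fls)"
        using xp_add[of "r - int j" p, where ?'a = 'k] by (simp add: algebra_simps)
      have "smode a (xp (p + r - int j)) b = (\<Sum>i<I. sV (of_int (ibinom (r - int j) i)) (w i))"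
        unfolding x w_def
      proof (rule smode_xp_expand)
        fix i assume "int I \<le> i"
        moreover have "K \<le> int I" unfolding I_def by linarith
        ultimately show "Y a i b = 0" using K by simp
      qed
      then show "(\<Sum>i<I. su (of_int (ibinom (r - int j) i)) (Rt j (w i))) = Rt j (smode a (xp (p + r - int j)) b)"
        by (simp add: lin_sum[OF Rt(2)] lin_scale[OF Rt(2)])
    qed
    finally show ?thesis .
  qed

  have "\<phi> (\<Sum>i<I. sV (of_int ((-1)^i * ibinom r i)) (smode a (zp (r - int i) * xp p) (v i)
      - sV (of_int (sgnpow r)) (smode c (zp (r - int i) * h) (w i))))
    = (\<Sum>i<I. su (of_int ((-1)^i * ibinom r i)) (\<phi> (smode a (zp (r - int i) * xp p) (v i))))
     - (\<Sum>i<I. su (of_int ((-1)^i * ibinom r i)) (su (of_int (sgnpow r)) (\<phi> (smode c (zp (r - int i) * h) (w i)))))"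
    unfolding lin_sum[OF lin] lin_scale[OF lin] lin_diff[OF lin] us.scale_right_diff_distrib sum_subtractf ..
  then have main: "(\<Sum>i<N1. su (of_int (ibinom p i)) (rmode (Y a (r + int i) c) (p + q - int i) \<phi> b))
     = (\<Sum>s<S. su (of_int ((-1)^s * ibinom r s)) (rmode c (q + int s) (Lf s) b))
      - (\<Sum>j<S. su (of_int ((-1)^j * ibinom r j)) (Rt j (smode a (xp (p + r - int j)) b)))"
    unfolding J[symmetric] left first second by (simp add: algebra_simps)
  have "rmode c (q + int s) (Lf s) b - Rt s (smode a (xp (p + r - int s)) b)
     = rmode a (p + r - int s) (rmode c (q + int s) \<phi>) b" for s
    using lmode_minus_rmode[OF Rt(2)[of s], of a "p + r - int s" b] lmode_rmode_commute[OF \<phi>]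
    by (simp add: Lf_def Rt_def algebra_simps)
  then have "(\<Sum>i<N1. su (of_int (ibinom p i)) (rmode (Y a (r + int i) c) (p + q - int i) \<phi> b))
     = (\<Sum>s<S. su (of_int ((-1)^s * ibinom r s)) (rmode a (p + r - int s) (rmode c (q + int s) \<phi>) b))"
    unfolding main sum_subtractf[symmetric] us.scale_right_diff_distrib[symmetric] by simp
  also have "\<dots> = (\<Sum>s<N2. su (of_int ((-1)^s * ibinom r s)) (rmode a (p + r - int s) (rmode c (q + int s) \<phi>) b))"
    by (rule sum_lessThan_tail) (use N2 in \<open>auto simp: S_def\<close>)
  finally show ?thesis .
qed

end

lemma fun_sum_apply: "(sum f S) x = (\<Sum>i\<in>S. f i x)"
  by (induction S rule: infinite_finite_induct) simp_all

lemma fsum_apply: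
  fixes f :: "nat \<Rightarrow> 'a \<Rightarrow> 'b::comm_monoid_add"
  assumes "\<And>i. N \<le> i \<Longrightarrow> f i = 0"
  shows "fsum f x = fsum (\<lambda>i. f i x)"
proof -
  have "fsum f = sum f {..<N}" by (rule fsum_eq) (rule assms)
  moreover have "fsum (\<lambda>i. f i x) = (\<Sum>i<N. f i x)" by (rule fsum_eq) (simp add: assms)
  ultimately show ?thesis by (simp add: fun_sum_apply)
qed

section \<open>The weak V-module of good functionals\<close>

context coind
begin

definition sc :: "'k \<Rightarrow> ('v \<Rightarrow> 'u) \<Rightarrow> 'v \<Rightarrow> 'u" where
  "sc c \<phi> = (\<lambda>b. su c (\<phi> b))"

lemma sc_apply: "sc c \<phi> b = su c (\<phi> b)" by (simp add: sc_def)

lemma vector_space_sc: "vector_space sc"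
  by unfold_locales
    (simp_all add: sc_def fun_eq_iff us.scale_right_distrib us.scale_left_distrib)

lemma good_zero: "good 0"
  unfolding good_def lin_def kill_def using us.subspace_0[OF Uc_sub] by simp

lemma good_add: assumes "good \<phi>" "good \<psi>" shows "good (\<phi> + \<psi>)"
  unfolding good_def
proof (intro conjI allI)
  show "lin (\<phi> + \<psi>)"
    using good_lin[OF assms(1)] good_lin[OF assms(2)] us.subspace_add[OF Uc_sub]
    by (simp add: lin_def us.scale_right_distrib)
  fix a
  obtain l c where 1: "kill \<phi> a l c" by (rule goodE[OF assms(1)])
  obtain l' c' where 2: "kill \<psi> a l' c'" by (rule goodE[OF assms(2)])
  have "kill \<phi> a (max l l') (min c c')" by (rule kill_mono[OF 1]) auto
  moreover have "kill \<psi> a (max l l') (min c c')" by (rule kill_mono[OF 2]) auto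
  ultimately have "kill (\<phi> + \<psi>) a (max l l') (min c c')" by (simp add: kill_def)
  then show "\<exists>l c. kill (\<phi> + \<psi>) a l c" by blast
qed

lemma good_sc:
  assumes "good \<phi>"
  shows "good (sc k \<phi>)"
  unfolding good_def
proof (intro conjI allI)
  show "lin (sc k \<phi>)"
    using good_lin[OF assms] us.subspace_scale[OF Uc_sub]
    by (simp add: lin_def sc_def us.scale_right_distrib us.scale_left_commute)
  fix a
  obtain l c where "kill \<phi> a l c" by (rule goodE[OF assms])
  then have "kill (sc k \<phi>) a l c" by (simp add: kill_def sc_def)
  then show "\<exists>l c. kill (sc k \<phi>) a l c" by blast
qed

lemma rmode_add_right:
  assumes "good \<phi>" "good \<psi>"
  shows "rmode a k (\<phi> + \<psi>) = rmode a k \<phi> + rmode a k \<psi>"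
proof
  fix b
  have "\<forall>\<^sub>F M in sequentially. (\<forall>b. rmode a k \<phi> b = - \<phi> (smode a (xp k * cutoff M) b))
      \<and> (\<forall>b. rmode a k \<psi> b = - \<psi> (smode a (xp k * cutoff M) b))
      \<and> (\<forall>b. rmode a k (\<phi> + \<psi>) b = - (\<phi> + \<psi>) (smode a (xp k * cutoff M) b))"
    by (intro eventually_conj good_rmode_ev assms good_add)
  from ev_ex[OF this] show "rmode a k (\<phi> + \<psi>) b = (rmode a k \<phi> + rmode a k \<psi>) b" by auto
qed

lemma rmode_sc:
  assumes "good \<phi>"
  shows "rmode a k (sc c \<phi>) = sc c (rmode a k \<phi>)"
proof
  fix b
  have "\<forall>\<^sub>F M in sequentially. (\<forall>b. rmode a k \<phi> b = - \<phi> (smode a (xp k * cutoff M) b))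
      \<and> (\<forall>b. rmode a k (sc c \<phi>) b = - (sc c \<phi>) (smode a (xp k * cutoff M) b))"
    by (intro eventually_conj good_rmode_ev assms good_sc)
  from ev_ex[OF this] show "rmode a k (sc c \<phi>) b = sc c (rmode a k \<phi>) b"
    by (auto simp: sc_apply us.scale_minus_right)
qed

lemma rmode_add_left:
  assumes "good \<phi>"
  shows "rmode (a + a') k \<phi> = rmode a k \<phi> + rmode a' k \<phi>"
proof
  fix b
  have "\<forall>\<^sub>F M in sequentially. (\<forall>b. rmode a k \<phi> b = - \<phi> (smode a (xp k * cutoff M) b))
      \<and> (\<forall>b. rmode a' k \<phi> b = - \<phi> (smode a' (xp k * cutoff M) b))
      \<and> (\<forall>b. rmode (a + a') k \<phi> b = - \<phi> (smode (a + a') (xp k * cutoff M) b))"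
    by (intro eventually_conj good_rmode_ev assms)
  from ev_ex[OF this] show "rmode (a + a') k \<phi> b = (rmode a k \<phi> + rmode a' k \<phi>) b"
    by (auto simp: smode_add_left lin_add[OF good_lin[OF assms]])
qed

lemma rmode_scale_left:
  assumes "good \<phi>"
  shows "rmode (sV c a) k \<phi> = sc c (rmode a k \<phi>)"
proof
  fix b
  have "\<forall>\<^sub>F M in sequentially. (\<forall>b. rmode a k \<phi> b = - \<phi> (smode a (xp k * cutoff M) b))
      \<and> (\<forall>b. rmode (sV c a) k \<phi> b = - \<phi> (smode (sV c a) (xp k * cutoff M) b))"
    by (intro eventually_conj good_rmode_ev assms)
  from ev_ex[OF this] show "rmode (sV c a) k \<phi> b = sc c (rmode a k \<phi>) b"
    by (auto simp: sc_apply smode_scale_left lin_scale[OF good_lin[OF assms]] us.scale_minus_right)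
qed

lemma rmode_trunc:
  assumes "good \<phi>"
  shows "\<exists>N. \<forall>l\<ge>N. rmode a l \<phi> = 0"
proof -
  obtain l c where "kill \<phi> a l c" by (rule goodE[OF assms])
  then show ?thesis using rmode_eq_0[OF good_lin[OF assms]] unfolding zero_fun_def by blast
qed

lemma smode_vac: "smode vac g b = sV (g $$ (-1)) b"
proof -
  have "smode vac g b = (\<Sum>j\<in>{-1}. sV (g $$ j) (Y vac j b))"
    unfolding smode_def by (rule sum.mono_neutral_left) (auto simp: Y_vac)
  then show ?thesis by (simp add: Y_vac)
qed

lemma kill_vac:
  assumes "lin \<phi>"
  shows "kill \<phi> vac 0 (-2)"
  unfolding kill_def
proof (intro allI impI)
  fix g :: "'k fls" and b assume "zord 0 g" "ideg (-2) g"
  from zord_ideg_inter[OF this] obtain f where "degle (- 2 - 0) f" "g = xp 0 * f" by blast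
  then have "g $$ (-1) = 0" by (simp add: degle_def)
  then show "\<phi> (smode vac g b) = 0" by (simp add: smode_vac lin_0[OF assms])
qed

lemma rmode_vac:
  assumes "good \<phi>"
  shows "rmode vac k \<phi> = (if k = -1 then \<phi> else 0)"
proof -
  have lin: "lin \<phi>" by (rule good_lin[OF assms])
  note kill = kill_vac[OF lin]
  consider "0 \<le> k" | "k \<le> -2" | "k = -1" by linarith
  then show ?thesis
  proof cases
    case 1
    then show ?thesis using rmode_eq_0[OF lin kill 1] by (simp add: zero_fun_def)
  next
    case 2
    have "rmode vac k \<phi> b = 0" for b
      using lmode_minus_rmode[OF lin, of vac k b] lmode_eq_0[OF lin kill 2]
      by (simp add: smode_vac xp_nth_neg lin_0[OF lin])
    then show ?thesis using 2 by (auto simp: fun_eq_iff)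
  next
    case 3
    have "rmode vac (-1) \<phi> b = \<phi> b" for b
    proof -
      \<comment> \<open>1/(xz) = 1/z - 1/x decays like z^(-2), as the bound for the vacuum demands,
        and has principal part -1/x at x = 0.\<close>
      let ?h = "xp (-1) * zp (-1) :: 'k fls"
      have "xp (-1) * xp 1 = (1 :: 'k fls)" by (simp add: xp_add[symmetric])
      then have x: "xp (-1) + xp (-1) * zp 1 = (1 :: 'k fls)" by (simp add: xp_eq distrib_left)
      have e: "?h + xp (-1) = zp (-1)"
      proof -
        have "?h + xp (-1) = (xp (-1) + xp (-1) * zp 1) * zp (-1)"
          by (simp add: distrib_right mult.assoc zp_add[symmetric])
        then show ?thesis unfolding x by simp
      qed
      have "\<phi> (smode vac ?h b) = - (\<Sum>k\<in>{-1}. su (-1) (rmode vac k \<phi> b))"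
      proof (rule rmode_gen[OF lin kill])
        show "ideg (-2) ?h" using ideg_mult[OF ideg_xp[of "-1"] ideg_zp[of "-1"]] by simp
        show "zord 0 (?h - (\<Sum>k\<in>{-1}. fls_const (-1) * xp k))"
          using zord_zp[of "-1"] e by simp
      qed simp
      moreover have "?h $$ (-1) = (xp (-1) :: 'k fls) $$ int 0" by (simp add: times_zp_nth)
      then have "?h $$ (-1) = 1" unfolding xp_nth by simp
      ultimately show ?thesis by (simp add: smode_vac)
    qed
    then show ?thesis using 3 by (simp add: fun_eq_iff)
  qed
qed

lemma rmode_0_left: "lin \<phi> \<Longrightarrow> rmode 0 k \<phi> = 0"
  by (simp add: rmode_def lin_0 fun_eq_iff)

lemma rmode_borcherds_at:
  assumes \<phi>: "good \<phi>"
  shows "bL su (\<lambda>j k. rmode (Y u j v) k \<phi> b) p q r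
    = bR su (\<lambda>k l. rmode u k (rmode v l \<phi>) b) (\<lambda>k l. rmode v k (rmode u l \<phi>) b) p q r"
proof -
  have lin: "lin \<phi>" by (rule good_lin[OF \<phi>])
  obtain K where K: "\<forall>j\<ge>K. Y u j v = 0" using Y_trunc by blast
  obtain l c where kill: "kill \<phi> u l c" by (rule goodE[OF \<phi>])
  obtain L where L: "\<forall>j\<ge>L. rmode v j \<phi> = 0" using rmode_trunc[OF \<phi>] by blast
  have ru: "\<forall>j\<ge>l. rmode u j \<phi> = 0" using rmode_eq_0[OF lin kill] by (simp add: zero_fun_def)
  have rz: "rmode a k 0 = 0" for a k using rmode_zero by (simp add: zero_fun_def)
  show ?thesis
  \<comment> \<open>The pole bound \<open>l\<close> of \<open>u\<close> at x = 0 is the threshold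
    for weak associativity; it depends neither on \<open>q\<close> nor on \<open>r\<close>, as the
    ladder requires.\<close>
  proof (rule us.borcherds_ladder[of K _ "max L l" _ _ l])
    fix j k :: int assume "K \<le> j" then show "rmode (Y u j v) k \<phi> b = 0" using K rmode_0_left[OF lin] by simp
  next
    fix k j :: int assume "max L l \<le> j"
    then show "rmode u k (rmode v j \<phi>) b = 0" "rmode v k (rmode u j \<phi>) b = 0" using L ru rz by simp_all
  next
    fix p q
    have "bL su (\<lambda>j k. rmode (Y u j v) k \<phi> b) p q 0
       = (\<Sum>i<nat K. su (of_int (ibinom p i)) (rmode (Y u (0 + int i) v) (p + q - int i) \<phi> b))"
      unfolding bL_def by (rule fsum_eq) (use K rmode_0_left[OF lin] in simp)
    also have "\<dots> = rmode u p (rmode v q \<phi>) b - rmode v q (rmode u p \<phi>) b"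
      using rmode_commutator[OF \<phi>, of "nat K" u v p q b] K by simp
    also have "\<dots> = bR su (\<lambda>k l. rmode u k (rmode v l \<phi>) b) (\<lambda>k l. rmode v k (rmode u l \<phi>) b) p q 0"
      unfolding bR_def by (subst fsum_eq[of 1]) (auto simp: ibinom_0_left sgnpow_def)
    finally show "bL su (\<lambda>j k. rmode (Y u j v) k \<phi> b) p q 0
       = bR su (\<lambda>k l. rmode u k (rmode v l \<phi>) b) (\<lambda>k l. rmode v k (rmode u l \<phi>) b) p q 0" .
  next
    fix p q r assume p: "l \<le> p"
    have "bL su (\<lambda>j k. rmode (Y u j v) k \<phi> b) p q r
       = (\<Sum>i<nat (K - r). su (of_int (ibinom p i)) (rmode (Y u (r + int i) v) (p + q - int i) \<phi> b))"
      unfolding bL_def by (rule fsum_eq) (use K rmode_0_left[OF lin] in simp)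
    also have "\<dots> = (\<Sum>i<nat (L - q). su (of_int ((-1)^i * ibinom r i)) (rmode u (p + r - int i) (rmode v (q + int i) \<phi>) b))"
      by (rule rmode_weak_assoc[OF \<phi> kill p]) (use K L in \<open>auto simp: zero_fun_def\<close>)
    also have "\<dots> = bR su (\<lambda>k l. rmode u k (rmode v l \<phi>) b) (\<lambda>k l. rmode v k (rmode u l \<phi>) b) p q r"
      unfolding bR_def by (subst fsum_eq[of "nat (L - q)"]) (use L ru rz p in auto)
    finally show "bL su (\<lambda>j k. rmode (Y u j v) k \<phi> b) p q r
       = bR su (\<lambda>k l. rmode u k (rmode v l \<phi>) b) (\<lambda>k l. rmode v k (rmode u l \<phi>) b) p q r" .
  qed
qed

lemma rmode_borcherds: "borcherds Y {\<phi>. good \<phi>} sc rmode"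
  unfolding borcherds_def
proof (intro allI ballI ext)
  fix u v \<phi> and p q r :: int and b assume "\<phi> \<in> {\<phi>. good \<phi>}"
  then have \<phi>: "good \<phi>" by simp
  have lin: "lin \<phi>" by (rule good_lin[OF \<phi>])
  obtain K where K: "\<forall>j\<ge>K. Y u j v = 0" using Y_trunc by blast
  obtain L where L: "\<forall>j\<ge>L. rmode v j \<phi> = 0" using rmode_trunc[OF \<phi>] by blast
  obtain L' where L': "\<forall>j\<ge>L'. rmode u j \<phi> = 0" using rmode_trunc[OF \<phi>] by blast
  have rz: "rmode a k 0 = 0" for a k using rmode_zero by (simp add: zero_fun_def)
  have sz: "sc c 0 = 0" for c by (simp add: sc_def fun_eq_iff)
  have "fsum (\<lambda>i. sc (of_int (ibinom p i)) (rmode (Y u (r + int i) v) (p + q - int i) \<phi>)) b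
     = bL su (\<lambda>j k. rmode (Y u j v) k \<phi> b) p q r"
    unfolding bL_def
    by (subst fsum_apply[of "nat (K - r)"]) (use K rmode_0_left[OF lin] sz in \<open>auto simp: sc_apply\<close>)
  also have "\<dots> = bR su (\<lambda>k l. rmode u k (rmode v l \<phi>) b) (\<lambda>k l. rmode v k (rmode u l \<phi>) b) p q r"
    by (rule rmode_borcherds_at[OF \<phi>])
  also have "\<dots> = fsum (\<lambda>i. sc (of_int ((- 1) ^ i * ibinom r i))
        (rmode u (p + r - int i) (rmode v (q + int i) \<phi>)
          - sc (of_int (sgnpow r)) (rmode v (q + r - int i) (rmode u (p + int i) \<phi>)))) b"
    unfolding bR_def
    by (subst fsum_apply[of "nat (L - q) + nat (L' - p)"])
      (use L L' rz sz in \<open>auto simp: sc_apply\<close>)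
  finally show "fsum (\<lambda>i. sc (of_int (ibinom p i)) (rmode (Y u (r + int i) v) (p + q - int i) \<phi>)) b
    = fsum (\<lambda>i. sc (of_int ((- 1) ^ i * ibinom r i))
        (rmode u (p + r - int i) (rmode v (q + int i) \<phi>)
          - sc (of_int (sgnpow r)) (rmode v (q + r - int i) (rmode u (p + int i) \<phi>)))) b" .
qed

sublocale gm: wmod V sc "{\<phi>. good \<phi>}" rmode
proof -
  interpret vf: vector_space sc by (rule vector_space_sc)
  show "wmod V sc {\<phi>. good \<phi>} rmode"
  proof unfold_locales
    show "vf.subspace {\<phi>. good \<phi>}"
      unfolding vf.subspace_def using good_zero good_add good_sc by blast
    show "borcherds Y {\<phi>. good \<phi>} sc rmode" by (rule rmode_borcherds)
  qed (auto simp: good_rmode rmode_add_right rmode_sc rmode_add_left rmode_scale_left rmode_trunc rmode_vac)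
qed

end

section \<open>Modules over the n-th Zhu algebra\<close>

context voa
begin

lemma fsum_smode:
  "fsum (\<lambda>i. sV (of_int (ibinom N i)) (Y a (m + int i) b)) = smode a (xp N * zp m) b"
proof -
  obtain h where h: "\<forall>j\<ge>h. Y a j b = 0" using Y_trunc by blast
  define K where "K = nat (h - m)"
  let ?t = "xp N - (\<Sum>i<K. of_int (ibinom N i) * zp (int i)) :: 'k fls"
  have "smode a (?t * zp m) b = 0"
  proof (rule smode_high[of "int K + m"])
    fix j assume j: "j < int K + m"
    have "?t $$ (j - m) = 0" by (rule xp_truncate) (use j in simp)
    then show "(?t * zp m) $$ j = 0" unfolding times_zp_nth .
  next
    fix j assume "int K + m \<le> j"
    moreover have "h \<le> int K + m" unfolding K_def by linarith
    ultimately show "Y a j b = 0" using h by simp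
  qed
  then have "smode a (xp N * zp m) b = smode a ((\<Sum>i<K. of_int (ibinom N i) * zp (int i)) * zp m) b"
    by (simp add: left_diff_distrib smode_diff)
  also have "\<dots> = (\<Sum>i<K. sV (of_int (ibinom N i)) (Y a (m + int i) b))"
    by (simp add: sum_distrib_right smode_sum mult.assoc smode_of_int_mult zp_add[symmetric] smode_zp add.commute)
  also have "\<dots> = fsum (\<lambda>i. sV (of_int (ibinom N i)) (Y a (m + int i) b))"
    by (rule fsum_eq[symmetric]) (use h in \<open>auto simp: K_def\<close>)
  finally show ?thesis ..
qed

lemma circ_smode: "circ V n s t d a b = smode a (xp (d + int n + int s) * zp (- 2 * int n - 2 - int t)) b"
proof -
  have e: "int i - 2 * int n - 2 - int t = (- 2 * int n - 2 - int t) + int i" for i by simp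
  show ?thesis unfolding circ_def e by (rule fsum_smode)
qed

lemma starh_smode:
  "starh V n d a b = smode a (\<Sum>j\<le>n. of_int ((-1)^j * int ((j + n) choose n)) * (xp (d + int n) * zp (- int n - 1 - int j))) b"
proof -
  have e: "int i - int n - int j - 1 = (- int n - 1 - int j) + int i" for i j by simp
  show ?thesis unfolding starh_def e fsum_smode smode_sum smode_of_int_mult ..
qed

lemma star_homog:
  assumes "a \<in> vgr V d"
  shows "star V n a b = starh V n d a b"
proof -
  have c: "vcomp V a = (\<lambda>j. if j = d then a else 0)"
    unfolding vcomp_eq_gcomp by (rule gv.gcomp_homog[OF assms])
  have 0: "starh V n d 0 b = 0" unfolding starh_smode by simp
  show ?thesis
  proof (cases "a = 0")
    case True then show ?thesis using c by (simp add: star_def 0)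
  next
    case False
    then have "{d'. vcomp V a d' \<noteq> 0} = {d}" by (auto simp: c)
    then show ?thesis by (simp add: star_def c)
  qed
qed

lemma circ_Oset: "a \<in> vgr V d \<Longrightarrow> s \<le> t \<Longrightarrow> circ V n s t d a b \<in> Oset V n"
  unfolding Oset_def by (rule sv.span_base) blast

text \<open>Integration by parts: moving the i-th divided power of translation from the state to the
  test series costs the sign (-1)^i.\<close>

lemma smode_D: "smode (Y a (- int i - 1) vac) g b = sV (of_int ((-1)^i)) (smode a (hasse i g) b)"
proof -
  obtain h where h: "\<forall>j\<ge>h. Y a j b = 0" using Y_trunc by blast
  have D: "Y (Y a (- int i - 1) vac) q b = sV (of_int ((-1)^i * ibinom q i)) (Y a (q - int i) b)" for q
    by (rule self.A_D) simp
  show ?thesis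
  proof (induction g rule: fls_approx_induct[where G = "h + int i"])
    case (add f g)
    then show ?case by (simp add: smode_add hasse_add sv.scale_right_distrib)
  next
    case (monom c p)
    show ?case
      unfolding smode_const_mult hasse_const_mult hasse_zp smode_of_int_mult smode_zp D by (simp add: mult_ac)
  next
    case H: (high t)
    have "smode (Y a (- int i - 1) vac) t b = 0"
      by (rule smode_high[of "h + int i"]) (use h H in \<open>auto simp: D\<close>)
    moreover have "smode a (hasse i t) b = 0"
      by (rule smode_high[of h]) (use h H in \<open>auto simp: hasse_nth\<close>)
    ultimately show ?case by simp
  qed
qed

text \<open>Skew symmetry in divided-power form. It is the Borcherds identity on the vacuum with p =
  -1 and q = 0, where creation leaves a single term on the right.\<close>

lemma Y_skew:
  assumes "\<forall>i\<ge>N. Y a (j + int i) b = 0"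
  shows "Y b j a = sV (of_int (- sgnpow j)) (\<Sum>i<N. sV (of_int ((-1)^i)) (Y (Y a (j + int i) b) (- int i - 1) vac))"
proof -
  have e: "-1 + 0 - int i = - int i - 1" for i by simp
  have "(\<Sum>i<N. sV (of_int (ibinom (-1) i)) (Y (Y a (j + int i) b) (-1 + 0 - int i) vac))
    = (\<Sum>i<1. sV (of_int ((-1)^i * ibinom j i))
        (Y a (-1 + j - int i) (Y b (0 + int i) vac)
          - sV (of_int (sgnpow j)) (Y b (0 + j - int i) (Y a (-1 + int i) vac))))"
    by (rule self.borcherds_sum) (use assms in \<open>auto simp: Y_creation\<close>)
  also have "\<dots> = - sV (of_int (sgnpow j)) (Y b j a)" by (simp add: Y_creation)
  finally have "(\<Sum>i<N. sV (of_int ((-1)^i)) (Y (Y a (j + int i) b) (- int i - 1) vac)) = - sV (of_int (sgnpow j)) (Y b j a)"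
    unfolding ibinom_minus_one e by simp
  moreover have "sgnpow j * sgnpow j = 1" by (simp add: sgnpow_def)
  then have "(of_int (sgnpow j) * of_int (sgnpow j) :: 'k) = 1" by (metis of_int_1 of_int_mult)
  ultimately show ?thesis by (simp add: sv.scale_minus_right)
qed

end

section \<open>Functionals attached to an A_n(V)-module\<close>

locale amodl = voa V for V :: "('k::field, 'v::ab_group_add) voa" +
  fixes n :: nat and U :: "('k, 'v, 'u::ab_group_add) amod"
  assumes amod: "is_amod V n U"
begin

abbreviation "Uc \<equiv> ucar U"
abbreviation "\<rho> \<equiv> uact U"

sublocale coind V "usc U" "ucar U"
proof -
  interpret u: vector_space "usc U" using amod by (simp add: is_amod_def)
  show "coind V (usc U) (ucar U)"
    by unfold_locales (use amod in \<open>simp add: is_amod_def\<close>)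
qed

lemma rho_closed: "x \<in> Uc \<Longrightarrow> \<rho> a x \<in> Uc" using amod by (simp add: is_amod_def)
lemma rho_add_right: "x \<in> Uc \<Longrightarrow> y \<in> Uc \<Longrightarrow> \<rho> a (x + y) = \<rho> a x + \<rho> a y"
  using amod by (simp add: is_amod_def linon_def)
lemma rho_scale_right: "x \<in> Uc \<Longrightarrow> \<rho> a (usc U c x) = usc U c (\<rho> a x)"
  using amod by (simp add: is_amod_def linon_def)
lemma rho_add_left: "x \<in> Uc \<Longrightarrow> \<rho> (a + b) x = \<rho> a x + \<rho> b x"
  using amod by (simp add: is_amod_def linon_def)
lemma rho_scale_left: "x \<in> Uc \<Longrightarrow> \<rho> (sV c a) x = usc U c (\<rho> a x)"
  using amod by (simp add: is_amod_def linon_def)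
lemma rho_Oset: "x \<in> Uc \<Longrightarrow> a \<in> Oset V n \<Longrightarrow> \<rho> a x = 0"
  using amod by (simp add: is_amod_def)
lemma rho_vac: "x \<in> Uc \<Longrightarrow> \<rho> vac x = x"
  using amod by (simp add: is_amod_def)
lemma rho_star: "x \<in> Uc \<Longrightarrow> \<rho> (star V n a b) x = \<rho> a (\<rho> b x)"
  using amod by (simp add: is_amod_def)

definition phi :: "'u \<Rightarrow> 'v \<Rightarrow> 'u" where "phi u = (\<lambda>b. \<rho> b u)"

lemma lin_phi: "u \<in> Uc \<Longrightarrow> lin (phi u)"
  by (simp add: lin_def phi_def rho_add_left rho_scale_left rho_closed)

text \<open>The two bounds force \<open>g\<close> to be x^(d+n) times a Laurent polynomial of degree
  at most -2n-2, hence a combination of the residue functions of the elements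
  \<open>circ V n 0 t d a b\<close>, which lie in O_n(V).\<close>

lemma kill_phi:
  assumes u: "u \<in> Uc" and a: "a \<in> vgr V d"
  shows "kill (phi u) a (d + int n) (d - int n - 2)"
  unfolding kill_def
proof (intro allI impI)
  fix g :: "'k fls" and b assume "zord (d + int n) g" "ideg (d - int n - 2) g"
  moreover have "d - int n - 2 - (d + int n) = - 2 * int n - 2" by simp
  ultimately obtain f where f: "degle (- 2 * int n - 2) f" "g = xp (d + int n) * f"
    using zord_ideg_inter by metis
  obtain F t where F: "finite F" "f = (\<Sum>p\<in>F. fls_const (f $$ p) * zp p) + t"
    "\<And>j. j < - 2 * int n - 1 \<Longrightarrow> t $$ j = 0"
    by (rule fls_decompose[of f "- 2 * int n - 1"]) (rule that)
  have f0: "f $$ p = 0" if "p > - 2 * int n - 2" for p using f(1) that by (simp add: degle_def)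
  have "t = 0"
  proof (rule fls_eqI)
    fix j show "t $$ j = 0 $$ j"
    proof (cases "j < - 2 * int n - 1")
      case True then show ?thesis using F(3) by simp
    next
      case False
      then have fj: "f $$ j = 0" by (intro f0) simp
      have "(\<Sum>p\<in>F. fls_const (f $$ p) * zp p) $$ j = 0"
        unfolding fls_nth_sum by (rule sum.neutral) (use fj in \<open>auto simp: zp_nth\<close>)
      moreover have "f $$ j = ((\<Sum>p\<in>F. fls_const (f $$ p) * zp p) + t) $$ j" using F(2) by metis
      ultimately show ?thesis using fj by simp
    qed
  qed
  then have g: "g = (\<Sum>p\<in>F. fls_const (f $$ p) * (xp (d + int n) * zp p))"
    using f(2) F(2) by (metis (no_types, lifting) add.right_neutral mult.left_commute sum.cong sum_distrib_left)
  have "usc U (f $$ p) (phi u (smode a (xp (d + int n) * zp p) b)) = 0" if "p \<in> F" for p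
  proof (cases "p > - 2 * int n - 2")
    case True then show ?thesis using f0 by simp
  next
    case False
    define t where "t = nat (- 2 * int n - 2 - p)"
    have p: "p = - 2 * int n - 2 - int t" using False by (simp add: t_def)
    have "smode a (xp (d + int n) * zp p) b = circ V n 0 t d a b" by (simp add: circ_smode p)
    then have "phi u (smode a (xp (d + int n) * zp p) b) = 0"
      using rho_Oset[OF u circ_Oset[OF a, of 0 t]] by (simp add: phi_def)
    then show ?thesis by simp
  qed
  then show "phi u (smode a g b) = 0" unfolding g phi_smode_sum[OF lin_phi[OF u]]
    by (intro sum.neutral ballI)
qed

lemma good_phi:
  assumes u: "u \<in> Uc"
  shows "good (phi u)"
  unfolding good_def
proof (intro conjI allI)
  show l: "lin (phi u)" by (rule lin_phi[OF u])
  fix a show "\<exists>l c. kill (phi u) a l c"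
  proof (induction a rule: V_induct)
    case (homog d a) then show ?case using kill_phi[OF u] by blast
  next
    case (add a a')
    then obtain l c l' c' where "kill (phi u) a l c" "kill (phi u) a' l' c'" by blast
    then have "kill (phi u) a (max l l') (min c c')" "kill (phi u) a' (max l l') (min c c')"
      by (auto intro: kill_mono)
    then have "kill (phi u) (a + a') (max l l') (min c c')"
      by (simp add: kill_def smode_add_left lin_add[OF l])
    then show ?case by blast
  qed
qed

text \<open>The coefficients (-1)^j binom(j+n,n) are binom(-n-1,j): the residue function of the
  product is x^(d+n) times the first n+1 terms of x^(-n-1) at infinity. It equals x^(d-1) up to
  z^(d-n-2), an error that does not affect \<open>phi u\<close>.\<close>

lemma lmode_star:
  assumes u: "u \<in> Uc" and a: "a \<in> vgr V d"
  shows "lmode a (d - 1) (phi u) b = \<rho> a (\<rho> b u)"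
proof -
  let ?h = "\<Sum>j\<le>n. of_int ((-1)^j * int ((j + n) choose n)) * (xp (d + int n) * zp (- int n - 1 - int j)) :: 'k fls"
  have h: "?h = xp (d + int n) * (\<Sum>j<Suc n. of_int (ibinom (- int n - 1) j) * zp (- int n - 1 - int j))"
    unfolding sum_distrib_left lessThan_Suc_atMost
  proof (intro sum.cong refl)
    fix j
    have "ibinom (- int n - 1) j = (-1)^j * int ((n + j) choose j)"
      unfolding ibinom_neg_Suc ibinom_of_nat ..
    also have "(n + j) choose j = (j + n) choose n"
      using binomial_symmetric[of j "n + j"] by (simp add: add.commute)
    finally show "of_int ((-1)^j * int ((j + n) choose n)) * (xp (d + int n) * zp (- int n - 1 - int j))
       = xp (d + int n) * (of_int (ibinom (- int n - 1) j) * zp (- int n - 1 - int j) :: 'k fls)"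
      by (simp only: mult.left_commute)
  qed
  have "\<rho> (star V n a b) u = phi u (smode a ?h b)"
    by (simp only: star_homog[OF a] starh_smode phi_def)
  also have "\<dots> = (\<Sum>k\<in>{d - 1}. usc U 1 (lmode a k (phi u) b))"
  proof (rule lmode_gen[OF lin_phi[OF u] kill_phi[OF u a]])
    show "zord (d + int n) ?h"
      unfolding h by (rule zord_mono[OF zord_mult[OF zord_xp zord_sum]]) (auto intro!: zord_of_int_mult zord_zp)
    have x: "xp (d - 1) = xp (d + int n) * (xp (- int n - 1) :: 'k fls)"
      by (simp add: xp_add[symmetric])
    have "ideg (d + int n + (- int n - 1 - int (Suc n))) (xp (d + int n)
       * (xp (- int n - 1) - (\<Sum>j<Suc n. of_int (ibinom (- int n - 1) j) * zp (- int n - 1 - int j)) :: 'k fls))"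
      by (intro ideg_mult ideg_xp xp_expand_inf)
    from ideg_uminus[OF this] have "ideg (d - int n - 2) (?h - xp (d - 1))"
      unfolding h x by (simp add: algebra_simps)
    then show "ideg (d - int n - 2) (?h - (\<Sum>k\<in>{d - 1}. fls_const 1 * xp k))" by simp
  qed simp
  finally show ?thesis using rho_star[OF u] by simp
qed

text \<open>Applied at the vacuum, \<open>lmode_star\<close> writes the action of either element as
  a residue. Integration by parts turns x^(d+i-1) into binom(d+i-1,i) x^(d-1), and with the sign
  (-1)^i the scalar is binom(-d,i).\<close>

lemma rho_D:
  assumes u: "u \<in> Uc" and a: "a \<in> vgr V d"
  shows "\<rho> (Y a (- int i - 1) vac) u = usc U (of_int (ibinom (- d) i)) (\<rho> a u)"
proof -
  let ?a = "Y a (- int i - 1) vac" and ?k = "d + int i - 1"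
  have a': "?a \<in> vgr V (d + int i)" using Y_gr[OF a vac_gr, of "- int i - 1"] by (simp add: algebra_simps)
  have "\<rho> ?a u = lmode ?a ?k (phi u) vac"
    using lmode_star[OF u a', of vac] by (simp add: rho_vac u)
  have "\<forall>\<^sub>F M in sequentially. (\<forall>b. lmode ?a ?k (phi u) b = phi u (smode ?a (xp ?k * (1 - cutoff M)) b))
     \<and> d + int n \<le> (?k - int i) + int M \<and> (?k - int i) - int M \<le> d - int n - 2"
    by (intro eventually_conj ev_le1 ev_le2 good_lmode_ev good_phi u)
  from ev_ex[OF this] obtain M where M: "\<And>b. lmode ?a ?k (phi u) b = phi u (smode ?a (xp ?k * (1 - cutoff M)) b)"
    "d + int n \<le> (?k - int i) + int M" "(?k - int i) - int M \<le> d - int n - 2" by blast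
  let ?h = "hasse i (xp ?k * (1 - cutoff M)) :: 'k fls"
  have e: "?h - (\<Sum>k\<in>{d - 1}. fls_const (of_int (ibinom ?k i)) * xp k) = - hasse i (xp ?k * cutoff M)"
  proof -
    have "?h = hasse i (xp ?k) - hasse i (xp ?k * cutoff M)"
      by (simp add: right_diff_distrib hasse_diff)
    also have "hasse i (xp ?k) = of_int (ibinom ?k i) * (xp (d - 1) :: 'k fls)"
      unfolding hasse_xp by simp
    finally show ?thesis by (simp add: fls_of_int)
  qed
  have "phi u (smode a ?h vac) = (\<Sum>k\<in>{d - 1}. usc U (of_int (ibinom ?k i)) (lmode a k (phi u) vac))"
  proof (rule lmode_gen[OF lin_phi[OF u] kill_phi[OF u a]])
    show "zord (d + int n) ?h"
      by (rule zord_mono[OF zord_hasse[OF zord_mult[OF zord_xp zord_one_diff_cutoff]]]) (use M in simp)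
    show "ideg (d - int n - 2) (?h - (\<Sum>k\<in>{d - 1}. fls_const (of_int (ibinom ?k i)) * xp k))"
      unfolding e
      by (rule ideg_uminus[OF ideg_mono[OF ideg_hasse[OF ideg_mult[OF ideg_xp ideg_cutoff]]]]) (use M in simp)
  qed simp
  also have "\<dots> = usc U (of_int (ibinom ?k i)) (\<rho> a u)"
    using lmode_star[OF u a, of vac] by (simp add: rho_vac u)
  finally have *: "phi u (smode a ?h vac) = usc U (of_int (ibinom ?k i)) (\<rho> a u)" .
  have "\<rho> ?a u = phi u (smode ?a (xp ?k * (1 - cutoff M)) vac)"
    using lmode_star[OF u a', of vac] M(1) by (simp add: rho_vac u)
  also have "\<dots> = usc U (of_int ((-1)^i)) (usc U (of_int (ibinom ?k i)) (\<rho> a u))"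
    unfolding smode_D lin_scale[OF lin_phi[OF u]] * ..
  also have "\<dots> = usc U (of_int (ibinom (- d) i)) (\<rho> a u)"
    unfolding ibinom_minus us.scale_scale by simp
  finally show ?thesis .
qed

text \<open>By \<open>rho_D\<close> the i-th term of skew symmetry acquires the scalar
  binom(d+e-j-2,i). These are the coefficients of x^(d+e-j-2), so the series of translations sums to
  a power of x.\<close>

lemma rho_skew_zp:
  assumes u: "u \<in> Uc" and a: "a \<in> vgr V d" and b: "b \<in> vgr V e"
  shows "phi u (smode b (zp j) a) = - usc U (of_int (sgnpow j)) (phi u (smode a (zp j * xp (d + e - j - 2)) b))"
proof -
  have l: "lin (phi u)" by (rule lin_phi[OF u])
  obtain K where K: "\<forall>l\<ge>K. Y a l b = 0" using Y_trunc by blast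
  define N where "N = nat (K - j)"
  have N: "\<forall>i\<ge>N. Y a (j + int i) b = 0" using K by (auto simp: N_def)
  have t: "phi u (sV (of_int ((-1)^i)) (Y (Y a (j + int i) b) (- int i - 1) vac))
     = usc U (of_int (ibinom (d + e - j - 2) i)) (phi u (Y a (j + int i) b))" for i
  proof -
    have "Y a (j + int i) b \<in> vgr V (d + e - (j + int i) - 1)" by (rule Y_gr[OF a b])
    from rho_D[OF u this, of i]
    have "phi u (Y (Y a (j + int i) b) (- int i - 1) vac)
      = usc U (of_int (ibinom (- (d + e - (j + int i) - 1)) i)) (phi u (Y a (j + int i) b))"
      by (simp only: phi_def)
    moreover have "ibinom (- (d + e - (j + int i) - 1)) i = (-1)^i * ibinom (d + e - j - 2) i"
      unfolding ibinom_minus by (simp add: algebra_simps)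
    ultimately show ?thesis by (simp add: lin_scale[OF l])
  qed
  have "phi u (smode b (zp j) a) = usc U (of_int (- sgnpow j)) (\<Sum>i<N. usc U (of_int (ibinom (d + e - j - 2) i)) (phi u (Y a (j + int i) b)))"
    unfolding smode_zp Y_skew[OF N] lin_scale[OF l, of "of_int (- sgnpow j)"] lin_sum[OF l] t ..
  also have "(\<Sum>i<N. usc U (of_int (ibinom (d + e - j - 2) i)) (phi u (Y a (j + int i) b)))
     = phi u (\<Sum>i<N. sV (of_int (ibinom (d + e - j - 2) i)) (Y a (j + int i) b))"
    by (simp add: lin_sum[OF l] lin_scale[OF l])
  also have "(\<Sum>i<N. sV (of_int (ibinom (d + e - j - 2) i)) (Y a (j + int i) b)) = smode a (zp j * xp (d + e - j - 2)) b"
    unfolding mult.commute[of "zp j"] fsum_smode[symmetric]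
    by (rule fsum_eq[symmetric]) (use N in simp)
  finally show ?thesis by (simp add: us.scale_minus_left)
qed

text \<open>Since x = 1 + z, both sides satisfy the recursion that adds the values at (s, j) and (s,
  j+1) to get the value at (s+1, j), and they agree at s = 0. To go down in \<open>s\<close>, the
  recursion is solved towards smaller \<open>j\<close>, starting at large \<open>j\<close>, where
  truncation makes both sides zero.\<close>

lemma rho_skew:
  assumes u: "u \<in> Uc" and a: "a \<in> vgr V d" and b: "b \<in> vgr V e"
  shows "phi u (smode b (xp s * zp j) a) = - usc U (of_int (sgnpow j)) (phi u (smode a (zp j * xp (d + e - j - 2 - s)) b))"
proof -
  have l: "lin (phi u)" by (rule lin_phi[OF u])
  define P where "P s j \<longleftrightarrow> phi u (smode b (xp s * zp j) a) = - usc U (of_int (sgnpow j)) (phi u (smode a (zp j * xp (d + e - j - 2 - s)) b))" for s j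
  define L where "L s j = phi u (smode b (xp s * zp j) a)" for s j
  define R where "R s j = - usc U (of_int (sgnpow j)) (phi u (smode a (zp j * xp (d + e - j - 2 - s)) b))" for s j
  have Ls: "L (s + 1) j = L s j + L s (j + 1)" for s j
  proof -
    have "xp (s + 1) * zp j = xp s * zp j + xp s * (zp (j + 1) :: 'k fls)"
      by (simp add: xp_add zp_add xp_eq algebra_simps)
    then show ?thesis by (simp add: L_def smode_add lin_add[OF l])
  qed
  have Rs: "R (s + 1) j = R s j + R s (j + 1)" for s j
  proof -
    let ?m = "d + e - j - 3 - s"
    have sg: "sgnpow (j + 1) = - sgnpow j" by (rule sgnpow_add_one)
    have i: "d + e - j - 2 - s = ?m + 1" "d + e - (j + 1) - 2 - s = ?m" "d + e - j - 2 - (s + 1) = ?m" by simp_all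
    have "zp j * xp (m + 1) = zp j * xp m + zp (j + 1) * (xp m :: 'k fls)" for m
      by (simp add: xp_add zp_add xp_eq algebra_simps)
    from this[of ?m] show ?thesis
      unfolding R_def i sg by (simp add: smode_add lin_add[OF l] us.scale_right_distrib us.scale_minus_left)
  qed
  have base: "L 0 j = R 0 j" for j
    using rho_skew_zp[OF u a b, of j] by (simp add: L_def R_def)
  obtain K1 where K1: "\<forall>j\<ge>K1. Y b j a = 0" using Y_trunc by blast
  obtain K2 where K2: "\<forall>j\<ge>K2. Y a j b = 0" using Y_trunc by blast
  have high: "L s j = R s j" if "max K1 K2 \<le> j" for s j
  proof -
    have "smode b (xp s * zp j) a = 0"
      by (rule smode_high[of K1]) (use that K1 in \<open>auto simp: times_zp_nth xp_nth_neg\<close>)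
    moreover have "smode a (zp j * xp m) b = 0" for m
      by (rule smode_high[of K2]) (use that K2 in \<open>auto simp: zp_times_nth xp_nth_neg\<close>)
    ultimately show ?thesis by (simp add: L_def R_def lin_0[OF l])
  qed
  have "\<forall>j. L s j = R s j"
  proof (induction s rule: int_induct[where k = 0])
    case base then show ?case using \<open>\<And>j. L 0 j = R 0 j\<close> by simp
  next
    case (step1 s) then show ?case by (simp add: Ls Rs)
  next
    case (step2 s)
    have "\<forall>j. max K1 K2 \<le> j + int m \<longrightarrow> L (s - 1) j = R (s - 1) j" for m
    proof (induction m)
      case 0 then show ?case using high by simp
    next
      case (Suc m)
      show ?case
      proof (intro allI impI)
        fix j assume "max K1 K2 \<le> j + int (Suc m)"
        then have "L (s - 1) (j + 1) = R (s - 1) (j + 1)" using Suc by simp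
        moreover have "L s j = R s j" using step2 by simp
        ultimately show "L (s - 1) j = R (s - 1) j" using Ls[of "s - 1" j] Rs[of "s - 1" j] by simp
      qed
    qed
    then show ?case by (metis add.commute diff_le_eq nat_le_iff order_refl zero_le_imp_eq_int linear)
  qed
  then show ?thesis by (simp add: L_def R_def)
qed

text \<open>The substitution \<open>x \<mapsto> 1/x\<close> exchanges the two expansion points.\<close>

lemma rmode_phi_eq_lmode_phi:
  assumes u: "u \<in> Uc" and a: "a \<in> vgr V d" and b: "b \<in> vgr V e"
  shows "rmode a (d + e - 2 - k) (phi u) b = lmode b k (phi u) a"
proof -
  have l: "lin (phi u)" by (rule lin_phi[OF u])
  let ?k = "d + e - 2 - k"
  have "\<forall>\<^sub>F M in sequentially. (\<forall>x. lmode b k (phi u) x = phi u (smode b (xp k * (1 - cutoff M)) x))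
     \<and> d + int n \<le> ?k + int M \<and> ?k - int M \<le> d - int n - 2"
    by (intro eventually_conj ev_le1 ev_le2 good_lmode_ev good_phi u)
  from ev_ex[OF this] obtain M where M: "\<And>x. lmode b k (phi u) x = phi u (smode b (xp k * (1 - cutoff M)) x)"
    "d + int n \<le> ?k + int M" "?k - int M \<le> d - int n - 2" by blast
  define c where "c i = (of_nat (M choose i) * (-1)^i :: 'k)" for i
  have bin: "(1 - w) ^ M = (\<Sum>i\<le>M. fls_const (c i) * w ^ i)" for w :: "'k fls"
  proof -
    have "(1 - w) ^ M = (- w + 1) ^ M" by simp
    also have "\<dots> = (\<Sum>i\<le>M. of_nat (M choose i) * (- w) ^ i * 1 ^ (M - i))" by (rule binomial_ring)
    also have "\<dots> = (\<Sum>i\<le>M. fls_const (c i) * w ^ i)"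
    proof (intro sum.cong refl)
      fix i
      have "fls_const (c i) = of_nat (M choose i) * (-1) ^ i"
        by (simp add: c_def fls_const_mult_const[symmetric] fls_const_power fls_of_nat[symmetric] del: fls_const_mult_const)
      then show "of_nat (M choose i) * (- w) ^ i * 1 ^ (M - i) = fls_const (c i) * w ^ i"
        using power_minus[of w i] by (simp add: mult.assoc)
    qed
    finally show ?thesis .
  qed
  \<comment> \<open>Under x \<mapsto> 1/x the variable z = x - 1 becomes -z/x, so -1/z becomes x/z.
    Thus \<open>y'\<close> is the image of \<open>y\<close>, and \<open>h\<close> is the image of
    the test series of \<open>lmode b k\<close>, up to the power of x dictated by the
    degrees.\<close>
  define y where "y = (- zp (-1) :: 'k fls)"
  define y' where "y' = (xp 1 * zp (-1) :: 'k fls)"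
  define h where "h = xp ?k * (1 - y' ^ M) ^ M"
  have mono: "phi u (smode b (xp k * y ^ m) a) = - phi u (smode a (xp ?k * y' ^ m) b)" for m
  proof -
    have 1: "y ^ m = fls_const ((-1)^m) * zp (- int m)"
      unfolding y_def power_minus[of "zp (-1)"] zp_power by (simp add: fls_const_power)
    have x: "xp (int m) = (xp 1 :: 'k fls) ^ m"
      by (induction m) (simp_all add: xp_add)
    have 2: "xp ?k * y' ^ m = zp (- int m) * xp (d + e - (- int m) - 2 - k)"
    proof -
      have "xp (d + e - (- int m) - 2 - k) = xp ?k * (xp (int m) :: 'k fls)"
        by (simp add: xp_add[symmetric] algebra_simps)
      then show ?thesis unfolding y'_def power_mult_distrib zp_power x by (simp add: mult_ac)
    qed
    have s: "(-1 :: 'k)^m * of_int (sgnpow (- int m)) = 1" by (simp add: sgnpow_def)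
    have "phi u (smode b (xp k * y ^ m) a) = usc U ((-1)^m) (phi u (smode b (xp k * zp (- int m)) a))"
      unfolding 1 mult.left_commute[of "xp k" "fls_const _"] smode_const_mult lin_scale[OF l] ..
    also have "\<dots> = - phi u (smode a (xp ?k * y' ^ m) b)"
      unfolding rho_skew[OF u a b] 2 us.scale_minus_right us.scale_scale s by simp
    finally show ?thesis .
  qed
  have "lmode b k (phi u) a = phi u (smode b (xp k * (1 - y ^ M) ^ M) a)"
    unfolding M(1) cutoff_def y_def by simp
  also have "\<dots> = (\<Sum>i\<le>M. usc U (c i) (phi u (smode b (xp k * y ^ (M * i)) a)))"
    unfolding bin sum_distrib_left power_mult[symmetric] mult.left_commute[of "xp k"] by (rule phi_smode_sum[OF l])
  also have "\<dots> = - (\<Sum>i\<le>M. usc U (c i) (phi u (smode a (xp ?k * y' ^ (M * i)) b)))"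
    unfolding mono by (simp add: sum_negf us.scale_minus_right)
  also have "\<dots> = - phi u (smode a h b)"
    unfolding h_def bin sum_distrib_left power_mult[symmetric] mult.left_commute[of "xp ?k"] phi_smode_sum[OF l] ..
  \<comment> \<open>At x = 0, where \<open>y'\<close> vanishes, \<open>h\<close> agrees with its
    power of x to high order; at infinity \<open>y'\<close> tends to 1 and \<open>h\<close> is
    small.\<close>
  also have "phi u (smode a h b) = - (\<Sum>k\<in>{?k}. usc U 1 (rmode a k (phi u) b))"
  proof (rule rmode_gen[OF l kill_phi[OF u a]])
    have y1: "1 - y' = - zp (-1)"
    proof -
      have "y' = zp (-1) + zp 1 * zp (-1)" by (simp add: y'_def xp_eq distrib_right)
      then show ?thesis by (simp add: zp_add[symmetric])
    qed
    have iy: "ideg 0 y'" unfolding y'_def using ideg_mult[OF ideg_xp[of 1] ideg_zp[of "-1"]] by simp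
    have "ideg (- 1 + 0) ((1 - y') * (\<Sum>i<M. y' ^ i))"
      unfolding y1 by (intro ideg_mult ideg_uminus ideg_zp ideg_sum) (use ideg_power[OF iy] in simp)
    then have "ideg (- 1) (1 - y' ^ M)" by (simp add: one_diff_power_eq)
    from ideg_mult[OF ideg_xp[of ?k] ideg_power[OF this, of M]]
    have "ideg (?k - int M) h" by (simp add: h_def)
    then show "ideg (d - int n - 2) h" by (rule ideg_mono) (rule M(3))
    have zy: "zord 1 y'" unfolding y'_def using zord_mult[OF zord_xp[of 1] zord_zp[of "-1"]] by simp
    have zv: "zord (int M) (y' ^ M)" using zord_power[OF zy, of M] by simp
    have z0: "zord 0 (1 - y' ^ M)" by (intro zord_diff zord_one zord_mono[OF zv]) simp
    have "zord (int M + 0) (y' ^ M * (\<Sum>i<M. (1 - y' ^ M) ^ i))"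
      by (intro zord_mult zv zord_sum) (use zord_power[OF z0] in simp)
    moreover have "1 - (1 - y' ^ M) ^ M = y' ^ M * (\<Sum>i<M. (1 - y' ^ M) ^ i)"
      using one_diff_power_eq[of "1 - y' ^ M" M] by simp
    ultimately have "zord (int M) (1 - (1 - y' ^ M) ^ M)" by simp
    from zord_uminus[OF zord_mult[OF zord_xp[of ?k] this]]
    have "zord (?k + int M) (h - xp ?k)" by (simp add: h_def right_diff_distrib)
    then have "zord (d + int n) (h - xp ?k)" by (rule zord_mono) (rule M(2))
    then show "zord (d + int n) (h - (\<Sum>k\<in>{?k}. fls_const 1 * xp k))" by simp
  qed simp
  finally show ?thesis by simp
qed

lemma lin_eqI_homog:
  assumes "lin \<phi>" "lin \<psi>" "\<And>e b. b \<in> vgr V e \<Longrightarrow> \<phi> b = \<psi> b"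
  shows "\<phi> = \<psi>"
proof
  fix b show "\<phi> b = \<psi> b"
    by (induction b rule: V_induct) (simp_all add: assms(3) lin_add[OF assms(1)] lin_add[OF assms(2)])
qed

text \<open>By the symmetry the value at b is the zero mode of b at infinity evaluated at
  \<open>a\<close>, which is o(b) o(a) u.\<close>

lemma rmode_phi_zero_mode:
  assumes u: "u \<in> Uc" and a: "a \<in> vgr V d"
  shows "rmode a (d - 1) (phi u) = phi (\<rho> a u)"
proof (rule lin_eqI_homog)
  show "lin (rmode a (d - 1) (phi u))" by (intro good_lin good_rmode good_phi u)
  show "lin (phi (\<rho> a u))" by (intro lin_phi rho_closed u)
  fix e b assume b: "b \<in> vgr V e"
  show "rmode a (d - 1) (phi u) b = phi (\<rho> a u) b"
    using rmode_phi_eq_lmode_phi[OF u a b, of "e - 1"] lmode_star[OF u b, of a] by (simp add: phi_def)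
qed

lemma rmode_phi_high:
  assumes "u \<in> Uc" "a \<in> vgr V d" "d + int n \<le> k"
  shows "rmode a k (phi u) = 0"
  using rmode_eq_0[OF lin_phi kill_phi, of u a d k] assms by (simp add: zero_fun_def)

lemma lmode_vac:
  assumes "good \<phi>"
  shows "lmode vac k \<phi> b = (if k = -1 then \<phi> b else 0)"
  using lmode_minus_rmode[OF good_lin[OF assms], of vac k b] rmode_vac[OF assms, of k]
  by (simp add: smode_vac xp_nth_neg lin_0[OF good_lin[OF assms]] split: if_splits)

lemma phi_vac: "u \<in> Uc \<Longrightarrow> phi u vac = u" by (simp add: phi_def rho_vac)

text \<open>The symmetry with the vacuum as second element. Evaluation at the vacuum thus picks out
  the part of degree n.\<close>

lemma rmode_phi_vac:
  assumes u: "u \<in> Uc" and a: "a \<in> vgr V d"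
  shows "rmode a k (phi u) vac = (if k = d - 1 then \<rho> a u else 0)"
  using rmode_phi_eq_lmode_phi[OF u a vac_gr, of "d - 2 - k"] lmode_vac[OF good_phi[OF u], of "d - 2 - k" a]
  by (simp add: phi_def)

end

section \<open>The module generated by U\<close>

lemma (in vector_space) direct_sum_decomp:
  fixes gr :: "nat \<Rightarrow> 'b set"
  assumes sub: "\<And>k. subspace (gr k)"
    and indep: "\<And>f. (\<And>k. f k \<in> gr k) \<Longrightarrow> finite {k. f k \<noteq> 0} \<Longrightarrow> sum f {k. f k \<noteq> 0} = 0 \<Longrightarrow> f = (\<lambda>k. 0)"
    and x: "x \<in> span (\<Union>k. gr k)"
  shows "\<exists>!f. (\<forall>k. f k \<in> gr k) \<and> finite {k. f k \<noteq> 0} \<and> x = sum f {k. f k \<noteq> 0}"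
proof -
  let ?P = "\<lambda>x f. (\<forall>k. f k \<in> gr k) \<and> finite {k. f k \<noteq> 0} \<and> x = sum f {k. f k \<noteq> 0}"
  have P_add: "?P (x + s y) (\<lambda>k. f k + s (g k))"
    if f: "?P x f" and g: "?P y g" and s: "\<And>k z. z \<in> gr k \<Longrightarrow> s z \<in> gr k" "\<And>y z. s (y + z) = s y + s z" "s 0 = 0"
    for x y f g and s :: "'b \<Rightarrow> 'b"
  proof (intro conjI allI)
    let ?S = "{k. f k \<noteq> 0} \<union> {k. g k \<noteq> 0}"
    have fin: "finite ?S" using f g by simp
    have sub': "{k. f k + s (g k) \<noteq> 0} \<subseteq> ?S" using s(3) by auto
    show "f k + s (g k) \<in> gr k" for k using f g s(1) by (simp add: subspace_add[OF sub])
    show "finite {k. f k + s (g k) \<noteq> 0}" by (rule finite_subset[OF sub' fin])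
    have ss: "s (sum h A) = (\<Sum>k\<in>A. s (h k))" for h :: "nat \<Rightarrow> 'b" and A
      by (induction A rule: infinite_finite_induct) (simp_all add: s)
    have "sum f {k. f k \<noteq> 0} = sum f ?S" "sum g {k. g k \<noteq> 0} = sum g ?S"
      by (rule sum.mono_neutral_left[OF fin]; auto)+
    moreover have "x = sum f {k. f k \<noteq> 0}" "y = sum g {k. g k \<noteq> 0}" using f g by blast+
    ultimately have xy: "x = sum f ?S" "y = sum g ?S" by (simp_all only:)
    have "x + s y = sum f ?S + (\<Sum>k\<in>?S. s (g k))" by (simp only: xy ss)
    also have "\<dots> = (\<Sum>k\<in>?S. f k + s (g k))" by (rule sum.distrib[symmetric])
    also have "\<dots> = (\<Sum>k\<in>{k. f k + s (g k) \<noteq> 0}. f k + s (g k))"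
      by (rule sum.mono_neutral_right[OF fin sub']) auto
    finally show "x + s y = (\<Sum>k\<in>{k. f k + s (g k) \<noteq> 0}. f k + s (g k))" .
  qed
  have ex: "\<exists>f. ?P x f" using x
  proof (induction rule: span_induct_alt)
    case base
    show ?case by (rule exI[of _ "\<lambda>k. 0"]) (simp add: subspace_0[OF sub])
  next
    case (step c x y)
    then obtain k f where k: "x \<in> gr k" and f: "?P y f" by blast
    have "?P x (\<lambda>j. if j = k then x else 0)"
    proof (cases "x = 0")
      case True
      then show ?thesis by (simp add: subspace_0[OF sub])
    next
      case False
      then have e: "{j. (if j = k then x else 0) \<noteq> 0} = {k}" by auto
      show ?thesis unfolding e using k by (simp add: subspace_0[OF sub])
    qed
    from P_add[OF f this, of "scale c"]
    have "?P (y + scale c x) (\<lambda>j. f j + scale c (if j = k then x else 0))"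
      by (simp add: subspace_scale[OF sub] scale_right_distrib)
    then show ?case unfolding add.commute[of y] by (rule exI[where x = "\<lambda>j. f j + scale c (if j = k then x else 0)"])
  qed
  have "f = g" if f: "?P x f" and g: "?P x g" for f g
  proof -
    have d: "?P (x + - x) (\<lambda>k. f k + - g k)"
      by (rule P_add[OF f g]) (auto intro: subspace_neg[OF sub])
    then have "(\<lambda>k. f k + - g k) = (\<lambda>k. 0)" by (intro indep) simp_all
    then have "f k + - g k = 0" for k by (rule fun_cong)
    then show "f = g" by (intro ext) simp
  qed
  with ex show ?thesis by blast
qed

context amodl
begin

lemma rmode_0 [simp]: "rmode a k 0 = 0" by (simp add: rmode_def fun_eq_iff)

lemma phi_add: "x \<in> Uc \<Longrightarrow> y \<in> Uc \<Longrightarrow> phi (x + y) = phi x + phi y"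
  by (simp add: phi_def fun_eq_iff rho_add_right)
lemma phi_scale: "x \<in> Uc \<Longrightarrow> phi (usc U c x) = sc c (phi x)"
  by (simp add: phi_def fun_eq_iff rho_scale_right sc_def)
lemma phi_zero: "phi 0 = 0"
  using phi_scale[of 0 0] us.subspace_0[OF Uc_sub] by (simp add: sc_def fun_eq_iff)
lemma phi_eq_0: "u \<in> Uc \<Longrightarrow> phi u = 0 \<Longrightarrow> u = 0"
  using phi_vac[of u] by simp

lemma subspace_phi: "gm.vs.subspace (phi ` Uc)"
  unfolding gm.vs.subspace_def
proof (intro conjI ballI allI)
  show "0 \<in> phi ` Uc" using phi_zero us.subspace_0[OF Uc_sub] by (metis image_eqI)
  fix x y assume "x \<in> phi ` Uc" "y \<in> phi ` Uc"
  then show "x + y \<in> phi ` Uc" using phi_add us.subspace_add[OF Uc_sub] by (smt (verit) image_iff)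
next
  fix c x assume "x \<in> phi ` Uc"
  then show "sc c x \<in> phi ` Uc" using phi_scale us.subspace_scale[OF Uc_sub] by (smt (verit) image_iff)
qed

text \<open>Weak associativity evaluated at the vacuum is a unitriangular system of equations for the differences
  of the two sides.\<close>

lemma rmode_rmode_phi_vac:
  assumes u: "u \<in> Uc" and a: "a \<in> vgr V d" and b: "b \<in> vgr V e"
  shows "rmode b k (rmode a (d + e - 2 - k) (phi u)) vac = lmode b k (phi u) a"
proof -
  have g: "good (phi u)" by (rule good_phi[OF u])
  have l: "lin (phi u)" by (rule good_lin[OF g])
  have kb: "kill (phi u) b (e + int n) (e - int n - 2)" by (rule kill_phi[OF u b])
  define X where "X k = rmode b k (rmode a (d + e - 2 - k) (phi u)) vac" for k
  define L where "L k = lmode b k (phi u) a" for k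
  have low: "X k = 0 \<and> L k = 0" if k: "k \<le> e - int n - 2" for k
  proof -
    have "rmode a (d + e - 2 - k) (phi u) = 0" by (rule rmode_phi_high[OF u a]) (use k in simp)
    then have "X k = 0" using rmode_zero[of b k] by (simp add: X_def zero_fun_def)
    moreover have "L k = 0" using lmode_eq_0[OF l kb k] by (simp add: L_def)
    ultimately show ?thesis by simp
  qed
  let ?p = "e + int n"
  \<comment> \<open>Weak associativity for \<open>b\<close> and \<open>a\<close> with p = e + n and
    r = t - p. At the vacuum its left side is \<open>phi u\<close> of a residue, by
    \<open>rmode_phi_vac\<close>, and expanding z^r at infinity expresses this through the modes of
    \<open>b\<close> there.\<close>
  have rel: "(\<Sum>j<J. usc U (of_int ((-1)^j * ibinom (t - ?p) j)) (X (t - int j)))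
     = (\<Sum>j<J. usc U (of_int ((-1)^j * ibinom (t - ?p) j)) (L (t - int j)))"
    if J: "t - int J \<le> e - int n - 2" for t J
  proof -
    define r where "r = t - ?p"
    define q where "q = d + e - 2 - t"
    obtain K where K: "\<forall>l\<ge>K. Y b l a = 0" using Y_trunc by blast
    define N where "N = nat (K - r)"
    have N: "\<forall>i\<ge>N. Y b (r + int i) a = 0" using K by (auto simp: N_def)
    have q0: "\<forall>i\<ge>J. rmode a (q + int i) (phi u) = (\<lambda>b. 0)"
      using rmode_phi_high[OF u a] J by (auto simp: q_def zero_fun_def)
    have "(\<Sum>i<N. usc U (of_int (ibinom ?p i)) (rmode (Y b (r + int i) a) (?p + q - int i) (phi u) vac))
      = (\<Sum>i<J. usc U (of_int ((-1)^i * ibinom r i)) (rmode b (?p + r - int i) (rmode a (q + int i) (phi u)) vac))"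
      by (rule rmode_weak_assoc[OF g kb order_refl N q0])
    moreover have "rmode (Y b (r + int i) a) (?p + q - int i) (phi u) vac = phi u (Y b (r + int i) a)" for i
    proof -
      have "Y b (r + int i) a \<in> vgr V (e + d - (r + int i) - 1)" by (rule Y_gr[OF b a])
      from rmode_phi_vac[OF u this, of "?p + q - int i"] show ?thesis
        by (simp add: phi_def q_def r_def)
    qed
    moreover have "rmode b (?p + r - int i) (rmode a (q + int i) (phi u)) vac = X (t - int i)" for i
    proof -
      have 1: "?p + r - int i = t - int i" and 2: "q + int i = d + e - 2 - (t - int i)" by (simp_all add: r_def q_def)
      show ?thesis unfolding X_def 1 2 ..
    qed
    moreover have "(\<Sum>i<N. usc U (of_int (ibinom ?p i)) (phi u (Y b (r + int i) a))) = phi u (smode b (xp ?p * zp r) a)"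
    proof -
      have "smode b (xp ?p * zp r) a = (\<Sum>i<N. sV (of_int (ibinom ?p i)) (Y b (r + int i) a))"
        unfolding fsum_smode[symmetric] by (rule fsum_eq) (use N in simp)
      then show ?thesis by (simp add: lin_sum[OF l] lin_scale[OF l])
    qed
    moreover have "phi u (smode b (xp ?p * zp r) a) = (\<Sum>j<J. usc U (of_int ((-1)^j * ibinom r j)) (L (t - int j)))"
    proof -
      let ?k = "\<lambda>j. t - int j"
      have inj: "inj_on ?k {..<J}" by (auto simp: inj_on_def)
      have e: "xp ?p * zp r - (\<Sum>k\<in>?k ` {..<J}. fls_const (of_int ((-1)^nat (t - k) * ibinom r (nat (t - k)))) * xp k)
        = (zp r - (\<Sum>j<J. of_int ((-1)^j * ibinom r j) * xp (r - int j))) * (xp ?p :: 'k fls)"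
      proof -
        have x: "xp (t - int j) = xp (r - int j) * (xp ?p :: 'k fls)" for j
          using xp_add[of "r - int j" ?p, where ?'a = 'k] by (simp add: r_def)
        show ?thesis
          unfolding left_diff_distrib sum_distrib_right sum.reindex[OF inj] o_def x
          by (simp add: fls_of_int[symmetric] mult.assoc mult.commute[of "zp r"] del: of_int_mult of_int_power)
      qed
      have "phi u (smode b (xp ?p * zp r) a) = (\<Sum>k\<in>?k ` {..<J}. usc U (of_int ((-1)^nat (t - k) * ibinom r (nat (t - k)))) (lmode b k (phi u) a))"
      proof (rule lmode_gen[OF l kb])
        show "zord ?p (xp ?p * zp r :: 'k fls)" by (rule zord_mono[OF zord_mult[OF zord_xp zord_zp]]) simp
        show "ideg (e - int n - 2) (xp ?p * zp r - (\<Sum>k\<in>?k ` {..<J}. fls_const (of_int ((-1)^nat (t - k) * ibinom r (nat (t - k)))) * xp k) :: 'k fls)"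
          unfolding e by (rule ideg_mono[OF ideg_mult[OF zp_expand_inf ideg_xp]]) (use J in \<open>simp add: r_def\<close>)
      qed simp
      then show ?thesis
        unfolding sum.reindex[OF inj] o_def L_def by (simp del: of_int_mult of_int_power)
    qed
    ultimately show ?thesis by (simp add: r_def)
  qed
  have "\<forall>t. t \<le> e - int n - 2 + int m \<longrightarrow> X t = L t" for m
  proof (induction m)
    case 0 then show ?case using low by simp
  next
    case (Suc m)
    show ?case
    proof (intro allI impI)
      fix t assume t: "t \<le> e - int n - 2 + int (Suc m)"
      have IH: "X (t - int (Suc j)) = L (t - int (Suc j))" for j using Suc t by simp
      have "t - int (Suc m) \<le> e - int n - 2" using t by simp
      from rel[OF this] have "X t + (\<Sum>j<m. usc U (of_int ((-1)^Suc j * ibinom (t - ?p) (Suc j))) (X (t - int (Suc j))))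
         = L t + (\<Sum>j<m. usc U (of_int ((-1)^Suc j * ibinom (t - ?p) (Suc j))) (L (t - int (Suc j))))"
        unfolding sum.lessThan_Suc_shift by simp
      then show "X t = L t" unfolding IH by simp
    qed
  qed
  from this[of "nat (k - (e - int n - 2))"] have "X k = L k" by simp
  then show ?thesis by (simp add: X_def L_def)
qed

text \<open>The composite has degree 0, so weak associativity and \<open>rmode_phi_zero_mode\<close>
  put it into the image of \<open>phi\<close>. Elements of this image are determined by their value
  at the vacuum, which \<open>rmode_rmode_phi_vac\<close> computes.\<close>

lemma rmode_rmode_phi:
  assumes u: "u \<in> Uc" and a: "a \<in> vgr V d" and b: "b \<in> vgr V e" and k: "k' + k = d + e - 2"
  shows "rmode b k' (rmode a k (phi u)) = phi (rmode a k (phi u) b)"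
proof -
  have k1: "k = d + e - 2 - k'" using k by simp
  have "rmode b k' (rmode a k (phi u)) \<in> gm.vs.span {rmode (Y b j a) (k' + k - j) (phi u) | j. True}"
    by (rule gm.A_A_span) (simp add: good_phi u)
  also have "\<dots> \<subseteq> phi ` Uc"
  proof (rule gm.vs.span_minimal[OF _ subspace_phi], safe)
    fix j
    have m: "Y b j a \<in> vgr V (e + d - j - 1)" by (rule Y_gr[OF b a])
    have e: "k' + k - j = e + d - j - 1 - 1" using k by simp
    show "rmode (Y b j a) (k' + k - j) (phi u) \<in> phi ` Uc"
      unfolding e rmode_phi_zero_mode[OF u m] by (intro imageI rho_closed u)
  qed
  finally obtain u' where u': "u' \<in> Uc" "rmode b k' (rmode a k (phi u)) = phi u'" by blast
  have "u' = rmode b k' (rmode a k (phi u)) vac" using u' phi_vac by simp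
  also have "\<dots> = rmode a k (phi u) b"
    unfolding k1 rmode_rmode_phi_vac[OF u a b] rmode_phi_eq_lmode_phi[OF u a b] ..
  finally show ?thesis using u'(2) by simp
qed

text \<open>\<open>Lcar\<close> is the carrier of \<open>L_n(U)\<close> and \<open>Lgr m\<close> its component of degree \<open>m\<close>.\<close>

definition Lgr :: "int \<Rightarrow> ('v \<Rightarrow> 'u) set" where
  "Lgr m = gm.vs.span {rmode a k (phi u) | a k u d. u \<in> Uc \<and> a \<in> vgr V d \<and> int n + d - k - 1 = m}"

definition Lcar :: "('v \<Rightarrow> 'u) set" where
  "Lcar = gm.vs.span {rmode a k (phi u) | a k u. u \<in> Uc}"

lemma subspace_Lgr: "gm.vs.subspace (Lgr m)" unfolding Lgr_def by (rule gm.vs.subspace_span)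
lemma subspace_Lcar: "gm.vs.subspace Lcar" unfolding Lcar_def by (rule gm.vs.subspace_span)

lemma Lgr_gen: "u \<in> Uc \<Longrightarrow> a \<in> vgr V d \<Longrightarrow> int n + d - k - 1 = m \<Longrightarrow> rmode a k (phi u) \<in> Lgr m"
  unfolding Lgr_def by (rule gm.vs.span_base) blast

lemma Lcar_good: "\<chi> \<in> Lcar \<Longrightarrow> good \<chi>"
proof -
  have "Lcar \<subseteq> {\<phi>. good \<phi>}" unfolding Lcar_def
    by (rule gm.vs.span_minimal[OF _ gm.C_sub]) (use good_rmode good_phi in blast)
  then show "\<chi> \<in> Lcar \<Longrightarrow> good \<chi>" by blast
qed

lemma Lgr_Lcar: "Lgr m \<subseteq> Lcar"
  unfolding Lgr_def Lcar_def by (rule gm.vs.span_mono) blast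

lemma Lgr_good: "\<chi> \<in> Lgr m \<Longrightarrow> good \<chi>" using Lcar_good Lgr_Lcar by blast

lemma Lgr_induct [consumes 1, case_names zero gen]:
  assumes "\<chi> \<in> Lgr m"
    and "P 0"
    and "\<And>c a k u d y. u \<in> Uc \<Longrightarrow> a \<in> vgr V d \<Longrightarrow> int n + d - k - 1 = m \<Longrightarrow> good y \<Longrightarrow> P y
      \<Longrightarrow> P (sc c (rmode a k (phi u)) + y)"
  shows "P \<chi>"
proof -
  have "good \<chi> \<and> P \<chi>" using assms(1) unfolding Lgr_def
  proof (induction rule: gm.vs.span_induct_alt)
    case base show ?case using conjI[OF good_zero assms(2)] .
  next
    case (step c x y)
    then obtain a k u d where x: "x = rmode a k (phi u)" "u \<in> Uc" "a \<in> vgr V d" "int n + d - k - 1 = m" by blast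
    have "good (sc c x + y)" unfolding x(1) by (intro good_add good_sc good_rmode good_phi x) (use step in blast)
    moreover have "P (sc c x + y)" unfolding x(1) by (rule assms(3)[OF x(2-4)]) (use step in blast)+
    ultimately show ?case by (rule conjI)
  qed
  then show ?thesis ..
qed

lemma Lgr_rmode:
  assumes "\<chi> \<in> Lgr m" and c: "c \<in> vgr V e"
  shows "rmode c l \<chi> \<in> Lgr (m + e - l - 1)"
  using assms(1)
proof (induction rule: Lgr_induct)
  case zero
  have "rmode c l 0 \<in> Lgr (m + e - l - 1)" unfolding rmode_0 by (rule gm.vs.subspace_0[OF subspace_Lgr])
  then show ?case .
next
  case (gen k0 a k u d y)
  have "rmode c l (rmode a k (phi u)) \<in> gm.vs.span {rmode (Y c j a) (l + k - j) (phi u) | j. True}"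
    by (rule gm.A_A_span) (simp add: good_phi gen)
  also have "\<dots> \<subseteq> Lgr (m + e - l - 1)"
  proof (rule gm.vs.span_minimal[OF _ subspace_Lgr], safe)
    fix j
    show "rmode (Y c j a) (l + k - j) (phi u) \<in> Lgr (m + e - l - 1)"
      by (rule Lgr_gen[OF gen(1) Y_gr[OF c gen(2)]]) (use gen(3) in simp)
  qed
  finally have 1: "rmode c l (rmode a k (phi u)) \<in> Lgr (m + e - l - 1)" .
  have e: "rmode c l (sc k0 (rmode a k (phi u)) + y) = sc k0 (rmode c l (rmode a k (phi u))) + rmode c l y"
    using gen by (simp add: rmode_add_right rmode_sc good_sc good_rmode good_phi)
  have "rmode c l (sc k0 (rmode a k (phi u)) + y) \<in> Lgr (m + e - l - 1)"
    unfolding e by (rule gm.vs.subspace_add[OF subspace_Lgr gm.vs.subspace_scale[OF subspace_Lgr 1] gen(5)])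
  then show ?case .
qed

lemma Lgr_neg: "\<chi> \<in> Lgr m \<Longrightarrow> m < 0 \<Longrightarrow> \<chi> = 0"
proof (induction rule: Lgr_induct)
  case (gen c a k u d y)
  then have "rmode a k (phi u) = 0" by (intro rmode_phi_high) auto
  moreover have "y = 0" using gen by blast
  ultimately have "sc c (rmode a k (phi u)) + y = 0" by (simp add: sc_def fun_eq_iff)
  then show ?case .
next
  case zero
  have "(0 :: 'v \<Rightarrow> 'u) = 0" ..
  then show ?case .
qed

lemma Lgr_n: "Lgr (int n) = phi ` Uc"
proof
  show "Lgr (int n) \<subseteq> phi ` Uc" unfolding Lgr_def
  proof (rule gm.vs.span_minimal[OF _ subspace_phi], safe)
    fix a k u d assume "u \<in> Uc" "a \<in> vgr V d" "int n + d - k - 1 = int n"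
    moreover from this have "k = d - 1" by simp
    ultimately show "rmode a k (phi u) \<in> phi ` Uc" using rmode_phi_zero_mode rho_closed by auto
  qed
  show "phi ` Uc \<subseteq> Lgr (int n)"
  proof safe
    fix u assume u: "u \<in> Uc"
    have "rmode vac (-1) (phi u) \<in> Lgr (int n)" by (rule Lgr_gen[OF u vac_gr]) simp
    then show "phi u \<in> Lgr (int n)" by (simp add: rmode_vac good_phi u)
  qed
qed

text \<open>The mode of \<open>b\<close> has degree n - m and so leads to degree n, a copy of U. On
  generators this is \<open>rmode_rmode_phi\<close>, and both sides are linear.\<close>

lemma Lgr_key:
  assumes "\<chi> \<in> Lgr m" and b: "b \<in> vgr V e"
  shows "rmode b (e - 1 - int n + m) \<chi> = phi (\<chi> b)"
  using assms(1)
proof (induction rule: Lgr_induct)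
  case zero
  have "rmode b (e - 1 - int n + m) 0 = phi ((0 :: 'v \<Rightarrow> 'u) b)" by (simp add: phi_zero)
  then show ?case .
next
  case (gen c a k u d y)
  let ?x = "rmode a k (phi u)"
  have x: "good ?x" by (intro good_rmode good_phi gen)
  have U: "?x b \<in> Uc" "y b \<in> Uc" using lin_Uc good_lin x gen(4) by blast+
  have "rmode b (e - 1 - int n + m) ?x = phi (?x b)"
    by (rule rmode_rmode_phi[OF gen(1,2) b]) (use gen(3) in simp)
  then have "rmode b (e - 1 - int n + m) (sc c ?x + y) = sc c (phi (?x b)) + phi (y b)"
    using gen x by (simp add: rmode_add_right rmode_sc good_sc)
  also have "\<dots> = phi ((sc c ?x + y) b)"
    using U by (simp add: phi_add phi_scale us.subspace_scale[OF Uc_sub] sc_apply)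
  finally show ?case .
qed

text \<open>A mode of any other degree misses degree n, and elements of other degrees vanish at the
  vacuum by \<open>rmode_phi_vac\<close>.\<close>

lemma Lgr_other:
  assumes "\<chi> \<in> Lgr m" and b: "b \<in> vgr V e" and k': "k' \<noteq> e - 1 - int n + m"
  shows "rmode b k' \<chi> vac = 0"
  using assms(1)
proof (induction rule: Lgr_induct)
  case zero
  have "rmode b k' 0 vac = 0" by simp
  then show ?case .
next
  case (gen c a k u d y)
  let ?x = "rmode a k (phi u)"
  have x: "good ?x" by (intro good_rmode good_phi gen)
  have "rmode b k' ?x \<in> gm.vs.span {rmode (Y b j a) (k' + k - j) (phi u) | j. True}"
    by (rule gm.A_A_span) (simp add: good_phi gen)
  also have "\<dots> \<subseteq> {\<psi>. \<psi> vac = 0}"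
  proof (rule gm.vs.span_minimal, safe)
    fix j
    have "Y b j a \<in> vgr V (e + d - j - 1)" by (rule Y_gr[OF b gen(2)])
    from rmode_phi_vac[OF gen(1) this, of "k' + k - j"] show "rmode (Y b j a) (k' + k - j) (phi u) vac = 0"
      using k' gen(3) by auto
  qed (auto simp: gm.vs.subspace_def sc_apply)
  finally have "rmode b k' ?x vac = 0" by simp
  moreover have "rmode b k' (sc c ?x + y) = sc c (rmode b k' ?x) + rmode b k' y"
    using gen x by (simp add: rmode_add_right rmode_sc good_sc)
  moreover have "rmode b k' y vac = 0" by (rule gen)
  ultimately have "rmode b k' (sc c ?x + y) vac = 0" by (simp add: sc_apply)
  then show ?case .
qed

lemma Lcar_rmode:
  assumes "\<chi> \<in> Lcar"
  shows "rmode c l \<chi> \<in> Lcar"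
proof -
  have "good \<chi> \<and> rmode c l \<chi> \<in> Lcar" using assms unfolding Lcar_def
  proof (induction rule: gm.vs.span_induct_alt)
    case base
    have "good 0 \<and> rmode c l 0 \<in> gm.vs.span {rmode a k (phi u) | a k u. u \<in> Uc}"
      using gm.vs.span_zero good_zero by simp
    then show ?case .
  next
    case (step k0 x y)
    then obtain a k u where x: "x = rmode a k (phi u)" and u: "u \<in> Uc" by blast
    have gx: "good x" unfolding x by (intro good_rmode good_phi u)
    have "rmode c l x \<in> gm.vs.span {rmode (Y c j a) (l + k - j) (phi u) | j. True}"
      unfolding x by (rule gm.A_A_span) (simp add: good_phi u)
    also have "\<dots> \<subseteq> gm.vs.span {rmode a k (phi u) | a k u. u \<in> Uc}"
      by (rule gm.vs.span_mono) (use u in blast)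
    finally have 1: "rmode c l x \<in> gm.vs.span {rmode a k (phi u) | a k u. u \<in> Uc}" .
    have y: "good y" "rmode c l y \<in> gm.vs.span {rmode a k (phi u) | a k u. u \<in> Uc}" using step by blast+
    have e: "rmode c l (sc k0 x + y) = sc k0 (rmode c l x) + rmode c l y"
      using y gx by (simp add: rmode_add_right rmode_sc good_sc)
    have "good (sc k0 x + y) \<and> rmode c l (sc k0 x + y) \<in> gm.vs.span {rmode a k (phi u) | a k u. u \<in> Uc}"
      unfolding e by (intro conjI good_add good_sc gx y gm.vs.span_add gm.vs.span_scale 1)
    then show ?case .
  qed
  then show ?thesis ..
qed

lemma Lcar_span: "Lcar = gm.vs.span (\<Union>m::nat. Lgr (int m))"
proof
  have "rmode a k (phi u) \<in> gm.vs.span (\<Union>m::nat. Lgr (int m))" if u: "u \<in> Uc" for a k u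
  proof (induction a rule: V_induct)
    case (homog d a)
    have x: "rmode a k (phi u) \<in> Lgr (int n + d - k - 1)" by (rule Lgr_gen[OF u homog]) simp
    show ?case
    proof (cases "int n + d - k - 1 < 0")
      case True
      then have "rmode a k (phi u) = 0" by (rule Lgr_neg[OF x])
      then show ?thesis using gm.vs.span_zero by metis
    next
      case False
      then have "rmode a k (phi u) \<in> Lgr (int (nat (int n + d - k - 1)))" using x by simp
      then show ?thesis by (intro gm.vs.span_base) blast
    qed
  next
    case (add a a')
    have e: "rmode (a + a') k (phi u) = rmode a k (phi u) + rmode a' k (phi u)"
      by (rule rmode_add_left[OF good_phi[OF u]])
    show ?case unfolding e by (rule gm.vs.span_add[OF add(3,4)])
  qed
  then show "Lcar \<subseteq> gm.vs.span (\<Union>m::nat. Lgr (int m))"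
    unfolding Lcar_def by (intro gm.vs.span_minimal gm.vs.subspace_span) blast
  show "gm.vs.span (\<Union>m::nat. Lgr (int m)) \<subseteq> Lcar"
    by (rule gm.vs.span_minimal[OF _ subspace_Lcar]) (use Lgr_Lcar in blast)
qed

lemma good_nonzero_homog:
  assumes "good \<chi>" "\<chi> \<noteq> 0"
  obtains e b where "b \<in> vgr V e" "\<chi> b \<noteq> 0"
proof -
  have "\<exists>e b. b \<in> vgr V e \<and> \<chi> b \<noteq> 0"
  proof (rule ccontr)
    assume "\<not> ?thesis"
    then have "\<chi> = 0"
      using lin_eqI_homog[OF good_lin[OF assms(1)] good_lin[OF good_zero]] by auto
    with assms show False by simp
  qed
  with that show ?thesis by blast
qed

lemma Lgr_indep:
  fixes f :: "nat \<Rightarrow> 'v \<Rightarrow> 'u"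
  assumes f: "\<And>k. f k \<in> Lgr (int k)" and fin: "finite {k. f k \<noteq> 0}" and s: "sum f {k. f k \<noteq> 0} = 0"
  shows "f = (\<lambda>k. 0)"
proof (rule ccontr)
  assume "f \<noteq> (\<lambda>k. 0)"
  then obtain m where m: "f m \<noteq> 0" by auto
  then obtain e b where b: "b \<in> vgr V e" "f m b \<noteq> 0"
    by (rule good_nonzero_homog[OF Lgr_good[OF f]]) (rule that)
  \<comment> \<open>This mode of \<open>b\<close> has degree n - m. Applied to the sum and evaluated
    at the vacuum, it isolates the value of \<open>f m\<close> at \<open>b\<close>.\<close>
  let ?k = "e - 1 - int n + int m"
  have "0 = rmode b ?k (sum f {k. f k \<noteq> 0}) vac" using s rmode_zero[of b ?k] by (simp add: zero_fun_def)
  also have "\<dots> = (\<Sum>j\<in>{k. f k \<noteq> 0}. rmode b ?k (f j) vac)"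
    using gm.A_sum_right[of "{k. f k \<noteq> 0}" f b ?k] Lgr_good[OF f] by (simp add: fun_sum_apply)
  also have "\<dots> = (\<Sum>j\<in>{k. f k \<noteq> 0}. if j = m then f m b else 0)"
  proof (intro sum.cong refl)
    fix j
    show "rmode b ?k (f j) vac = (if j = m then f m b else 0)"
    proof (cases "j = m")
      case True
      then show ?thesis
        using Lgr_key[OF f b(1), of m] phi_vac lin_Uc[OF good_lin[OF Lgr_good[OF f]]] by simp
    next
      case False
      then show ?thesis using Lgr_other[OF f b(1), of ?k j] by simp
    qed
  qed
  also have "\<dots> = f m b" using fin m by simp
  finally show False using b(2) by simp
qed

definition LM :: "('k, 'v, 'v \<Rightarrow> 'u) vmod" where
  "LM = \<lparr>mcar = Lcar, msc = sc, mY = rmode, mgr = (\<lambda>m. Lgr (int m))\<rparr>"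

lemma LM_simps [simp]: "mcar LM = Lcar" "msc LM = sc" "mY LM = rmode" "mgr LM m = Lgr (int m)"
  by (simp_all add: LM_def)

lemma is_vmod_LM: "is_vmod V LM"
  unfolding is_vmod_def LM_simps
proof (intro conjI allI ballI impI)
  show "vector_space sc" by (rule vector_space_sc)
  show "gm.vs.subspace Lcar" by (rule subspace_Lcar)
  show "borcherds Y Lcar sc rmode" using rmode_borcherds Lcar_good unfolding borcherds_def by blast
  show "\<exists>!f. (\<forall>m. f m \<in> Lgr (int m)) \<and> finite {m. f m \<noteq> 0} \<and> x = sum f {m. f m \<noteq> 0}" if "x \<in> Lcar" for x
    using gm.vs.direct_sum_decomp[of "\<lambda>m. Lgr (int m)" x, OF subspace_Lgr Lgr_indep] that Lcar_span by blast
  show "linon Lcar sc sc (rmode v k)" for v k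
    using Lcar_good by (simp add: linon_def rmode_add_right rmode_sc)
  show "linon UNIV sV sc (\<lambda>v. rmode v k w)" if "w \<in> Lcar" for k w
    using Lcar_good[OF that] by (simp add: linon_def rmode_add_left rmode_scale_left)
  fix v s k m w assume v: "v \<in> vgr V s" and w: "w \<in> Lgr (int m)"
  show "if 0 \<le> int m + s - k - 1 then rmode v k w \<in> Lgr (int (nat (int m + s - k - 1))) else rmode v k w = 0"
    using Lgr_rmode[OF w v, of k] Lgr_neg by auto
qed (use Lcar_rmode Lcar_good rmode_trunc rmode_vac subspace_Lgr Lgr_Lcar in auto)

lemma zmode_phi:
  assumes u: "u \<in> Uc"
  shows "gm.zmode a (phi u) = phi (\<rho> a u)"
proof (induction a rule: V_induct)
  case (homog d a)
  then show ?case using gm.zmode_homog[of "phi u" a d] rmode_phi_zero_mode[OF u] good_phi[OF u] by simp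
next
  case (add a b)
  then show ?case using good_phi[OF u] by (simp add: gm.zmode_add rho_add_left u phi_add rho_closed)
qed

lemma oact_LM: "oact V LM a w = gm.zmode a w"
  by (simp add: oact_def gm.zmode_def)

text \<open>Evaluation at the vacuum inverts \<open>phi\<close> because o(1) is the
  identity.\<close>

lemma Mpiece_LM_iso: "amod_iso (Mpiece V LM n) U"
  unfolding amod_iso_def
proof (intro exI[of _ "\<lambda>\<chi>. \<chi> vac"] conjI)
  show "bij_betw (\<lambda>\<chi>. \<chi> vac) (ucar (Mpiece V LM n)) (ucar U)"
    by (rule bij_betwI[where g = phi]) (auto simp: Mpiece_def Lgr_n phi_vac)
qed (auto simp: Mpiece_def linon_def sc_apply oact_LM Lgr_n zmode_phi phi_vac rho_closed)

end

section \<open>Irreducibility of L_n(U) and its component of degree 0\<close>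

locale simple_amodl = amodl +
  assumes simple: "simple_amod V n U"
begin

lemma irreducible_LM: "irreducible_vmod V LM"
  unfolding irreducible_vmod_def LM_simps
proof (intro conjI allI impI)
  have "Uc \<noteq> {0}" using simple by (simp add: simple_amod_def)
  then obtain u where u: "u \<in> Uc" "u \<noteq> 0" using us.subspace_0[OF Uc_sub] by blast
  have "phi u \<in> Lcar" using Lgr_n Lgr_Lcar u(1) by blast
  moreover have "phi u \<noteq> 0" using phi_eq_0 u by blast
  ultimately show "Lcar \<noteq> {0}" by blast
next
  fix W assume W: "gm.vs.subspace W \<and> W \<subseteq> Lcar \<and> (\<forall>v k. \<forall>w\<in>W. rmode v k w \<in> W) \<and> (\<forall>x\<in>W. \<forall>m. mcomp LM x m \<in> W)"
  interpret gL: graded_space sc "\<lambda>m. Lgr (int m)" Lcar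
    using is_vmod_LM unfolding is_vmod_def LM_simps
    by unfold_locales (auto simp: subspace_Lgr subspace_Lcar Lgr_Lcar)
  show "W = {0} \<or> W = Lcar"
  proof (cases "W = {0}")
    case False
    then obtain x where x: "x \<in> W" "x \<noteq> 0" using W gm.vs.subspace_0 by blast
    have xL: "x \<in> Lcar" using x W by blast
    have mc: "mcomp LM x = gcomp (\<lambda>m. Lgr (int m)) x" by (simp add: mcomp_eq_gcomp LM_def)
    have "\<exists>m. mcomp LM x m \<noteq> 0"
      using gL.gcomp_sum[OF xL] x(2) unfolding mc by (metis (mono_tags, lifting) empty_Collect_eq sum.empty)
    then obtain m where m: "mcomp LM x m \<noteq> 0" by blast
    let ?y = "mcomp LM x m"
    have y: "?y \<in> Lgr (int m)" "?y \<in> W" using gL.gcomp_in[OF xL] W x mc by auto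
    obtain e b where b: "b \<in> vgr V e" "?y b \<noteq> 0"
      by (rule good_nonzero_homog[OF Lgr_good[OF y(1)] m]) (rule that)
    have "phi (?y b) \<in> W" using Lgr_key[OF y(1) b(1)] W y(2) by metis
    \<comment> \<open>The trace of \<open>W\<close> in degree n. It contains the nonzero vector
      \<open>?y b\<close> and is stable under all o(a), so by simplicity it is all of U, and U
      generates the module.\<close>
    define U' where "U' = {u \<in> Uc. phi u \<in> W}"
    have Wsub: "gm.vs.subspace W" using W by blast
    have "us.subspace U'"
      unfolding us.subspace_def U'_def
      using us.subspace_0[OF Uc_sub] us.subspace_add[OF Uc_sub] us.subspace_scale[OF Uc_sub]
        gm.vs.subspace_0[OF Wsub] gm.vs.subspace_add[OF Wsub] gm.vs.subspace_scale[OF Wsub]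
      by (auto simp: phi_zero phi_add phi_scale)
    moreover have "U' \<subseteq> Uc" by (auto simp: U'_def)
    moreover have "\<rho> a u \<in> U'" if "u \<in> U'" for a u
    proof -
      have u: "u \<in> Uc" "phi u \<in> W" using that by (auto simp: U'_def)
      have "phi (\<rho> a u) = gm.zmode a (phi u)" using zmode_phi[OF u(1)] by simp
      also have "\<dots> \<in> W" unfolding gm.zmode_def
        by (intro gm.vs.subspace_sum Wsub) (use W u in blast)
      finally show ?thesis using rho_closed[OF u(1)] by (simp add: U'_def)
    qed
    ultimately have "U' = {0} \<or> U' = Uc" using simple unfolding simple_amod_def by blast
    moreover have "?y b \<in> U'"
      using \<open>phi (?y b) \<in> W\<close> lin_Uc[OF good_lin[OF Lgr_good[OF y(1)]]] by (simp add: U'_def)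
    ultimately have "U' = Uc" using b(2) by blast
    then have "phi u \<in> W" if "u \<in> Uc" for u using that unfolding U'_def by blast
    then have "rmode a k (phi u) \<in> W" if "u \<in> Uc" for a k u using W that by blast
    then have "Lcar \<subseteq> W" unfolding Lcar_def by (intro gm.vs.span_minimal Wsub) blast
    then show ?thesis using W by blast
  qed simp
qed

lemma LM_0_nonzero:
  assumes nf: "\<not> factors_prev V n U"
  shows "Lgr 0 \<noteq> {0}"
proof
  assume L0: "Lgr 0 = {0}"
  have "Uc \<noteq> {0}" using simple by (simp add: simple_amod_def)
  show False
  proof (cases "n = 0")
    case True
    then have "phi ` Uc = {0}" using Lgr_n L0 by simp
    then have "u = 0" if "u \<in> Uc" for u using phi_eq_0[OF that] that by blast
    with \<open>Uc \<noteq> {0}\<close> show False using us.subspace_0[OF Uc_sub] by blast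
  next
    case False
    have "\<rho> x u = 0" if x: "x \<in> Oset V (n - 1)" and u: "u \<in> Uc" for x u
    proof -
      have "gm.low (n - 1) (phi u)"
        unfolding gm.low_def
      proof (intro conjI allI ballI impI)
        show "phi u \<in> {\<phi>. good \<phi>}" by (simp add: good_phi u)
        fix d a k assume a: "a \<in> vgr V d" and k: "d + int (n - 1) \<le> k"
        show "rmode a k (phi u) = 0"
        proof (cases "d + int n \<le> k")
          case True then show ?thesis by (rule rmode_phi_high[OF u a])
        next
          case F: False
          \<comment> \<open>Only k = d + n - 1 is left, since n > 0 and k lies between d + n - 1 and
            d + n. Such modes send \<open>phi u\<close> to degree 0, assumed zero here; so
            \<open>phi u\<close> is low of order n - 1 and O_{n-1}(V) kills it.\<close>
          then have "int n + d - k - 1 = 0" using k False by auto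
          from Lgr_gen[OF u a this] L0 show ?thesis by blast
        qed
      qed
      from gm.zmode_Oset[OF this x] have "phi (\<rho> x u) = 0" using zmode_phi[OF u] by simp
      then show ?thesis using phi_eq_0 rho_closed[OF u] by blast
    qed
    with nf False show False by (simp add: factors_prev_def)
  qed
qed

end

section \<open>Graded modules\<close>

locale vmodl = voa V for V :: "('k::field, 'v::ab_group_add) voa" +
  fixes M :: "('k, 'v, 'm::ab_group_add) vmod"
  assumes vmod: "is_vmod V M"
begin

sublocale wmod V "msc M" "mcar M" "mY M"
proof -
  interpret u: vector_space "msc M" using vmod by (simp add: is_vmod_def)
  show "wmod V (msc M) (mcar M) (mY M)"
    using vmod by unfold_locales (auto simp: is_vmod_def linon_def)
qed

sublocale gd: graded_space "msc M" "mgr M" "mcar M"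
  using vmod by unfold_locales (auto simp: is_vmod_def)

lemma mcomp_gcomp: "mcomp M = gcomp (mgr M)" by (rule mcomp_eq_gcomp)

lemma mgr_A:
  assumes "v \<in> vgr V d" "w \<in> mgr M m"
  shows "0 \<le> int m + d - k - 1 \<Longrightarrow> mY M v k w \<in> mgr M (nat (int m + d - k - 1))"
    and "int m + d - k - 1 < 0 \<Longrightarrow> mY M v k w = 0"
proof -
  have "if 0 \<le> int m + d - k - 1 then mY M v k w \<in> mgr M (nat (int m + d - k - 1)) else mY M v k w = 0"
    using vmod assms unfolding is_vmod_def by blast
  then show "0 \<le> int m + d - k - 1 \<Longrightarrow> mY M v k w \<in> mgr M (nat (int m + d - k - 1))"
    and "int m + d - k - 1 < 0 \<Longrightarrow> mY M v k w = 0" by auto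
qed

lemma mgr_mcar: "w \<in> mgr M m \<Longrightarrow> w \<in> mcar M" using gd.gr_C by blast

lemma low_mgr: "w \<in> mgr M n \<Longrightarrow> low n w"
  unfolding low_def using mgr_A(2) mgr_mcar by simp

lemma oact_zmode: "oact V M = zmode"
  by (rule ext, rule ext) (simp add: oact_def zmode_def)

lemma zmode_mgr:
  assumes "w \<in> mgr M m"
  shows "zmode a w \<in> mgr M m"
  unfolding zmode_def
proof (intro vs.subspace_sum gd.gr_sub)
  fix d
  have "vcomp V a d \<in> vgr V d" by (simp add: vcomp_eq_gcomp gv.gcomp_in)
  from mgr_A(1)[OF this assms, of "d - 1"] show "mY M (vcomp V a d) (d - 1) w \<in> mgr M m" by simp
qed

lemma mcomp_A:
  assumes w: "w \<in> mgr M j"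
  shows "mcomp M (mY M v k w) m = mY M (vcomp V v (int m - int j + k + 1)) k w"
proof (induction v rule: V_induct)
  case (homog d v)
  have c: "vcomp V v = (\<lambda>i. if i = d then v else 0)"
    unfolding vcomp_eq_gcomp by (rule gv.gcomp_homog[OF homog])
  show ?case
  proof (cases "0 \<le> int j + d - k - 1")
    case True
    have "mcomp M (mY M v k w) = (\<lambda>i. if i = nat (int j + d - k - 1) then mY M v k w else 0)"
      unfolding mcomp_gcomp by (rule gd.gcomp_homog[OF mgr_A(1)[OF homog w True]])
    moreover have "m = nat (int j + d - k - 1) \<longleftrightarrow> int m - int j + k + 1 = d" using True by auto
    ultimately show ?thesis by (simp add: c mgr_mcar[OF w])
  next
    case False
    then have "mY M v k w = 0" by (intro mgr_A(2)[OF homog w]) simp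
    moreover have "int m - int j + k + 1 \<noteq> d" using False by auto
    ultimately show ?thesis by (simp add: c mgr_mcar[OF w] mcomp_gcomp gd.gcomp_0)
  qed
next
  case (add v v')
  have "vcomp V (v + v') = (\<lambda>d. vcomp V v d + vcomp V v' d)"
    unfolding vcomp_eq_gcomp by (rule gv.gcomp_add) auto
  then show ?case using add mgr_mcar[OF w]
    by (simp add: A_add_left mcomp_gcomp gd.gcomp_add A_closed)
qed

lemma mcomp_A_same:
  assumes w: "w \<in> mgr M j"
  shows "mcomp M (mY M v k w) j = oact V M (vcomp V v (k + 1)) w"
proof -
  have "vcomp V v (k + 1) \<in> vgr V (k + 1)" by (simp add: vcomp_eq_gcomp gv.gcomp_in)
  from zmode_homog[OF mgr_mcar[OF w] this] show ?thesis
    unfolding mcomp_A[OF w] oact_zmode by simp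
qed

text \<open>Single modes already span the submodule generated by \<open>W\<close>: by weak
  associativity a product of modes stays in this span.\<close>

definition gen :: "'m set \<Rightarrow> 'm set" where
  "gen W = vs.span {mY M v k w | v k w. w \<in> W}"

lemma gen_sub: "W \<subseteq> mcar M \<Longrightarrow> gen W \<subseteq> mcar M"
  unfolding gen_def by (rule vs.span_minimal[OF _ C_sub]) (use A_closed in blast)

lemma gen_base: "W \<subseteq> mcar M \<Longrightarrow> W \<subseteq> gen W"
proof
  fix w assume "W \<subseteq> mcar M" "w \<in> W"
  then have "w = mY M vac (-1) w" using A_vac by (simp add: subset_iff)
  then show "w \<in> gen W" unfolding gen_def using \<open>w \<in> W\<close> by (intro vs.span_base) blast
qed

lemma gen_induct [consumes 2, case_names zero step]:
  assumes "W \<subseteq> mcar M" "x \<in> gen W"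
    and "P 0"
    and "\<And>c v k w y. w \<in> W \<Longrightarrow> y \<in> mcar M \<Longrightarrow> y \<in> gen W \<Longrightarrow> P y \<Longrightarrow> P (msc M c (mY M v k w) + y)"
  shows "P x"
proof -
  have "x \<in> mcar M \<and> x \<in> gen W \<and> P x" using assms(2) unfolding gen_def
  proof (induction rule: vs.span_induct_alt)
    case base
    show ?case using assms(3) vs.subspace_0[OF C_sub] vs.span_zero by blast
  next
    case (step c x y)
    then obtain v k w where x: "x = mY M v k w" "w \<in> W" by blast
    have y: "y \<in> mcar M" "y \<in> gen W" "P y" using step unfolding gen_def by blast+
    have xg: "x \<in> gen W" unfolding gen_def using step(1) by (rule vs.span_base)
    have "x \<in> mcar M" using x A_closed assms(1) by blast
    then have "msc M c x + y \<in> mcar M" by (intro vs.subspace_add[OF C_sub] vs.subspace_scale[OF C_sub] y)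
    moreover have "msc M c x + y \<in> gen W"
      using xg y(2) unfolding gen_def by (intro vs.span_add vs.span_scale)
    moreover have "P (msc M c x + y)" unfolding x(1) by (rule assms(4)[OF x(2) y])
    ultimately show ?case unfolding gen_def by blast
  qed
  then show ?thesis by blast
qed

lemma gen_A:
  assumes W: "W \<subseteq> mcar M" and x: "x \<in> gen W"
  shows "mY M u l x \<in> gen W"
  using W x
proof (induction rule: gen_induct)
  case zero show ?case by (simp add: gen_def vs.span_zero)
next
  case (step c v k w y)
  have w: "w \<in> mcar M" using step W by blast
  have "mY M u l (mY M v k w) \<in> vs.span {mY M (Y u j v) (l + k - j) w | j. True}"
    by (rule A_A_span[OF w])
  also have "\<dots> \<subseteq> gen W" unfolding gen_def by (rule vs.span_mono) (use step(1) in blast)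
  finally have "mY M u l (mY M v k w) \<in> gen W" .
  moreover have "mY M u l (msc M c (mY M v k w) + y) = msc M c (mY M u l (mY M v k w)) + mY M u l y"
    using step w by (simp add: A_add_right A_scale_right A_closed vs.subspace_scale[OF C_sub])
  ultimately show ?case using step unfolding gen_def by (simp add: vs.span_add vs.span_scale)
qed

text \<open>As \<open>W\<close> sits in one degree, each component of a mode applied to it comes
  from the matching homogeneous component of the acting state.\<close>

lemma gen_mcomp:
  assumes W: "W \<subseteq> mgr M j" and x: "x \<in> gen W"
  shows "mcomp M x m \<in> vs.span {mY M v k w | v k w d. w \<in> W \<and> v \<in> vgr V d \<and> int j + d - k - 1 = int m}"
proof -
  have WC: "W \<subseteq> mcar M" using W mgr_mcar by blast
  show ?thesis using WC x
  proof (induction rule: gen_induct)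
    case zero show ?case by (simp add: mcomp_gcomp gd.gcomp_0 vs.span_zero)
  next
    case (step c v k w y)
    have w: "w \<in> mgr M j" "w \<in> mcar M" using step W WC by blast+
    let ?v = "vcomp V v (int m - int j + k + 1)"
    have "?v \<in> vgr V (int m - int j + k + 1)" by (simp add: vcomp_eq_gcomp gv.gcomp_in)
    moreover have "int j + (int m - int j + k + 1) - k - 1 = int m" by simp
    ultimately have "mcomp M (mY M v k w) m \<in> {mY M v k w | v k w d. w \<in> W \<and> v \<in> vgr V d \<and> int j + d - k - 1 = int m}"
      unfolding mcomp_A[OF w(1)] using step(1) by blast
    then have "mcomp M (mY M v k w) m \<in> vs.span {mY M v k w | v k w d. w \<in> W \<and> v \<in> vgr V d \<and> int j + d - k - 1 = int m}"
      by (rule vs.span_base)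
    moreover have "mcomp M (msc M c (mY M v k w) + y) m = msc M c (mcomp M (mY M v k w) m) + mcomp M y m"
      using step w by (simp add: mcomp_gcomp gd.gcomp_add gd.gcomp_scale A_closed vs.subspace_scale[OF C_sub])
    ultimately show ?case using step by (simp add: vs.span_add vs.span_scale)
  qed
qed

lemma irreducible_gen:
  assumes irr: "irreducible_vmod V M" and W: "W \<subseteq> mgr M j" and w: "w \<in> W" "w \<noteq> 0"
  shows "gen W = mcar M"
proof -
  have WC: "W \<subseteq> mcar M" using W mgr_mcar by blast
  have "mcomp M x m \<in> gen W" if "x \<in> gen W" for x m
  proof -
    have "vs.span {mY M v k w | v k w d. w \<in> W \<and> v \<in> vgr V d \<and> int j + d - k - 1 = int m} \<subseteq> gen W"
      unfolding gen_def by (rule vs.span_mono) blast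
    then show ?thesis using gen_mcomp[OF W that] by blast
  qed
  moreover have "vs.subspace (gen W)" unfolding gen_def by (rule vs.subspace_span)
  ultimately have "gen W = {0} \<or> gen W = mcar M"
    using irr gen_sub[OF WC] gen_A[OF WC] unfolding irreducible_vmod_def by blast
  then show ?thesis using gen_base[OF WC] w by blast
qed

lemma mgr_mcomp: "x \<in> mgr M m \<Longrightarrow> mcomp M x m = x"
  by (simp add: mcomp_gcomp gd.gcomp_homog)

lemma is_amod_Mpiece: "is_amod V n (Mpiece V M n)"
  unfolding is_amod_def Mpiece_def
  using zmode_mgr zmode_add_right zmode_scale_right zmode_add zmode_scale mgr_mcar zmode_Oset[OF low_mgr] zmode_vac zmode_star[OF low_mgr]
  by (auto simp: vs.vector_space_axioms gd.gr_sub oact_zmode linon_def)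

text \<open>A nonzero submodule of M(n) generates M. What it generates in degree n comes from modes
  of degree 0, which are the operators o(a), so it is the submodule itself.\<close>

lemma simple_Mpiece:
  assumes irr: "irreducible_vmod V M" and nz: "mgr M n \<noteq> {0}"
  shows "simple_amod V n (Mpiece V M n)"
  unfolding simple_amod_def
proof (intro conjI allI impI)
  show "is_amod V n (Mpiece V M n)" by (rule is_amod_Mpiece)
  show "ucar (Mpiece V M n) \<noteq> {0}" using nz by (simp add: Mpiece_def)
  fix W assume "module.subspace (usc (Mpiece V M n)) W \<and> W \<subseteq> ucar (Mpiece V M n)
     \<and> (\<forall>a. \<forall>x\<in>W. uact (Mpiece V M n) a x \<in> W)"
  then have W: "vs.subspace W" "W \<subseteq> mgr M n" "\<And>a x. x \<in> W \<Longrightarrow> zmode a x \<in> W"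
    by (auto simp: Mpiece_def oact_zmode)
  show "W = {0} \<or> W = ucar (Mpiece V M n)"
  proof (cases "W = {0}")
    case False
    then obtain w where w: "w \<in> W" "w \<noteq> 0" using vs.subspace_0[OF W(1)] by blast
    have g: "gen W = mcar M" by (rule irreducible_gen[OF irr W(2) w])
    have "x \<in> W" if x: "x \<in> mgr M n" for x
    proof -
      have "x \<in> vs.span {mY M v k w | v k w d. w \<in> W \<and> v \<in> vgr V d \<and> int n + d - k - 1 = int n}"
        using gen_mcomp[OF W(2), of x n] mgr_mcomp[OF x] mgr_mcar[OF x] g by simp
      also have "\<dots> \<subseteq> W"
      proof (rule vs.span_minimal[OF _ W(1)], safe)
        fix v k w d assume w: "w \<in> W" and v: "v \<in> vgr V d" and k: "int n + d - k - 1 = int n"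
        have "k = d - 1" using k by simp
        then show "mY M v k w \<in> W"
          using zmode_homog[OF mgr_mcar v, of w n] W(3)[OF w, of v] W(2) w by auto
      qed
      finally show ?thesis .
    qed
    then show ?thesis using W(2) by (auto simp: Mpiece_def)
  qed simp
qed

lemma Mpiece_not_factors:
  assumes irr: "irreducible_vmod V M" and nz: "mgr M n \<noteq> {0}" and nz0: "mgr M 0 \<noteq> {0}"
  shows "\<not> factors_prev V n (Mpiece V M n)"
proof
  assume f: "factors_prev V n (Mpiece V M n)"
  obtain w0 where w0: "w0 \<in> mgr M n" "w0 \<noteq> 0" using nz vs.subspace_0[OF gd.gr_sub] by blast
  obtain z0 where z0: "z0 \<in> mgr M 0" "z0 \<noteq> 0" using nz0 vs.subspace_0[OF gd.gr_sub] by blast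
  show False
  proof (cases "n = 0")
    case True
    then have "zmode vac w0 = 0" using f w0(1) by (simp add: factors_prev_def Mpiece_def oact_zmode)
    then show False using zmode_vac[OF mgr_mcar[OF w0(1)]] w0(2) by simp
  next
    case False
    have AA: "mY M a (d - int n - 1) (mY M b (e + int n - 1) w) = 0"
      if "w \<in> mgr M n" "a \<in> vgr V d" "b \<in> vgr V e" for a b d e w
    proof -
      have "zmode (circ V (n - 1) 1 1 d a b) w = 0"
        using f that(1) circ_Oset[OF that(2), of 1 1 "n - 1" b] False
        by (simp add: factors_prev_def Mpiece_def oact_zmode)
      then show ?thesis using zmode_circ_top[OF low_mgr[OF that(1)] _ that(2,3)] False by simp
    qed
    \<comment> \<open>M(0) is spanned by modes of degree -n applied to M(n), so by \<open>AA\<close>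
      every mode of degree n kills it. But M(0) also generates M, so M(n) is spanned by just these
      modes and would vanish.\<close>
    have A0: "mY M a (d - int n - 1) z = 0" if a: "a \<in> vgr V d" and z: "z \<in> mgr M 0" for a d z
    proof -
      have "gen (mgr M n) = mcar M" by (rule irreducible_gen[OF irr order_refl w0])
      then have "z \<in> vs.span {mY M v k w | v k w d. w \<in> mgr M n \<and> v \<in> vgr V d \<and> int n + d - k - 1 = int 0}"
        using gen_mcomp[OF order_refl, of z n 0] mgr_mcomp[OF z] mgr_mcar[OF z] by simp
      then have "z \<in> mcar M \<and> mY M a (d - int n - 1) z = 0"
      proof (induction rule: vs.span_induct_alt)
        case base then show ?case using vs.subspace_0[OF C_sub] by simp
      next
        case (step c x y)
        then obtain v k w e where x: "x = mY M v k w" "w \<in> mgr M n" "v \<in> vgr V e" "int n + e - k - 1 = int 0" by blast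
        have k: "k = e + int n - 1" using x(4) by simp
        have "mY M a (d - int n - 1) x = 0" unfolding x(1) k by (rule AA[OF x(2) a x(3)])
        moreover have "x \<in> mcar M" unfolding x(1) by (rule A_closed[OF mgr_mcar[OF x(2)]])
        ultimately show ?case using step
          by (simp add: A_add_right A_scale_right vs.subspace_add[OF C_sub] vs.subspace_scale[OF C_sub])
      qed
      then show ?thesis ..
    qed
    have "gen (mgr M 0) = mcar M" by (rule irreducible_gen[OF irr order_refl z0])
    then have "w0 \<in> vs.span {mY M v k w | v k w d. w \<in> mgr M 0 \<and> v \<in> vgr V d \<and> int 0 + d - k - 1 = int n}"
      using gen_mcomp[OF order_refl, of w0 0 n] mgr_mcomp[OF w0(1)] mgr_mcar[OF w0(1)] by simp
    also have "\<dots> \<subseteq> {0}"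
    proof (rule vs.span_minimal, safe)
      fix v k w d assume w: "w \<in> mgr M 0" and v: "v \<in> vgr V d" and k: "int 0 + d - k - 1 = int n"
      have "k = d - int n - 1" using k by simp
      then show "mY M v k w = 0" using A0[OF v w] by simp
    qed (rule vs.subspace_single_0)
    finally show False using w0(2) by simp
  qed
qed

end

section \<open>Uniqueness\<close>

lemma fsum_Pair:
  fixes f :: "nat \<Rightarrow> 'a::comm_monoid_add" and g :: "nat \<Rightarrow> 'b::comm_monoid_add"
  assumes "\<And>i. N \<le> i \<Longrightarrow> f i = 0" "\<And>i. N \<le> i \<Longrightarrow> g i = 0"
  shows "fsum (\<lambda>i. (f i, g i)) = (fsum f, fsum g)"
proof -
  have "fsum (\<lambda>i. (f i, g i)) = (\<Sum>i<N. (f i, g i))"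
    by (rule fsum_eq) (simp add: assms zero_prod_def)
  also have "\<dots> = (sum f {..<N}, sum g {..<N})"
    by (induction N) (simp_all add: zero_prod_def)
  finally show ?thesis by (simp add: fsum_eq[of N f] fsum_eq[of N g] assms)
qed

lemma subspace_prod:
  assumes "vector_space s1" "vector_space s2" "module.subspace s1 A" "module.subspace s2 B"
  shows "module.subspace (\<lambda>c x. (s1 c (fst x), s2 c (snd x))) (A \<times> B)"
proof -
  interpret a: vector_space s1 by (rule assms)
  interpret b: vector_space s2 by (rule assms)
  interpret p: vector_space "\<lambda>c x. (s1 c (fst x), s2 c (snd x))"
    by unfold_locales (simp_all add: a.scale_right_distrib b.scale_right_distrib
        a.scale_left_distrib b.scale_left_distrib prod_eq_iff)
  show ?thesis using assms(3,4)
    by (auto simp: p.subspace_def a.subspace_def b.subspace_def zero_prod_def)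
qed

locale two_vmods = M1: vmodl V M1 + M2: vmodl V M2
  for V :: "('k::field, 'v::ab_group_add) voa"
    and M1 :: "('k, 'v, 'm1::ab_group_add) vmod" and M2 :: "('k, 'v, 'm2::ab_group_add) vmod"
begin

definition ps :: "'k \<Rightarrow> 'm1 \<times> 'm2 \<Rightarrow> 'm1 \<times> 'm2" where
  "ps c x = (msc M1 c (fst x), msc M2 c (snd x))"

definition pA :: "'v \<Rightarrow> int \<Rightarrow> 'm1 \<times> 'm2 \<Rightarrow> 'm1 \<times> 'm2" where
  "pA v k x = (mY M1 v k (fst x), mY M2 v k (snd x))"

lemma borcherds_prod: "borcherds (vY V) (mcar M1 \<times> mcar M2) ps pA"
  unfolding borcherds_def
proof (intro allI ballI)
  fix u v w and p q r :: int assume w: "w \<in> mcar M1 \<times> mcar M2"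
  obtain w1 w2 where ww: "w = (w1, w2)" "w1 \<in> mcar M1" "w2 \<in> mcar M2" using w by blast
  obtain K where K: "\<forall>j\<ge>K. vY V u j v = 0" using M1.Y_trunc by blast
  obtain L1 where L1: "\<forall>j\<ge>L1. mY M1 v j w1 = 0" using M1.A_trunc[OF ww(2)] by blast
  obtain L2 where L2: "\<forall>j\<ge>L2. mY M2 v j w2 = 0" using M2.A_trunc[OF ww(3)] by blast
  obtain L3 where L3: "\<forall>j\<ge>L3. mY M1 u j w1 = 0" using M1.A_trunc[OF ww(2)] by blast
  obtain L4 where L4: "\<forall>j\<ge>L4. mY M2 u j w2 = 0" using M2.A_trunc[OF ww(3)] by blast
  let ?N = "nat (L1 - q) + nat (L2 - q) + nat (L3 - p) + nat (L4 - p)"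
  have "fsum (\<lambda>i. ps (of_int (ibinom p i)) (pA (vY V u (r + int i) v) (p + q - int i) w))
     = (fsum (\<lambda>i. msc M1 (of_int (ibinom p i)) (mY M1 (vY V u (r + int i) v) (p + q - int i) w1)),
        fsum (\<lambda>i. msc M2 (of_int (ibinom p i)) (mY M2 (vY V u (r + int i) v) (p + q - int i) w2)))"
    unfolding ps_def pA_def ww(1) fst_conv snd_conv
    by (rule fsum_Pair[of "nat (K - r)"]) (use K ww in auto)
  also have "\<dots> = (fsum (\<lambda>i. msc M1 (of_int ((-1)^i * ibinom r i))
                 (mY M1 u (p + r - int i) (mY M1 v (q + int i) w1)
                  - msc M1 (of_int (sgnpow r)) (mY M1 v (q + r - int i) (mY M1 u (p + int i) w1)))),
       fsum (\<lambda>i. msc M2 (of_int ((-1)^i * ibinom r i))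
                 (mY M2 u (p + r - int i) (mY M2 v (q + int i) w2)
                  - msc M2 (of_int (sgnpow r)) (mY M2 v (q + r - int i) (mY M2 u (p + int i) w2)))))"
    using M1.A_borcherds M2.A_borcherds ww(2,3) unfolding borcherds_def by auto
  also have "\<dots> = fsum (\<lambda>i. ps (of_int ((-1)^i * ibinom r i))
                 (pA u (p + r - int i) (pA v (q + int i) w)
                  - ps (of_int (sgnpow r)) (pA v (q + r - int i) (pA u (p + int i) w))))"
    unfolding ps_def pA_def ww(1) fst_conv snd_conv minus_prod_def
    by (rule fsum_Pair[of ?N, symmetric]) (use L1 L2 L3 L4 in auto)
  finally show "fsum (\<lambda>i. ps (of_int (ibinom p i)) (pA (vY V u (r + int i) v) (p + q - int i) w))
    = fsum (\<lambda>i. ps (of_int ((-1)^i * ibinom r i))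
                 (pA u (p + r - int i) (pA v (q + int i) w)
                  - ps (of_int (sgnpow r)) (pA v (q + r - int i) (pA u (p + int i) w))))" .
qed

sublocale pm: wmod V ps "mcar M1 \<times> mcar M2" pA
proof -
  interpret p: vector_space ps
    by unfold_locales (simp_all add: ps_def M1.vs.scale_right_distrib M2.vs.scale_right_distrib
        M1.vs.scale_left_distrib M2.vs.scale_left_distrib prod_eq_iff)
  show "wmod V ps (mcar M1 \<times> mcar M2) pA"
  proof unfold_locales
    show "p.subspace (mcar M1 \<times> mcar M2)"
      using subspace_prod[OF M1.vs.vector_space_axioms M2.vs.vector_space_axioms M1.C_sub M2.C_sub]
      unfolding ps_def[abs_def] .
    show "borcherds (vY V) (mcar M1 \<times> mcar M2) ps pA" by (rule borcherds_prod)
    fix w v assume w: "w \<in> mcar M1 \<times> mcar M2"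
    obtain N1 where "\<forall>l\<ge>N1. mY M1 v l (fst w) = 0" using M1.A_trunc w by force
    moreover obtain N2 where "\<forall>l\<ge>N2. mY M2 v l (snd w) = 0" using M2.A_trunc w by force
    ultimately have "\<forall>l\<ge>max N1 N2. pA v l w = 0" by (simp add: pA_def zero_prod_def)
    then show "\<exists>N. \<forall>l\<ge>N. pA v l w = 0" by blast
  qed (auto simp: pA_def ps_def M1.A_closed M2.A_closed M1.A_add_right M2.A_add_right
      M1.A_scale_right M2.A_scale_right M1.A_add_left M2.A_add_left M1.A_scale_left M2.A_scale_left
      M1.A_vac M2.A_vac zero_prod_def)
qed

lemma uniqueness:
  assumes irr1: "irreducible_vmod V M1" and irr2: "irreducible_vmod V M2"
    and nz1: "mgr M1 n \<noteq> {0}" and nz2: "mgr M2 n \<noteq> {0}"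
    and iso: "amod_iso (Mpiece V M1 n) (Mpiece V M2 n)"
  shows "vmod_iso M1 M2"
proof -
  obtain \<psi> where bij: "bij_betw \<psi> (mgr M1 n) (mgr M2 n)"
    and psi_lin: "linon (mgr M1 n) (msc M1) (msc M2) \<psi>"
    and psi_act: "\<And>a x. x \<in> mgr M1 n \<Longrightarrow> \<psi> (oact V M1 a x) = oact V M2 a (\<psi> x)"
    using iso unfolding amod_iso_def Mpiece_def by auto
  have psi_in: "\<psi> x \<in> mgr M2 n" if "x \<in> mgr M1 n" for x using bij that by (auto simp: bij_betw_def)
  have psi_add: "\<psi> (x + y) = \<psi> x + \<psi> y" if "x \<in> mgr M1 n" "y \<in> mgr M1 n" for x y
    using psi_lin that by (simp add: linon_def)
  have psi_scale: "\<psi> (msc M1 c x) = msc M2 c (\<psi> x)" if "x \<in> mgr M1 n" for c x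
    using psi_lin that by (simp add: linon_def)
  have zero1: "0 \<in> mgr M1 n" using M1.vs.subspace_0[OF M1.gd.gr_sub] .
  have psi_0: "\<psi> 0 = 0" using psi_scale[OF zero1, of 0] by simp
  have psi_eq0: "x = 0" if "x \<in> mgr M1 n" "\<psi> x = 0" for x
    using bij that zero1 psi_0 by (metis bij_betw_def inj_on_eq_iff)
  obtain w1 where w1: "w1 \<in> mgr M1 n" "w1 \<noteq> 0" using nz1 zero1 by blast
  obtain w2 where w2: "w2 \<in> mgr M2 n" "w2 \<noteq> 0" using nz2 M2.vs.subspace_0[OF M2.gd.gr_sub] by blast
  define G where "G = pm.vs.span {pA v k (w, \<psi> w) | v k w. w \<in> mgr M1 n}"
  have Gsub: "pm.vs.subspace G" unfolding G_def by (rule pm.vs.subspace_span)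
  have G_induct: "P x" if "x \<in> G" "P 0"
    and step: "\<And>c v k w y. w \<in> mgr M1 n \<Longrightarrow> y \<in> mcar M1 \<times> mcar M2 \<Longrightarrow> y \<in> G \<Longrightarrow> P y \<Longrightarrow> P (ps c (pA v k (w, \<psi> w)) + y)"
    for P and x :: "'m1 \<times> 'm2"
  proof -
    have "x \<in> mcar M1 \<times> mcar M2 \<and> x \<in> G \<and> P x" using that(1) unfolding G_def
    proof (induction rule: pm.vs.span_induct_alt)
      case base
      show ?case using that(2) pm.vs.subspace_0[OF pm.C_sub] pm.vs.span_zero by blast
    next
      case (step c x y)
      then obtain v k w where x: "x = pA v k (w, \<psi> w)" "w \<in> mgr M1 n" by blast
      have y: "y \<in> mcar M1 \<times> mcar M2" "y \<in> G" "P y" using step unfolding G_def by blast+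
      have xg: "x \<in> G" unfolding G_def using step(1) by (rule pm.vs.span_base)
      have "(w, \<psi> w) \<in> mcar M1 \<times> mcar M2" using x(2) psi_in M1.mgr_mcar M2.mgr_mcar by blast
      then have "x \<in> mcar M1 \<times> mcar M2" unfolding x(1) by (rule pm.A_closed)
      then have "ps c x + y \<in> mcar M1 \<times> mcar M2" by (intro pm.vs.subspace_add[OF pm.C_sub] pm.vs.subspace_scale[OF pm.C_sub] y)
      moreover have "ps c x + y \<in> G" using xg y(2) Gsub by (intro pm.vs.subspace_add pm.vs.subspace_scale)
      moreover have "P (ps c x + y)" unfolding x(1) by (rule that(3)[OF x(2) y])
      ultimately show ?case unfolding G_def by blast
    qed
    then show ?thesis by blast
  qed
  have pair_C: "(w, \<psi> w) \<in> mcar M1 \<times> mcar M2" if "w \<in> mgr M1 n" for w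
    using that psi_in M1.mgr_mcar M2.mgr_mcar by blast
  have G_C: "x \<in> mcar M1 \<times> mcar M2" if "x \<in> G" for x using that
  proof (rule G_induct)
    show "0 \<in> mcar M1 \<times> mcar M2" by (rule pm.vs.subspace_0[OF pm.C_sub])
  qed (intro pm.vs.subspace_add[OF pm.C_sub] pm.vs.subspace_scale[OF pm.C_sub] pm.A_closed pair_C)
  have G_gen: "pA v k (w, \<psi> w) \<in> G" if "w \<in> mgr M1 n" for v k w
    unfolding G_def by (rule pm.vs.span_base) (use that in blast)
  have G_A: "pA u l x \<in> G" if "x \<in> G" for u l x using that
  proof (rule G_induct)
    show "pA u l 0 \<in> G" using pm.vs.subspace_0[OF Gsub] by simp
    fix c v k w y assume w: "w \<in> mgr M1 n" and y: "y \<in> mcar M1 \<times> mcar M2" "pA u l y \<in> G"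
    have "pA u l (pA v k (w, \<psi> w)) \<in> pm.vs.span {pA (vY V u j v) (l + k - j) (w, \<psi> w) | j. True}"
      by (rule pm.A_A_span[OF pair_C[OF w]])
    also have "\<dots> \<subseteq> G" unfolding G_def by (rule pm.vs.span_mono) (use w in blast)
    finally have 1: "pA u l (pA v k (w, \<psi> w)) \<in> G" .
    have c: "pA v k (w, \<psi> w) \<in> mcar M1 \<times> mcar M2" by (rule pm.A_closed[OF pair_C[OF w]])
    have "pA u l (ps c (pA v k (w, \<psi> w)) + y) = ps c (pA u l (pA v k (w, \<psi> w))) + pA u l y"
      using pm.A_add_right[OF pm.vs.subspace_scale[OF pm.C_sub c] y(1)] pm.A_scale_right[OF c] by metis
    then show "pA u l (ps c (pA v k (w, \<psi> w)) + y) \<in> G"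
      using pm.vs.subspace_add[OF Gsub pm.vs.subspace_scale[OF Gsub 1] y(2)] by metis
  qed
  define pc where "pc x m = (mcomp M1 (fst x) m, mcomp M2 (snd x) m)" for x m
  have pc_lin: "pc (ps c x + y) m = ps c (pc x m) + pc y m"
    if "x \<in> mcar M1 \<times> mcar M2" "y \<in> mcar M1 \<times> mcar M2" for c x y m
    using that M1.vs.subspace_scale[OF M1.C_sub] M2.vs.subspace_scale[OF M2.C_sub]
    by (auto simp: pc_def ps_def M1.mcomp_gcomp M2.mcomp_gcomp M1.gd.gcomp_add M2.gd.gcomp_add
        M1.gd.gcomp_scale M2.gd.gcomp_scale)
  have pc_0: "pc 0 m = 0" for m
    by (simp add: pc_def M1.mcomp_gcomp M2.mcomp_gcomp M1.gd.gcomp_0 M2.gd.gcomp_0 zero_prod_def)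
  have pc_gen: "pc (pA v k (w, \<psi> w)) m = pA (vcomp V v (int m - int n + k + 1)) k (w, \<psi> w)" if "w \<in> mgr M1 n" for v k w m
    by (simp add: pc_def pA_def M1.mcomp_A[OF that] M2.mcomp_A[OF psi_in[OF that]])
  have pA_C: "pA v k (w, \<psi> w) \<in> mcar M1 \<times> mcar M2" if "w \<in> mgr M1 n" for v k w
    by (rule pm.A_closed[OF pair_C[OF that]])
  have G_pc: "pc x m \<in> G" if "x \<in> G" for x m using that
  proof (rule G_induct)
    show "pc 0 m \<in> G" using pm.vs.subspace_0[OF Gsub] by (simp add: pc_0)
    fix c v k w y assume "w \<in> mgr M1 n" "y \<in> mcar M1 \<times> mcar M2" "pc y m \<in> G"
    then show "pc (ps c (pA v k (w, \<psi> w)) + y) m \<in> G"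
      unfolding pc_lin[OF pA_C[OF \<open>w \<in> mgr M1 n\<close>] \<open>y \<in> mcar M1 \<times> mcar M2\<close>] pc_gen[OF \<open>w \<in> mgr M1 n\<close>]
      by (intro pm.vs.subspace_add[OF Gsub] pm.vs.subspace_scale[OF Gsub] G_gen)
  qed
  \<comment> \<open>In degree n only modes of degree 0 contribute, and \<psi> commutes with them, so
    the degree n part of \<open>G\<close> is contained in the graph of \<psi>. This keeps the two
    fibres over 0 proper.\<close>
  have G_n: "fst (pc x n) \<in> mgr M1 n \<and> snd (pc x n) = \<psi> (fst (pc x n))" if "x \<in> G" for x using that
  proof (rule G_induct)
    show "fst (pc 0 n) \<in> mgr M1 n \<and> snd (pc 0 n) = \<psi> (fst (pc 0 n))"
      using zero1 psi_0 by (simp add: pc_0)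
    fix c v k w y assume w: "w \<in> mgr M1 n" and y: "y \<in> mcar M1 \<times> mcar M2"
      and IH: "fst (pc y n) \<in> mgr M1 n \<and> snd (pc y n) = \<psi> (fst (pc y n))"
    let ?z = "oact V M1 (vcomp V v (k + 1)) w"
    have z: "?z \<in> mgr M1 n" unfolding M1.oact_zmode by (rule M1.zmode_mgr[OF w])
    have e: "pc (pA v k (w, \<psi> w)) n = (?z, \<psi> ?z)"
      by (simp add: pc_def pA_def M1.mcomp_A_same[OF w] M2.mcomp_A_same[OF psi_in[OF w]] psi_act[OF w])
    have "pc (ps c (pA v k (w, \<psi> w)) + y) n = ps c (?z, \<psi> ?z) + pc y n"
      unfolding pc_lin[OF pA_C[OF w] y] e ..
    then show "fst (pc (ps c (pA v k (w, \<psi> w)) + y) n) \<in> mgr M1 n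
        \<and> snd (pc (ps c (pA v k (w, \<psi> w)) + y) n) = \<psi> (fst (pc (ps c (pA v k (w, \<psi> w)) + y) n))"
      using z IH M1.vs.subspace_add[OF M1.gd.gr_sub] M1.vs.subspace_scale[OF M1.gd.gr_sub]
      by (simp add: ps_def psi_add psi_scale)
  qed
  have G_add: "(x + x', y + y') \<in> G" if "(x, y) \<in> G" "(x', y') \<in> G" for x y x' y'
    using pm.vs.subspace_add[OF Gsub that] by simp
  have G_scale: "(msc M1 c x, msc M2 c y) \<in> G" if "(x, y) \<in> G" for c x y
    using pm.vs.subspace_scale[OF Gsub that, of c] by (simp add: ps_def)
  have G_0: "(0, 0) \<in> G" using pm.vs.subspace_0[OF Gsub] by (simp add: zero_prod_def)
  have G_diff: "(x - x', y - y') \<in> G" if "(x, y) \<in> G" "(x', y') \<in> G" for x y x' y'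
    using pm.vs.subspace_diff[OF Gsub that] by simp
  have G_Y: "(mY M1 v k x, mY M2 v k y) \<in> G" if "(x, y) \<in> G" for v k x y
    using G_A[OF that, of v k] by (simp add: pA_def)
  have G_comp: "(mcomp M1 x m, mcomp M2 y m) \<in> G" if "(x, y) \<in> G" for x y m
    using G_pc[OF that, of m] by (simp add: pc_def)
  have G_car: "x \<in> mcar M1" "y \<in> mcar M2" if "(x, y) \<in> G" for x y using G_C[OF that] by auto
  have G_top: "mcomp M2 y n = \<psi> (mcomp M1 x n)" if "(x, y) \<in> G" for x y
    using G_n[OF that] by (simp add: pc_def)
  have m0: "mcomp M1 0 m = 0" "mcomp M2 0 m = 0" for m
    by (simp_all add: M1.mcomp_gcomp M2.mcomp_gcomp M1.gd.gcomp_0 M2.gd.gcomp_0)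
  \<comment> \<open>The fibre over 0 is a graded submodule of \<open>M2\<close>. It misses
    \<open>w2\<close>, because in degree n its elements equal \<psi> 0 = 0, and so irreducibility
    makes it zero. The opposite fibre uses the injectivity of \<psi>.\<close>
  have K2: "y = 0" if "(0, y) \<in> G" for y
  proof -
    let ?K = "{y. (0, y) \<in> G}"
    have "M2.vs.subspace ?K"
      unfolding M2.vs.subspace_def
    proof (intro conjI ballI allI)
      show "0 \<in> ?K" using G_0 by simp
      show "x + y \<in> ?K" if "x \<in> ?K" "y \<in> ?K" for x y using G_add[of 0 x 0 y] that by simp
      show "msc M2 c x \<in> ?K" if "x \<in> ?K" for c x using G_scale[of 0 x c] that by simp
    qed
    moreover have "mY M2 v k y \<in> ?K" if "y \<in> ?K" for v k y using G_Y[of 0 y v k] that by simp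
    moreover have "mcomp M2 y m \<in> ?K" if "y \<in> ?K" for y m using G_comp[of 0 y m] that by (simp add: m0)
    moreover have "?K \<subseteq> mcar M2" using G_car by blast
    ultimately have "?K = {0} \<or> ?K = mcar M2" using irr2 unfolding irreducible_vmod_def by blast
    moreover have "w2 \<notin> ?K"
    proof
      assume "w2 \<in> ?K"
      then have "mcomp M2 w2 n = \<psi> (mcomp M1 0 n)" using G_top by blast
      then show False using M2.mgr_mcomp[OF w2(1)] w2(2) by (simp add: m0 psi_0)
    qed
    ultimately show ?thesis using that M2.mgr_mcar[OF w2(1)] by blast
  qed
  have K1: "x = 0" if "(x, 0) \<in> G" for x
  proof -
    let ?K = "{x. (x, 0) \<in> G}"
    have "M1.vs.subspace ?K"
      unfolding M1.vs.subspace_def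
    proof (intro conjI ballI allI)
      show "0 \<in> ?K" using G_0 by simp
      show "x + y \<in> ?K" if "x \<in> ?K" "y \<in> ?K" for x y using G_add[of x 0 y 0] that by simp
      show "msc M1 c x \<in> ?K" if "x \<in> ?K" for c x using G_scale[of x 0 c] that by simp
    qed
    moreover have "mY M1 v k x \<in> ?K" if "x \<in> ?K" for v k x using G_Y[of x 0 v k] that by simp
    moreover have "mcomp M1 x m \<in> ?K" if "x \<in> ?K" for x m using G_comp[of x 0 m] that by (simp add: m0)
    moreover have "?K \<subseteq> mcar M1" using G_car by blast
    ultimately have "?K = {0} \<or> ?K = mcar M1" using irr1 unfolding irreducible_vmod_def by blast
    moreover have "w1 \<notin> ?K"
    proof
      assume "w1 \<in> ?K"
      then have "mcomp M2 0 n = \<psi> (mcomp M1 w1 n)" using G_top by blast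
      then show False using M1.mgr_mcomp[OF w1(1)] w1 psi_eq0 by (simp add: m0)
    qed
    ultimately show ?thesis using that M1.mgr_mcar[OF w1(1)] by blast
  qed
  have S1: "mgr M1 n \<subseteq> mcar M1" "mgr M2 n \<subseteq> mcar M2" using M1.mgr_mcar M2.mgr_mcar by blast+
  have tot: "\<exists>y. (x, y) \<in> G" if "x \<in> mcar M1" for x
  proof -
    have "x \<in> M1.gen (mgr M1 n)" using M1.irreducible_gen[OF irr1 order_refl w1] that by simp
    with S1(1) show ?thesis
    proof (induction rule: M1.gen_induct)
      case zero show ?case using G_0 by blast
    next
      case (step c v k w y)
      then obtain y' where "(y, y') \<in> G" by blast
      moreover have "(mY M1 v k w, mY M2 v k (\<psi> w)) \<in> G" using G_gen[OF step(1), of v k] by (simp add: pA_def)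
      ultimately have "(msc M1 c (mY M1 v k w) + y, msc M2 c (mY M2 v k (\<psi> w)) + y') \<in> G" by (intro G_add G_scale)
      then show ?case by blast
    qed
  qed
  have onto: "\<exists>x. (x, y) \<in> G" if "y \<in> mcar M2" for y
  proof -
    have "y \<in> M2.gen (mgr M2 n)" using M2.irreducible_gen[OF irr2 order_refl w2] that by simp
    with S1(2) show ?thesis
    proof (induction rule: M2.gen_induct)
      case zero show ?case using G_0 by blast
    next
      case (step c v k w y)
      then obtain y' where "(y', y) \<in> G" by blast
      moreover obtain w' where w': "w' \<in> mgr M1 n" "w = \<psi> w'" using step(1) bij by (auto simp: bij_betw_def)
      moreover have "(mY M1 v k w', mY M2 v k w) \<in> G" using G_gen[OF w'(1), of v k] w'(2) by (simp add: pA_def)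
      ultimately have "(msc M1 c (mY M1 v k w') + y', msc M2 c (mY M2 v k w) + y) \<in> G" by (intro G_add G_scale)
      then show ?case by blast
    qed
  qed
  have single: "y = y'" if "(x, y) \<in> G" "(x, y') \<in> G" for x y y' using K2[of "y - y'"] G_diff[OF that] by simp
  have inj: "x = x'" if "(x, y) \<in> G" "(x', y) \<in> G" for x x' y using K1[of "x - x'"] G_diff[OF that] by simp
  define \<theta> where "\<theta> x = (THE y. (x, y) \<in> G)" for x
  have theta: "(x, \<theta> x) \<in> G" if x: "x \<in> mcar M1" for x
  proof -
    obtain y where y: "(x, y) \<in> G" using tot[OF x] by blast
    have "\<theta> x = y" unfolding \<theta>_def using y single[OF _ y] by (rule the_equality)
    with y show ?thesis by simp
  qed
  have theta_eq: "\<theta> x = y" if "(x, y) \<in> G" for x y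
    by (rule single[OF theta[OF G_car(1)[OF that]] that])
  \<comment> \<open>\<open>G\<close> is stable under taking components and is by now the graph of a
    bijection, so components must correspond.\<close>
  have grade: "x \<in> mgr M1 m \<longleftrightarrow> y \<in> mgr M2 m" if xy: "(x, y) \<in> G" for x y m
  proof
    assume x: "x \<in> mgr M1 m"
    have "(x, mcomp M2 y m) \<in> G" using G_comp[OF xy, of m] M1.mgr_mcomp[OF x] by simp
    then have "y = mcomp M2 y m" using single xy by blast
    moreover have "mcomp M2 y m \<in> mgr M2 m" unfolding M2.mcomp_gcomp by (rule M2.gd.gcomp_in[OF G_car(2)[OF xy]])
    ultimately show "y \<in> mgr M2 m" by simp
  next
    assume y: "y \<in> mgr M2 m"
    have "(mcomp M1 x m, y) \<in> G" using G_comp[OF xy, of m] M2.mgr_mcomp[OF y] by simp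
    then have "x = mcomp M1 x m" using inj xy by blast
    moreover have "mcomp M1 x m \<in> mgr M1 m" unfolding M1.mcomp_gcomp by (rule M1.gd.gcomp_in[OF G_car(1)[OF xy]])
    ultimately show "x \<in> mgr M1 m" by simp
  qed
  show ?thesis unfolding vmod_iso_def
  proof (intro exI[of _ \<theta>] conjI allI ballI)
    show "bij_betw \<theta> (mcar M1) (mcar M2)"
      unfolding bij_betw_def
    proof
      show "inj_on \<theta> (mcar M1)"
      proof (rule inj_onI)
        fix x x' assume x: "x \<in> mcar M1" "x' \<in> mcar M1" "\<theta> x = \<theta> x'"
        have "(x, \<theta> x') \<in> G" using theta[OF x(1)] x(3) by simp
        then show "x = x'" by (rule inj[OF _ theta[OF x(2)]])
      qed
      show "\<theta> ` mcar M1 = mcar M2"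
      proof (intro equalityI subsetI)
        fix y assume "y \<in> \<theta> ` mcar M1"
        then show "y \<in> mcar M2" using theta G_car(2) by blast
      next
        fix y assume "y \<in> mcar M2"
        then obtain x where x: "(x, y) \<in> G" using onto by blast
        from theta_eq[OF x] G_car(1)[OF x] show "y \<in> \<theta> ` mcar M1" by blast
      qed
    qed
    show "linon (mcar M1) (msc M1) (msc M2) \<theta>"
      unfolding linon_def
      by (intro conjI ballI allI theta_eq G_add G_scale theta)
    fix v k x assume "x \<in> mcar M1"
    then show "\<theta> (mY M1 v k x) = mY M2 v k (\<theta> x)" by (intro theta_eq G_Y theta)
  next
    fix m show "\<theta> ` mgr M1 m = mgr M2 m"
    proof
      show "\<theta> ` mgr M1 m \<subseteq> mgr M2 m"
      proof
        fix y assume "y \<in> \<theta> ` mgr M1 m"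
        then obtain x where x: "x \<in> mgr M1 m" "y = \<theta> x" by blast
        from grade[OF theta[OF M1.mgr_mcar[OF x(1)]], of m] x show "y \<in> mgr M2 m" by simp
      qed
      show "mgr M2 m \<subseteq> \<theta> ` mgr M1 m"
      proof
        fix y assume y: "y \<in> mgr M2 m"
        then obtain x where x: "(x, y) \<in> G" using onto M2.mgr_mcar by blast
        then have "x \<in> mgr M1 m" using grade y by blast
        moreover have "y = \<theta> x" using theta_eq[OF x] by simp
        ultimately show "y \<in> \<theta> ` mgr M1 m" by blast
      qed
    qed
  qed
qed

end

section \<open>Transport of structure\<close>

text \<open>L_n(U) consists of functions from V to U, while the required carrier type consists of
  scalar-valued functions with pointwise scaling. An injective linear map moves the structure to its
  image.\<close>

locale transport = vmodl V M + tv: vector_space s2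
  for V :: "('k::field, 'v::ab_group_add) voa" and M :: "('k, 'v, 'm::ab_group_add) vmod"
    and s2 :: "'k \<Rightarrow> 'n::ab_group_add \<Rightarrow> 'n" +
  fixes \<tau> :: "'m \<Rightarrow> 'n"
  assumes inj: "inj \<tau>" and tau_add: "\<tau> (x + y) = \<tau> x + \<tau> y" and tau_scale: "\<tau> (msc M c x) = s2 c (\<tau> x)"
begin

definition copy :: "('k, 'v, 'n) vmod" where
  "copy = \<lparr>mcar = \<tau> ` mcar M, msc = s2, mY = (\<lambda>v k w. \<tau> (mY M v k (inv \<tau> w))), mgr = (\<lambda>m. \<tau> ` mgr M m)\<rparr>"

lemma copy_simps [simp]: "mcar copy = \<tau> ` mcar M" "msc copy = s2" "mY copy v k (\<tau> x) = \<tau> (mY M v k x)" "mgr copy m = \<tau> ` mgr M m"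
  by (simp_all add: copy_def inv_f_f[OF inj])

lemma tau_0 [simp]: "\<tau> 0 = 0" using tau_add[of 0 0] by simp
lemma tau_eq_iff [simp]: "\<tau> x = \<tau> y \<longleftrightarrow> x = y" using inj by (auto simp: inj_def)
lemma tau_eq_0 [simp]: "\<tau> x = 0 \<longleftrightarrow> x = 0" using tau_eq_iff[of x 0] by simp
lemma tau_diff: "\<tau> (x - y) = \<tau> x - \<tau> y" using tau_add[of "x - y" y] by simp
lemma tau_sum: "\<tau> (sum f S) = (\<Sum>i\<in>S. \<tau> (f i))"
  by (induction S rule: infinite_finite_induct) (simp_all add: tau_add)
lemma tau_fsum: "\<tau> (fsum f) = fsum (\<lambda>i. \<tau> (f i))" by (simp add: fsum_def tau_sum)

lemma subspace_image: "vs.subspace W \<Longrightarrow> tv.subspace (\<tau> ` W)"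
  unfolding vs.subspace_def tv.subspace_def
  by (auto simp: tau_add[symmetric] tau_scale[symmetric] tau_0[symmetric] simp del: tau_0)

lemma subspace_vimage: "tv.subspace W \<Longrightarrow> vs.subspace (\<tau> -` W)"
  unfolding vs.subspace_def tv.subspace_def by (auto simp: tau_add tau_scale)

lemma decomp_copy:
  assumes x: "x \<in> mcar M"
  shows "\<exists>!f. (\<forall>m. f m \<in> \<tau> ` mgr M m) \<and> finite {m. f m \<noteq> 0} \<and> \<tau> x = sum f {m. f m \<noteq> 0}"
proof (rule ex_ex1I)
  show "\<exists>f. (\<forall>m. f m \<in> \<tau> ` mgr M m) \<and> finite {m. f m \<noteq> 0} \<and> \<tau> x = sum f {m. f m \<noteq> 0}"
  proof (intro exI[of _ "\<lambda>m. \<tau> (mcomp M x m)"] conjI allI)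
    show "\<tau> (mcomp M x m) \<in> \<tau> ` mgr M m" for m using gd.gcomp_in[OF x] by (simp add: mcomp_gcomp)
    show "finite {m. \<tau> (mcomp M x m) \<noteq> 0}" using gd.gcomp_finite[OF x] by (simp add: mcomp_gcomp)
    show "\<tau> x = (\<Sum>m\<in>{m. \<tau> (mcomp M x m) \<noteq> 0}. \<tau> (mcomp M x m))"
      using gd.gcomp_sum[OF x] unfolding mcomp_gcomp tau_eq_0 tau_sum[symmetric] by (rule arg_cong)
  qed
  fix f g
  assume f: "(\<forall>m. f m \<in> \<tau> ` mgr M m) \<and> finite {m. f m \<noteq> 0} \<and> \<tau> x = sum f {m. f m \<noteq> 0}"
    and g: "(\<forall>m. g m \<in> \<tau> ` mgr M m) \<and> finite {m. g m \<noteq> 0} \<and> \<tau> x = sum g {m. g m \<noteq> 0}"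
  have *: "h = (\<lambda>m. \<tau> (mcomp M x m))"
    if h: "(\<forall>m. h m \<in> \<tau> ` mgr M m) \<and> finite {m. h m \<noteq> 0} \<and> \<tau> x = sum h {m. h m \<noteq> 0}" for h
  proof -
    from h have "\<forall>m. \<exists>y. y \<in> mgr M m \<and> h m = \<tau> y" by blast
    then obtain h' where h': "\<And>m. h' m \<in> mgr M m" "\<And>m. h m = \<tau> (h' m)" by metis
    have "finite {m. h' m \<noteq> 0}" "\<tau> x = \<tau> (sum h' {m. h' m \<noteq> 0})" using h by (simp_all add: h'(2) tau_sum)
    then have "mcomp M x = h'"
      unfolding mcomp_gcomp by (intro gd.gcomp_unique[where S = "{m. h' m \<noteq> 0}"] h') auto
    then show ?thesis using h'(2) by auto
  qed
  show "f = g" using *[OF f] *[OF g] by simp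
qed

lemma is_vmod_copy: "is_vmod V copy"
  unfolding is_vmod_def
proof (intro conjI allI ballI impI)
  show "vector_space (msc copy)" using tv.vector_space_axioms by simp
  show "module.subspace (msc copy) (mcar copy)" using subspace_image[OF C_sub] by simp
  show "module.subspace (msc copy) (mgr copy m)" for m using subspace_image[OF gd.gr_sub] by simp
  show "mgr copy m \<subseteq> mcar copy" for m using mgr_mcar by auto
  show "mY copy v k w \<in> mcar copy" if "w \<in> mcar copy" for v k w using that A_closed by auto
  show "linon (mcar copy) (msc copy) (msc copy) (mY copy v k)" for v k
    unfolding linon_def
    by (auto simp: tau_add[symmetric] tau_scale[symmetric] A_add_right A_scale_right)
  show "linon UNIV (vsc V) (msc copy) (\<lambda>v. mY copy v k w)" if "w \<in> mcar copy" for k w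
    using that unfolding linon_def
    by (auto simp: tau_add[symmetric] tau_scale[symmetric] A_add_left A_scale_left)
  show "\<exists>n. \<forall>l\<ge>n. mY copy v l w = 0" if "w \<in> mcar copy" for v w
    using that A_trunc by auto
  show "mY copy (vvac V) k w = (if k = -1 then w else 0)" if "w \<in> mcar copy" for k w
    using that A_vac by auto
  show "borcherds (vY V) (mcar copy) (msc copy) (mY copy)"
    unfolding borcherds_def
  proof (intro allI ballI)
    fix u v w and p q r :: int assume "w \<in> mcar copy"
    then obtain x where x: "x \<in> mcar M" "w = \<tau> x" by auto
    have "\<tau> (fsum (\<lambda>i. msc M (of_int (ibinom p i)) (mY M (vY V u (r + int i) v) (p + q - int i) x)))
     = \<tau> (fsum (\<lambda>i. msc M (of_int ((-1)^i * ibinom r i))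
                 (mY M u (p + r - int i) (mY M v (q + int i) x)
                  - msc M (of_int (sgnpow r)) (mY M v (q + r - int i) (mY M u (p + int i) x)))))"
      using A_borcherds x(1) unfolding borcherds_def by simp
    then show "fsum (\<lambda>i. msc copy (of_int (ibinom p i)) (mY copy (vY V u (r + int i) v) (p + q - int i) w))
     = fsum (\<lambda>i. msc copy (of_int ((-1)^i * ibinom r i))
                 (mY copy u (p + r - int i) (mY copy v (q + int i) w)
                  - msc copy (of_int (sgnpow r)) (mY copy v (q + r - int i) (mY copy u (p + int i) w))))"
      unfolding tau_fsum tau_scale tau_diff x(2) copy_simps .
  qed
  show "\<exists>!f. (\<forall>m. f m \<in> mgr copy m) \<and> finite {m. f m \<noteq> 0} \<and> x = sum f {m. f m \<noteq> 0}" if "x \<in> mcar copy" for x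
  proof -
    from that obtain y where y: "y \<in> mcar M" "x = \<tau> y" by auto
    show ?thesis unfolding y(2) copy_simps by (rule decomp_copy[OF y(1)])
  qed
  fix v s k m w assume v: "v \<in> vgr V s" and "w \<in> mgr copy m"
  then obtain x where x: "x \<in> mgr M m" "w = \<tau> x" by auto
  show "if 0 \<le> int m + s - k - 1 then mY copy v k w \<in> mgr copy (nat (int m + s - k - 1)) else mY copy v k w = 0"
    using mgr_A[OF v x(1), of k] x(2) by auto
qed

lemma mcomp_copy: "x \<in> mcar M \<Longrightarrow> mcomp copy (\<tau> x) m = \<tau> (mcomp M x m)"
proof -
  assume x: "x \<in> mcar M"
  interpret n: vmodl V copy by unfold_locales (rule is_vmod_copy)
  have "gcomp (mgr copy) (\<tau> x) = (\<lambda>m. \<tau> (mcomp M x m))"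
  proof (rule n.gd.gcomp_unique[where S = "{m. mcomp M x m \<noteq> 0}"])
    show "\<tau> (mcomp M x k) \<in> mgr copy k" for k using gd.gcomp_in[OF x] by (simp add: mcomp_gcomp)
    show "finite {m. mcomp M x m \<noteq> 0}" using gd.gcomp_finite[OF x] by (simp add: mcomp_gcomp)
    show "\<tau> x = (\<Sum>m\<in>{m. mcomp M x m \<noteq> 0}. \<tau> (mcomp M x m))"
      using gd.gcomp_sum[OF x] unfolding mcomp_gcomp tau_sum[symmetric] by (rule arg_cong)
  qed simp
  then show ?thesis by (simp add: mcomp_eq_gcomp[of copy])
qed

lemma irreducible_copy:
  assumes irr: "irreducible_vmod V M"
  shows "irreducible_vmod V copy"
  unfolding irreducible_vmod_def
proof (intro conjI allI impI)
  have "mcar M \<noteq> {0}" using irr by (simp add: irreducible_vmod_def)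
  then obtain x where "x \<in> mcar M" "x \<noteq> 0" using vs.subspace_0[OF C_sub] by blast
  then have "\<tau> x \<in> mcar copy" "\<tau> x \<noteq> 0" by simp_all
  then show "mcar copy \<noteq> {0}" by blast
  fix W assume W: "module.subspace (msc copy) W \<and> W \<subseteq> mcar copy \<and> (\<forall>v k. \<forall>w\<in>W. mY copy v k w \<in> W) \<and> (\<forall>x\<in>W. \<forall>m. mcomp copy x m \<in> W)"
  let ?W = "\<tau> -` W"
  have img: "\<tau> ` ?W = W" using W by auto
  have sub: "?W \<subseteq> mcar M" using W by auto
  have "vs.subspace ?W" by (rule subspace_vimage) (use W in simp)
  moreover have "mY M v k w \<in> ?W" if "w \<in> ?W" for v k w
  proof -
    have "mY copy v k (\<tau> w) \<in> W" using W that by blast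
    then show ?thesis by simp
  qed
  moreover have "mcomp M x m \<in> ?W" if "x \<in> ?W" for x m
  proof -
    have "mcomp copy (\<tau> x) m \<in> W" using W that by blast
    then show ?thesis using mcomp_copy[of x m] sub that by auto
  qed
  ultimately have "?W = {0} \<or> ?W = mcar M" using irr sub unfolding irreducible_vmod_def by blast
  then show "W = {0} \<or> W = mcar copy" using img by (metis copy_simps(1) image_empty image_insert tau_0)
qed

lemma oact_copy: "x \<in> mcar M \<Longrightarrow> oact V copy a (\<tau> x) = \<tau> (oact V M a x)"
  by (simp add: oact_def tau_sum)

lemma Mpiece_copy_iso:
  assumes "amod_iso (Mpiece V M n) U"
  shows "amod_iso (Mpiece V copy n) U"
proof -
  obtain \<phi> where \<phi>: "bij_betw \<phi> (mgr M n) (ucar U)" "linon (mgr M n) (msc M) (usc U) \<phi>"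
    "\<And>a x. x \<in> mgr M n \<Longrightarrow> \<phi> (oact V M a x) = uact U a (\<phi> x)"
    using assms unfolding amod_iso_def Mpiece_def by auto
  have inv: "inv \<tau> (\<tau> x) = x" for x by (rule inv_f_f[OF inj])
  have zmode_in: "oact V M a x \<in> mgr M n" if "x \<in> mgr M n" for a x
    unfolding oact_zmode by (rule zmode_mgr[OF that])
  show ?thesis unfolding amod_iso_def
  proof (intro exI[of _ "\<lambda>y. \<phi> (inv \<tau> y)"] conjI)
    have "bij_betw (inv \<tau>) (\<tau> ` mgr M n) (mgr M n)"
      by (rule bij_betwI[where g = \<tau>]) (auto simp: inv)
    from bij_betw_trans[OF this \<phi>(1)]
    show "bij_betw (\<lambda>y. \<phi> (inv \<tau> y)) (ucar (Mpiece V copy n)) (ucar U)"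
      by (simp add: Mpiece_def o_def)
    show "linon (ucar (Mpiece V copy n)) (usc (Mpiece V copy n)) (usc U) (\<lambda>y. \<phi> (inv \<tau> y))"
      using \<phi>(2) unfolding linon_def
      by (auto simp: Mpiece_def tau_add[symmetric] tau_scale[symmetric] inv)
    show "\<forall>a. \<forall>x\<in>ucar (Mpiece V copy n). \<phi> (inv \<tau> (uact (Mpiece V copy n) a x)) = uact U a (\<phi> (inv \<tau> x))"
      by (auto simp: Mpiece_def oact_copy mgr_mcar inv \<phi>(3))
  qed
qed

end

text \<open>The conjuncts give well-definedness, injectivity on isomorphism classes and surjectivity
  of the assignment M \<mapsto> M(n). That \<open>L\<close> has a nonzero component of degree n
  follows from its isomorphism with the nonzero module \<open>U\<close>.\<close>

theorem theorem4p1: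
  fixes V :: "('k::field, 'v::ab_group_add) voa" and n :: nat
  assumes "\<forall>p::'k poly. 0 < degree p \<longrightarrow> (\<exists>x. poly p x = 0)"
    and "(2::'k) \<noteq> 0"
    and "is_voa V"
  shows "(\<forall>M :: ('k, 'v, 'm::ab_group_add) vmod. good_vmod V n M \<longrightarrow>
            simple_amod V n (Mpiece V M n) \<and> \<not> factors_prev V n (Mpiece V M n))
       \<and> (\<forall>(M1 :: ('k, 'v, 'm1::ab_group_add) vmod) (M2 :: ('k, 'v, 'm2::ab_group_add) vmod).
            good_vmod V n M1 \<and> good_vmod V n M2 \<and> amod_iso (Mpiece V M1 n) (Mpiece V M2 n)
            \<longrightarrow> vmod_iso M1 M2)
       \<and> (\<forall>U :: ('k, 'v, 'u::ab_group_add) amod. simple_amod V n U \<and> \<not> factors_prev V n U \<longrightarrow>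
            (\<exists>L :: ('k, 'v, 'v \<times> int \<times> 'u \<Rightarrow> 'k) vmod.
               msc L = (\<lambda>c f x. c * f x) \<and> is_vmod V L \<and> irreducible_vmod V L
               \<and> mgr L 0 \<noteq> {0} \<and> amod_iso (Mpiece V L n) U))"
proof (intro conjI allI impI; (elim conjE)?)
  fix M :: "('k, 'v, 'm) vmod" assume M: "good_vmod V n M"
  then interpret vmodl V M by unfold_locales (simp_all add: good_vmod_def assms(3))
  show "simple_amod V n (Mpiece V M n)" using M by (simp add: good_vmod_def simple_Mpiece)
  show "\<not> factors_prev V n (Mpiece V M n)" using M by (simp add: good_vmod_def Mpiece_not_factors)
next
  fix M1 :: "('k, 'v, 'm1) vmod" and M2 :: "('k, 'v, 'm2) vmod"
  assume g: "good_vmod V n M1" "good_vmod V n M2" and iso: "amod_iso (Mpiece V M1 n) (Mpiece V M2 n)"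
  interpret two_vmods V M1 M2
    by unfold_locales (use g assms(3) in \<open>simp_all add: good_vmod_def\<close>)
  show "vmod_iso M1 M2" by (rule uniqueness[OF _ _ _ _ iso]) (use g in \<open>simp_all add: good_vmod_def\<close>)
next
  fix U :: "('k, 'v, 'u) amod" assume U: "simple_amod V n U" "\<not> factors_prev V n U"
  have "is_amod V n U" using U(1) unfolding simple_amod_def by blast
  then interpret simple_amodl V n U
    by unfold_locales (use U(1) assms(3) in blast)+
  \<comment> \<open>A basis of the whole value type turns a functional into the scalar function of
    (b, w) that gives the w-coordinate of its value at b. The integer slot of the required type is
    filled at 0 only.\<close>
  define B where "B = us.extend_basis {}"
  have B: "us.independent B" "us.span B = UNIV"
    unfolding B_def by (simp_all add: us.independent_extend_basis us.span_extend_basis us.independent_empty)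
  have vf: "vector_space (\<lambda>(c::'k) (f :: 'v \<times> int \<times> 'u \<Rightarrow> 'k) x. c * f x)"
    by unfold_locales (simp_all add: fun_eq_iff algebra_simps)
  define \<tau> :: "('v \<Rightarrow> 'u) \<Rightarrow> 'v \<times> int \<times> 'u \<Rightarrow> 'k" where
    "\<tau> \<phi> = (\<lambda>(b, j, w). if j = 0 then us.representation B (\<phi> b) w else 0)" for \<phi>
  have rep_inj: "x = y" if "us.representation B x = us.representation B y" for x y
  proof -
    have "x = (\<Sum>b | us.representation B x b \<noteq> 0. usc U (us.representation B x b) b)"
      by (rule us.sum_nonzero_representation_eq[OF B(1), symmetric]) (simp add: B(2))
    also have "\<dots> = y"
      unfolding that by (rule us.sum_nonzero_representation_eq[OF B(1)]) (simp add: B(2))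
    finally show "x = y" .
  qed
  interpret LM: transport V LM "\<lambda>(c::'k) f x. c * f x" \<tau>
  proof -
    interpret vf: vector_space "\<lambda>(c::'k) (f :: 'v \<times> int \<times> 'u \<Rightarrow> 'k) x. c * f x" by (rule vf)
    show "transport V LM (\<lambda>(c::'k) f x. c * f x) \<tau>"
    proof unfold_locales
      show "is_vmod V LM" by (rule is_vmod_LM)
      show "inj \<tau>"
      proof (rule injI)
        fix x y assume "\<tau> x = \<tau> y"
        then have "\<tau> x (b, 0, w) = \<tau> y (b, 0, w)" for b w by simp
        then have "us.representation B (x b) = us.representation B (y b)" for b by (auto simp: \<tau>_def)
        then show "x = y" using rep_inj by blast
      qed
      show "\<tau> (x + y) = \<tau> x + \<tau> y" for x y
        using us.representation_add[OF B(1)] B(2) by (auto simp: \<tau>_def fun_eq_iff)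
      show "\<tau> (msc LM c x) = (\<lambda>z. c * \<tau> x z)" for c x
        using us.representation_scale[OF B(1)] B(2) by (auto simp: \<tau>_def fun_eq_iff sc_apply)
    qed
  qed
  show "\<exists>L :: ('k, 'v, 'v \<times> int \<times> 'u \<Rightarrow> 'k) vmod.
               msc L = (\<lambda>c f x. c * f x) \<and> is_vmod V L \<and> irreducible_vmod V L
               \<and> mgr L 0 \<noteq> {0} \<and> amod_iso (Mpiece V L n) U"
  proof (intro exI[of _ LM.copy] conjI)
    show "msc LM.copy = (\<lambda>c f x. c * f x)" by simp
    show "is_vmod V LM.copy" by (rule LM.is_vmod_copy)
    show "irreducible_vmod V LM.copy" by (rule LM.irreducible_copy[OF irreducible_LM])
    show "amod_iso (Mpiece V LM.copy n) U" by (rule LM.Mpiece_copy_iso[OF Mpiece_LM_iso])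
    have "0 \<in> Lgr 0" by (rule gm.vs.subspace_0[OF subspace_Lgr])
    then obtain x where "x \<in> Lgr 0" "x \<noteq> 0" using LM_0_nonzero[OF U(2)] by blast
    then have "\<tau> x \<in> mgr LM.copy 0" "\<tau> x \<noteq> 0" by simp_all
    then show "mgr LM.copy 0 \<noteq> {0}" by blast
  qed
qed

end
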